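(* Let $r\in\,]0,1[$ and let $\lambda\in\mathrm{QI}$. The fundamental solution $f_\delta$ belongs to $\mathcal G_2(\lambda,B_r)$; let $\tilde f=J_\lambda(f_\delta)=\sum_{n\ge0}F_nQ^n\in B_r[[Q]]$ be its asymptotic expansion at $\lambda$, and let $$\hat F(\xi,z)=\sum_{n\ge0}F_n(z)\frac{\xi^{2n}}{(2n)!}\in\mathbb C\{\xi,z\}.$$ For $z\in\mathbb D_r$ let $\mathrm{REC}_\lambda(z)$ be the rectangle of all $\xi\in\mathbb C$ such that $$\big|\mathrm{Re}\big((2\pi i\lambda)^{-1/2}\xi\big)\big|<\kappa_+(\lambda)\log\tfrac1{|z|}\quad\text{and}\quad\big|\mathrm{Im}\big((2\pi i\lambda)^{-1/2}\xi\big)\big|<\kappa_-(\lambda)\log\tfrac1{|z|}.$$ (a) The holomorphic germ $\hat F$ extends analytically to the set $\{(\xi,z)\in\mathbb C\times\mathbb D_r:\ \xi\in\mathrm{REC}_\lambda(z)\}$. (b) For each $z\in\mathbb D_r$, $\partial(\mathrm{REC}_\lambda(z))$ is a natural boundary for the analytic function $\xi\mapsto\hat F(\xi,z)$. (c) Suppose that $\{M_n\}_{n\ge0}$ is a non-decreasing sequence of positive numbers such that $f_\delta\in\mathcal C^-(\lambda,\{M_n\},B_r)$ or $f_\delta\in\mathcal C^+(\lambda,\{M_n\},B_r)$. Then $\mathcal C^\pm(\lambda,\{M_n\},B_r)$ is not quasianalytic at $\lambda$.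
   Context: $\mathbb D=\{|q|<1\}$, $\mathbb E=\{|q|>1\}$, $\mathbb S^1=\{|q|=1\}$, $\mathbb D_r=\{|z|<r\}$. $B_r$ is the Banach space of bounded holomorphic functions on $\mathbb D_r$ vanishing at $0$, with the sup norm. **Fundamental solution.** $f_\delta(q,z)=\sum_{n\ge1}\frac{z^n}{q^n-1}$, viewed as the function $q\mapsto f_\delta(q,\cdot)\in B_r$ on $\mathbb D\cup\mathbb E$. **Carleman classes.** For a Banach space $B$, $\lambda\in\mathbb S^1$ and a sequence $\{M_n\}_{n\ge0}$ of positive numbers, $\mathcal C^-(\lambda,\{M_n\},B)$ is the space of $B$-valued functions $f$ for which there exist an open disk $\Delta\subset\mathbb D$ tangent to $\mathbb S^1$ at $\lambda$ on which $f$ is holomorphic, a formal series $\sum a_nQ^n\in B[[Q]]$ and $c_0,c_1>0$ with $\|f(q)-\sum_{0\le n\le N-1}a_n(q-\lambda)^n\|\le c_0c_1^NM_N|q-\lambda|^N$ for all $N\ge0$, $q\in\Delta$. $\mathcal C^+(\lambda,\{M_n\},B)$ is defined in the same way with $\Delta\subset\mathbb E$. $J^\pm_\lambda$ denotes the map sending $f$ to its asymptotic expansion $\sum a_nQ^n$; the class $\mathcal C^\pm(\lambda,\{M_n\},B)$ is quasianalytic at $\lambda$ if $J^\pm_\lambda$ is injective on it (two functions in the class with the same expansion coincide near $\lambda$, on a common disk of the type above). (The change of variable $q\mapsto\lambda^2/q$ induces an isomorphism between $\mathcal C^-(\lambda,\{M_n\},B)$ and $\mathcal C^+(\lambda,\{M_n\},B)$.)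 $\mathcal G_2(\lambda,B)$ is the space of functions $f$ which, for $M_n=\Gamma(1+2n)$, restrict to elements of $\mathcal C^-(\lambda,\{M_n\},B)$ and of $\mathcal C^+(\lambda,\{M_n\},B)$ with the same asymptotic expansion, denoted $J_\lambda(f)$. **Quadratic irrationals and Lagrange constants.** $\mathrm{QI}$ is the set of $\lambda=e^{2\pi i\alpha}$ with $\alpha$ (say in $]0,1[$) real, irrational and algebraic of degree $2$. For such $\lambda$, $\nu_\pm(\lambda)>0$ are defined by $$\frac1{\nu_-(\lambda)}=-\liminf_{(D,N)\in\mathbb N^*\times\mathbb Z}\Big\{D^{-2}\big(\tfrac ND-\alpha\big)^{-1}\Big\},\qquad\frac1{\nu_+(\lambda)}=\limsup_{(D,N)\in\mathbb N^*\times\mathbb Z}\Big\{D^{-2}\big(\tfrac ND-\alpha\big)^{-1}\Big\},$$ and $\kappa_\pm(\lambda)=(\nu_\pm(\lambda))^{1/2}$. For $z=0$ one has $\log\frac1{|z|}=+\infty$, the rectangle is $\mathbb C$ and (b) is vacuous. The choice of the square root $(2\pi i\lambda)^{1/2}$ is immaterial. *)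

theory Defs
  imports "HOL-Complex_Analysis.Complex_Analysis"
begin

definition inner_disc :: "complex set" where
  "inner_disc = {q. norm q < 1}"

definition outer_disc :: "complex set" where
  "outer_disc = {q. norm q > 1}"

text \<open>
  The elements are functions on the disc of radius \<open>r\<close>; they are represented by total
  functions with value 0 off the disc, so that equality in the space is equality in HOL.
\<close>

definition B_space :: "real \<Rightarrow> (complex \<Rightarrow> complex) set" where
  "B_space r = {g. g holomorphic_on ball 0 r \<and> bounded (g ` ball 0 r) \<and> g 0 = 0 \<and>
                   (\<forall>z. z \<notin> ball 0 r \<longrightarrow> g z = 0)}"

definition B_norm :: "real \<Rightarrow> (complex \<Rightarrow> complex) \<Rightarrow> real" where
  "B_norm r g = (SUP z\<in>ball 0 r. norm (g z))"

definition B_holomorphic_on :: "real \<Rightarrow> (complex \<Rightarrow> complex \<Rightarrow> complex) \<Rightarrow> complex set \<Rightarrow> bool" where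
  "B_holomorphic_on r f U \<longleftrightarrow>
     (\<forall>q\<in>U. f q \<in> B_space r \<and>
        (\<exists>d\<in>B_space r. ((\<lambda>h. B_norm r (\<lambda>z. (f (q + h) z - f q z) / h - d z)) \<longlongrightarrow> 0) (at 0)))"

definition f_delta :: "real \<Rightarrow> complex \<Rightarrow> complex \<Rightarrow> complex" where
  "f_delta r q z = (if z \<in> ball 0 r then (\<Sum>n. z ^ Suc n / (q ^ Suc n - 1)) else 0)"

text \<open>
  Throughout, \<open>U\<close> is \<^const>\<open>inner_disc\<close> for the classes with superscript minus and
  \<^const>\<open>outer_disc\<close> for those with superscript plus, and \<open>lam\<close> is a point of the unit circle.
  A circle through \<open>lam\<close> is tangent to the unit circle there iff its centre lies on the
  line through 0 and \<open>lam\<close>.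
\<close>

definition tangent_disk :: "complex set \<Rightarrow> complex \<Rightarrow> complex set \<Rightarrow> bool" where
  "tangent_disk U lam \<Delta> \<longleftrightarrow>
     (\<exists>t::real. t \<noteq> 0 \<and> \<Delta> = ball (lam + t *\<^sub>R lam) \<bar>t\<bar> \<and> \<Delta> \<subseteq> U)"

definition carleman_expansion ::
  "complex set \<Rightarrow> complex \<Rightarrow> (nat \<Rightarrow> real) \<Rightarrow> real \<Rightarrow> (complex \<Rightarrow> complex \<Rightarrow> complex)
     \<Rightarrow> (nat \<Rightarrow> complex \<Rightarrow> complex) \<Rightarrow> bool" where
  "carleman_expansion U lam M r f a \<longleftrightarrow>
     (\<forall>n. a n \<in> B_space r) \<and>
     (\<exists>\<Delta> c0 c1. tangent_disk U lam \<Delta> \<and> B_holomorphic_on r f \<Delta> \<and> 0 < c0 \<and> 0 < c1 \<and>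
        (\<forall>N. \<forall>q\<in>\<Delta>.
           B_norm r (\<lambda>z. f q z - (\<Sum>n<N. a n z * (q - lam) ^ n))
             \<le> c0 * c1 ^ N * M N * norm (q - lam) ^ N))"

definition carleman_class ::
  "complex set \<Rightarrow> complex \<Rightarrow> (nat \<Rightarrow> real) \<Rightarrow> real \<Rightarrow> (complex \<Rightarrow> complex \<Rightarrow> complex) set" where
  "carleman_class U lam M r = {f. \<exists>a. carleman_expansion U lam M r f a}"

definition asym_exp ::
  "complex set \<Rightarrow> complex \<Rightarrow> (nat \<Rightarrow> real) \<Rightarrow> real \<Rightarrow> (complex \<Rightarrow> complex \<Rightarrow> complex)
     \<Rightarrow> nat \<Rightarrow> complex \<Rightarrow> complex" where
  "asym_exp U lam M r f = (THE a. carleman_expansion U lam M r f a)"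

definition quasianalytic :: "complex set \<Rightarrow> complex \<Rightarrow> (nat \<Rightarrow> real) \<Rightarrow> real \<Rightarrow> bool" where
  "quasianalytic U lam M r \<longleftrightarrow>
     (\<forall>f\<in>carleman_class U lam M r. \<forall>g\<in>carleman_class U lam M r.
        asym_exp U lam M r f = asym_exp U lam M r g \<longrightarrow>
        (\<exists>\<Delta>. tangent_disk U lam \<Delta> \<and> (\<forall>q\<in>\<Delta>. f q = g q)))"

definition gevrey2_expansion ::
  "complex \<Rightarrow> real \<Rightarrow> (complex \<Rightarrow> complex \<Rightarrow> complex) \<Rightarrow> (nat \<Rightarrow> complex \<Rightarrow> complex) \<Rightarrow> bool" where
  "gevrey2_expansion lam r f a \<longleftrightarrow>
     carleman_expansion inner_disc lam (\<lambda>n. Gamma (1 + 2 * real n)) r f a \<and>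
     carleman_expansion outer_disc lam (\<lambda>n. Gamma (1 + 2 * real n)) r f a"

definition gevrey2_class :: "complex \<Rightarrow> real \<Rightarrow> (complex \<Rightarrow> complex \<Rightarrow> complex) set" where
  "gevrey2_class lam r = {f. \<exists>a. gevrey2_expansion lam r f a}"

definition gevrey2_exp ::
  "complex \<Rightarrow> real \<Rightarrow> (complex \<Rightarrow> complex \<Rightarrow> complex) \<Rightarrow> nat \<Rightarrow> complex \<Rightarrow> complex" where
  "gevrey2_exp lam r f = (THE a. gevrey2_expansion lam r f a)"

definition quadratic_irrational :: "real \<Rightarrow> bool" where
  "quadratic_irrational \<alpha> \<longleftrightarrow> \<alpha> \<notin> \<rat> \<and>
     (\<exists>p::rat poly. irreducible p \<and> degree p = 2 \<and> poly (map_poly of_rat p) \<alpha> = 0)"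

definition QI :: "complex set" where
  "QI = {exp (2 * of_real pi * \<i> * of_real \<alpha>) | \<alpha>::real.
           0 < \<alpha> \<and> \<alpha> < 1 \<and> quadratic_irrational \<alpha>}"

definition angle :: "complex \<Rightarrow> real" where
  "angle lam = (THE \<alpha>. 0 < \<alpha> \<and> \<alpha> < 1 \<and> lam = exp (2 * of_real pi * \<i> * of_real \<alpha>))"

text \<open>
  The lower and upper limits over pairs \<open>(D, N)\<close> with \<open>D \<ge> 1\<close> are taken along the
  complements of finite sets of pairs.
\<close>

definition approx_filter :: "(nat \<times> int) filter" where
  "approx_filter = inf cofinite (principal ({1..} \<times> UNIV))"

definition approx_quality :: "real \<Rightarrow> nat \<times> int \<Rightarrow> ereal" where
  "approx_quality \<alpha> = (\<lambda>(D, N). ereal (inverse ((real D)\<^sup>2) * inverse (of_int N / real D - \<alpha>)))"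

definition nu_minus :: "complex \<Rightarrow> real" where
  "nu_minus lam = 1 / real_of_ereal (- Liminf approx_filter (approx_quality (angle lam)))"

definition nu_plus :: "complex \<Rightarrow> real" where
  "nu_plus lam = 1 / real_of_ereal (Limsup approx_filter (approx_quality (angle lam)))"

definition kappa_minus :: "complex \<Rightarrow> real" where
  "kappa_minus lam = sqrt (nu_minus lam)"

definition kappa_plus :: "complex \<Rightarrow> real" where
  "kappa_plus lam = sqrt (nu_plus lam)"

text \<open>For \<open>z = 0\<close> the side lengths are infinite and the rectangle is the whole plane.\<close>

definition REC :: "complex \<Rightarrow> complex \<Rightarrow> complex set" where
  "REC lam z = {\<xi>. z \<noteq> 0 \<longrightarrow>
      \<bar>Re (\<xi> / csqrt (2 * of_real pi * \<i> * lam))\<bar> < kappa_plus lam * ln (1 / norm z) \<and>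
      \<bar>Im (\<xi> / csqrt (2 * of_real pi * \<i> * lam))\<bar> < kappa_minus lam * ln (1 / norm z)}"

text \<open>Real differentiability with a complex-linear derivative, at every point of \<open>W\<close>.\<close>

definition holomorphic2_on :: "(complex \<times> complex \<Rightarrow> complex) \<Rightarrow> (complex \<times> complex) set \<Rightarrow> bool" where
  "holomorphic2_on G W \<longleftrightarrow>
     (\<forall>p\<in>W. \<exists>a b. (G has_derivative (\<lambda>(h, k). a * h + b * k)) (at p))"

text \<open>
  No continuation across any boundary point. For convex \<open>U\<close> the intersection of \<open>U\<close>
  with a disc is connected, so that the continuation has to agree with \<open>f\<close> on all of it.
\<close>

definition natural_boundary :: "(complex \<Rightarrow> complex) \<Rightarrow> complex set \<Rightarrow> bool" where
  "natural_boundary f U \<longleftrightarrow>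
     (\<forall>p\<in>frontier U. \<not> (\<exists>\<rho>>0. \<exists>g. g holomorphic_on ball p \<rho> \<and>
        (\<forall>x\<in>ball p \<rho> \<inter> U. g x = f x)))"

end

theory Submission
  imports Defs "HOL-Real_Asymp.Real_Asymp"
begin

text \<open>
  The partial fractions \<open>1 / (q^k - 1) = (1 / k) \<Sum> L / (q - L)\<close> over the \<open>k\<close>-th roots of unity \<open>L\<close>
  express \<open>f_delta\<close>, its expansion at \<open>lam\<close> and the continued germ as sums over roots of unity; the
  latter is \<open>G(\<xi>, z) = - \<Sum> (z^k / k) \<Sum> L / (L - lam) * cosh (\<xi> / sqrt (L - lam))\<close>. For
  \<open>L = exp (2 pi i j / k)\<close> put \<open>x = j / k - \<alpha>\<close>, so that \<open>L - lam\<close> is close to \<open>2 pi i lam x\<close>. With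
  \<open>w = \<xi> / sqrt (2 pi i lam)\<close> the summand grows like \<open>|z|^k exp (|Re w| / sqrt x)\<close> for \<open>x > 0\<close> and like
  \<open>|z|^k exp (|Im w| / sqrt |x|)\<close> for \<open>x < 0\<close>, and \<open>k^2 |x|\<close> is asymptotically at least the Lagrange
  constant of the corresponding side: this gives convergence in the rectangle.

  Near an open side the only terms that do not converge across it are those with \<open>k^2 |x|\<close> close to
  the Lagrange constant. Since distinct fractions with denominators \<open>k\<close>, \<open>k'\<close> differ by at least
  \<open>1 / (k k')\<close>, their frequencies \<open>1 / sqrt |x|\<close> have Hadamard gaps, so the side is a natural boundary.

  For the last claim, Dirichlet's theorem gives for each \<open>n\<close> a denominator \<open>k\<close> comparable to \<open>n\<close> with
  \<open>|x| < 1 / (n k)\<close>; the coefficient of \<open>z^k\<close> in \<open>F_n\<close> shows that \<open>M n\<close> is at least of the order of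
  \<open>c^n (2 n)!\<close>, and then \<open>exp (- sqrt (\<plusminus> lam / (q - lam)))\<close> is a flat function in the class.
\<close>

section \<open>Power series in the Banach space\<close>

text \<open>The frequencies of the lacunary part are neither integers nor real, because
  \<open>L - lam\<close> is linear in x only to first order, so the classical gap theorem for power
  series does not apply. They do lie at a bounded distance from the positive reals, which changes
  each exponential by a locally bounded factor. The gap theorem can therefore be proved directly: in
  the n-th derivative at -1 a frequency b carries the weight b^n exp (-b), whose peak at b = n is
  sharp enough to single out one frequency.

  Continuation across a side would thus force the terms at a boundary point to decay exponentially
  in their frequency. The Lagrange constant is a lower limit, hence approached by infinitely many
  fractions, and their terms decay more slowly than any prescribed exponential; this is the
  contradiction.

  The exponent 2 in k^2 |x| is responsible both for the growth (2 n)! of the coefficients and for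
  the square root in the flat function. Quadratic irrationality enters as the inequality
  \<open>badly_approx\<close>, which makes both Lagrange constants positive and finite.\<close>

definition pser :: "real \<Rightarrow> (nat \<Rightarrow> complex) \<Rightarrow> complex \<Rightarrow> complex" where
  "pser r c z = (if z \<in> ball 0 r then (\<Sum>n. c n * z ^ Suc n) else 0)"

text \<open>Summability at the radius \<open>r\<close> itself is what bounds the sup norm by a sum
  over coefficients.\<close>

abbreviation asum :: "real \<Rightarrow> (nat \<Rightarrow> complex) \<Rightarrow> bool" where
  "asum r c \<equiv> summable (\<lambda>n. norm (c n) * r ^ Suc n)"

lemma asum_norm_summable:
  assumes "asum r c" "norm z < r"
  shows "summable (\<lambda>n. norm (c n * z ^ Suc n))"
  by (rule summable_comparison_test'[OF assms(1), of 0])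
     (use assms in \<open>auto simp: norm_mult norm_power simp del: power_Suc intro!: mult_left_mono power_mono\<close>)

lemma pser_sums:
  assumes "asum r c" "norm z < r"
  shows "(\<lambda>n. c n * z ^ Suc n) sums pser r c z"
  using summable_sums[OF summable_norm_cancel[OF asum_norm_summable[OF assms]]] assms(2)
  by (simp add: pser_def)

lemma norm_pser_le:
  assumes "asum r c" "0 < r"
  shows "norm (pser r c z) \<le> (\<Sum>n. norm (c n) * r ^ Suc n)"
proof (cases "norm z < r")
  case True
  have "norm (pser r c z) \<le> (\<Sum>n. norm (c n * z ^ Suc n))"
    using summable_norm[OF asum_norm_summable[OF assms(1) True]] True by (simp add: pser_def)
  also have "\<dots> \<le> (\<Sum>n. norm (c n) * r ^ Suc n)"
    by (rule suminf_le[OF _ asum_norm_summable[OF assms(1) True] assms(1)])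
       (use True in \<open>auto simp: norm_mult norm_power simp del: power_Suc intro!: mult_left_mono power_mono\<close>)
  finally show ?thesis .
next
  case False
  then show ?thesis using assms by (simp add: pser_def suminf_nonneg)
qed

lemma B_norm_leI:
  assumes "0 < r" "\<And>z. z \<in> ball 0 r \<Longrightarrow> norm (g z) \<le> K"
  shows "B_norm r g \<le> K"
  unfolding B_norm_def using assms by (intro cSUP_least) auto

lemma B_norm_pser_le:
  assumes "asum r c" "0 < r"
  shows "B_norm r (pser r c) \<le> (\<Sum>n. norm (c n) * r ^ Suc n)"
  using B_norm_leI norm_pser_le assms by metis

lemma norm_le_B_norm:
  assumes "bounded (g ` ball 0 r)" "z \<in> ball 0 r"
  shows "norm (g z) \<le> B_norm r g"
proof -
  obtain K where "\<forall>x\<in>g ` ball 0 r. norm x \<le> K" using assms(1) by (auto simp: bounded_iff)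
  then have "bdd_above ((\<lambda>z. norm (g z)) ` ball 0 r)" by (auto intro!: bdd_aboveI)
  then show ?thesis unfolding B_norm_def by (rule cSUP_upper[OF assms(2)])
qed

lemma pser_power_series:
  assumes "asum r c" "norm z < r"
  shows "(\<lambda>n. (if n = 0 then 0 else c (n - 1)) * (z - 0) ^ n) sums pser r c z"
  using pser_sums[OF assms] sums_Suc_iff[of "\<lambda>n. (if n = 0 then 0 else c (n - 1)) * (z - 0) ^ n" "pser r c z"]
  by simp

lemma pser_holomorphic:
  assumes "asum r c" shows "pser r c holomorphic_on ball 0 r"
  by (rule power_series_holomorphic) (use pser_power_series[OF assms] in auto)

lemma pser_in_B_space:
  assumes "asum r c" "0 < r" shows "pser r c \<in> B_space r"
  unfolding B_space_def using pser_holomorphic[OF assms(1)] norm_pser_le[OF assms]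
  by (auto simp: bounded_iff pser_def[of r c 0]) (auto simp: pser_def)

text \<open>Cauchy's inequality on the circle of radius r / 2. It lets a bound on the values control
  one chosen coefficient.\<close>

lemma pser_coeff:
  assumes "asum r c" "0 < r" and K: "\<And>z. norm z < r \<Longrightarrow> norm (pser r c z) \<le> K"
  shows "norm (c n) * (r / 2) ^ Suc n \<le> K"
proof -
  have hol: "pser r c holomorphic_on ball 0 r" by (rule pser_holomorphic[OF assms(1)])
  have "pser r c has_fps_expansion Abs_fps (\<lambda>n. if n = 0 then 0 else c (n - 1))"
    by (rule has_fps_expansionI, rule eventually_nhds_in_open[of "ball 0 r", THEN eventually_mono])
       (use pser_power_series[OF assms(1)] assms(2) in auto)
  from fps_nth_fps_expansion[OF this, of "Suc n"]
  have c: "c n = (deriv ^^ Suc n) (pser r c) 0 / fact (Suc n)" by simp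
  have "norm ((deriv ^^ Suc n) (pser r c) 0) \<le> fact (Suc n) * K / (r / 2) ^ Suc n"
  proof (rule Cauchy_inequality)
    show "pser r c holomorphic_on ball 0 (r/2)"
      by (rule holomorphic_on_subset[OF hol]) (use assms(2) in auto)
    show "continuous_on (cball 0 (r/2)) (pser r c)"
      by (rule holomorphic_on_imp_continuous_on, rule holomorphic_on_subset[OF hol]) (use assms(2) in auto)
  qed (use assms(2) K in auto)
  then show ?thesis using assms(2) unfolding c norm_divide norm_fact
    by (simp add: field_simps del: fact_Suc power_Suc)
qed

text \<open>Turns a Taylor remainder in the Banach space into a single power series, to be estimated
  coefficient by coefficient; \<open>x i\<close> will be the powers of
  \<open>q - lam\<close>.\<close>

lemma pser_sum_diff:
  assumes "asum r a" "\<And>i. i < N \<Longrightarrow> asum r (b i)" 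
  shows "pser r a z - (\<Sum>i<N. pser r (b i) z * x i) = pser r (\<lambda>n. a n - (\<Sum>i<N. b i n * x i)) z"
proof (cases "norm z < r")
  case True
  have "(\<lambda>n. a n * z ^ Suc n - (\<Sum>i<N. b i n * z ^ Suc n * x i)) sums (pser r a z - (\<Sum>i<N. pser r (b i) z * x i))"
    using pser_sums[OF assms(1) True] pser_sums[OF assms(2) True]
    by (intro sums_diff sums_sum sums_mult2) auto
  also have "(\<lambda>n. a n * z ^ Suc n - (\<Sum>i<N. b i n * z ^ Suc n * x i)) =
      (\<lambda>n. (a n - (\<Sum>i<N. b i n * x i)) * z ^ Suc n)"
    by (simp add: algebra_simps sum_distrib_left)
  finally show ?thesis using True by (simp add: pser_def sums_iff)
qed (simp add: pser_def)

text \<open>\<open>B_norm\<close> is a supremum of reals and is informative only for bounded sets,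
  so boundedness of the remainder must be known before its values can be compared with the
  norm.\<close>

lemma norm_le_B_norm_diff:
  assumes "g \<in> B_space r" "\<And>n. a n \<in> B_space r" "z \<in> ball 0 r"
  shows "norm (g z - (\<Sum>n<N. a n z * x n)) \<le> B_norm r (\<lambda>z. g z - (\<Sum>n<(N::nat). a n z * x n))"
proof (rule norm_le_B_norm[where g = "\<lambda>z. g z - (\<Sum>n<N. a n z * x n)", OF _ assms(3)])
  have "\<exists>K. \<forall>z\<in>ball 0 r. norm (h z) \<le> K" if "h \<in> B_space r" for h
    using that by (auto simp: B_space_def bounded_iff)
  then obtain K where K: "\<And>h z. h \<in> B_space r \<Longrightarrow> z \<in> ball 0 r \<Longrightarrow> norm (h z) \<le> K h" by metis
  have "norm (g z - (\<Sum>n<N. a n z * x n)) \<le> K g + (\<Sum>n<N. K (a n) * norm (x n))" if "z \<in> ball 0 r" for z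
    by (intro order.trans[OF norm_triangle_ineq4] add_mono order.trans[OF norm_sum] sum_mono K that assms)
       (use K[OF assms(2) that] in \<open>auto simp: norm_mult intro!: mult_right_mono\<close>)
  then show "bounded ((\<lambda>z. g z - (\<Sum>n<N. a n z * x n)) ` ball 0 r)"
    by (intro boundedI[of _ "K g + (\<Sum>n<N. K (a n) * norm (x n))"]) auto
qed

section \<open>Carleman expansions and flat functions\<close>

text \<open>\<open>\<tau>\<close> is the direction of the centre of the tangent disc seen from
  \<open>lam\<close>: -1 towards the origin, 1 away from it. It lets both classes share one
  proof.\<close>

definition disk_side :: "complex set \<Rightarrow> real \<Rightarrow> bool" where
  "disk_side U \<tau> \<longleftrightarrow> (U = inner_disc \<and> \<tau> = -1) \<or> (U = outer_disc \<and> \<tau> = 1)"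

abbreviation tdisk :: "complex \<Rightarrow> real \<Rightarrow> real \<Rightarrow> complex set" where
  "tdisk lam \<tau> s \<equiv> ball (lam + (\<tau> * s) *\<^sub>R lam) s"

lemma disk_side_abs: "disk_side U \<tau> \<Longrightarrow> \<bar>\<tau>\<bar> = 1"
  by (auto simp: disk_side_def)

lemma tangent_diskD:
  assumes "tangent_disk U lam \<Delta>" "disk_side U \<tau>" "norm lam = 1"
  obtains s where "0 < s" "\<Delta> = tdisk lam \<tau> s"
proof -
  obtain t where t: "t \<noteq> 0" "\<Delta> = ball (lam + t *\<^sub>R lam) \<bar>t\<bar>" "\<Delta> \<subseteq> U"
    using assms(1) by (auto simp: tangent_disk_def)
  \<comment> \<open>A test point of the disc on the axis through \<open>lam\<close>, meant to reveal
    the sign of \<open>t\<close>. For negative \<open>t\<close> the cut at 1/2 keeps it inside the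
    unit disc, which the centre itself may leave.\<close>
  define u where "u = (if t > 0 then t else - min \<bar>t\<bar> (1/2))"
  have "dist (lam + t *\<^sub>R lam) (lam + u *\<^sub>R lam) = \<bar>t - u\<bar>"
    using assms(3) by (simp add: dist_norm flip: scaleR_diff_left)
  also have "\<dots> < \<bar>t\<bar>" using t(1) by (auto simp: u_def min_def)
  finally have "lam + u *\<^sub>R lam \<in> U" using t by auto
  moreover have "norm (lam + u *\<^sub>R lam) = \<bar>1 + u\<bar>"
    using assms(3) by (metis norm_scaleR mult.right_neutral scaleR_left.add scaleR_one)
  ultimately have "0 < \<tau> * t"
    using assms(2) t(1) by (auto simp: u_def min_def disk_side_def inner_disc_def outer_disc_def split: if_splits)
  then have "\<Delta> = tdisk lam \<tau> (\<tau> * t)" "0 < \<tau> * t"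
    using t(2) assms(2) by (auto simp: disk_side_def)
  then show ?thesis using that by blast
qed

lemma tangent_disk_tdisk:
  assumes "disk_side U \<tau>" "norm lam = 1" "0 < s" "s \<le> 1/2"
  shows "tangent_disk U lam (tdisk lam \<tau> s)"
proof -
  have n: "norm (lam + (\<tau> * s) *\<^sub>R lam) = \<bar>1 + \<tau> * s\<bar>"
    using assms(2) by (metis norm_scaleR mult.right_neutral scaleR_left.add scaleR_one)
  have "tdisk lam \<tau> s \<subseteq> U"
  proof
    fix q assume "q \<in> tdisk lam \<tau> s"
    then have "norm (lam + (\<tau> * s) *\<^sub>R lam - q) < s" by (simp add: dist_norm)
    then show "q \<in> U"
      using norm_triangle_ineq2[of "lam + (\<tau> * s) *\<^sub>R lam" q] norm_triangle_ineq2[of q "lam + (\<tau> * s) *\<^sub>R lam"]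
        n assms by (auto simp: disk_side_def inner_disc_def outer_disc_def norm_minus_commute)
  qed
  then show ?thesis unfolding tangent_disk_def
    using assms disk_side_abs[OF assms(1)] by (intro exI[of _ "\<tau> * s"]) (auto simp: abs_mult)
qed

lemma tdisk_axis_mem:
  assumes "\<bar>\<tau>\<bar> = 1" "norm lam = 1" "0 < u" "u < 2 * s"
  shows "lam + (\<tau> * u) *\<^sub>R lam \<in> tdisk lam \<tau> s"
proof -
  have "dist (lam + (\<tau> * s) *\<^sub>R lam) (lam + (\<tau> * u) *\<^sub>R lam) = \<bar>\<tau> * (s - u)\<bar>"
    using assms(2) by (simp add: dist_norm right_diff_distrib flip: scaleR_diff_left)
  then show ?thesis using assms by (simp add: abs_mult)
qed

lemma carleman_expansionE:
  assumes "carleman_expansion U lam M r f a" "disk_side U \<tau>" "norm lam = 1"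
  obtains s c0 c1 where "0 < s" "0 < c0" "0 < c1" "\<And>n. a n \<in> B_space r"
    "\<And>N q z. q \<in> tdisk lam \<tau> s \<Longrightarrow> z \<in> ball 0 r \<Longrightarrow>
       norm (f q z - (\<Sum>n<N. a n z * (q - lam) ^ n)) \<le> c0 * c1 ^ N * M N * norm (q - lam) ^ N"
proof -
  obtain \<Delta> c0 c1 where D: "tangent_disk U lam \<Delta>" "B_holomorphic_on r f \<Delta>" "0 < c0" "0 < c1"
    and a: "\<And>n. a n \<in> B_space r"
    and b: "\<And>N q. q \<in> \<Delta> \<Longrightarrow> B_norm r (\<lambda>z. f q z - (\<Sum>n<N. a n z * (q - lam) ^ n))
             \<le> c0 * c1 ^ N * M N * norm (q - lam) ^ N"
    using assms(1) unfolding carleman_expansion_def by blast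
  obtain s where s: "0 < s" "\<Delta> = tdisk lam \<tau> s" using tangent_diskD[OF D(1) assms(2,3)] .
  have "norm (f q z - (\<Sum>n<N. a n z * (q - lam) ^ n)) \<le> c0 * c1 ^ N * M N * norm (q - lam) ^ N"
    if "q \<in> tdisk lam \<tau> s" "z \<in> ball 0 r" for N q z
  proof -
    have q: "q \<in> \<Delta>" using that(1) s(2) by simp
    have "f q \<in> B_space r" using D(2) q by (auto simp: B_holomorphic_on_def)
    from norm_le_B_norm_diff[where a = a, OF this a that(2), where N = N and x = "\<lambda>n. (q - lam) ^ n"] b[OF q, of N]
    show ?thesis by linarith
  qed
  then show ?thesis using that[OF s(1) D(3,4) a] by blast
qed

section \<open>Coefficient bounds and uniqueness of asymptotic expansions\<close>

lemma le_of_le_add_small: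
  fixes x A K u0 :: real
  assumes "0 < u0" "\<And>u. 0 < u \<Longrightarrow> u < u0 \<Longrightarrow> x \<le> A + K * u"
  shows "x \<le> A"
proof (rule tendsto_lowerbound)
  show "((\<lambda>u. A + K * u) \<longlongrightarrow> A) (at_right 0)" by (auto intro!: tendsto_eq_intros)
  show "eventually (\<lambda>u. x \<le> A + K * u) (at_right 0)"
    unfolding eventually_at_right_field using assms by blast
qed auto

text \<open>Two consecutive remainders differ by \<open>a n\<close> times the n-th power of
  \<open>q - lam\<close>. After division by |q - lam|^n the higher one vanishes as \<open>q\<close>
  tends to \<open>lam\<close> along the axis.\<close>

lemma carleman_coeff_bound:
  assumes "carleman_expansion U lam M r f a" "disk_side U \<tau>" "norm lam = 1"
  obtains c0 c1 where "0 < c0" "0 < c1" "\<And>n z. z \<in> ball 0 r \<Longrightarrow> norm (a n z) \<le> c0 * c1 ^ n * M n"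
proof -
  obtain s c0 c1 where H: "0 < s" "0 < c0" "0 < c1" "\<And>n. a n \<in> B_space r"
    "\<And>N q z. q \<in> tdisk lam \<tau> s \<Longrightarrow> z \<in> ball 0 r \<Longrightarrow>
       norm (f q z - (\<Sum>n<N. a n z * (q - lam) ^ n)) \<le> c0 * c1 ^ N * M N * norm (q - lam) ^ N"
    by (rule carleman_expansionE[OF assms]) (rule that)
  have \<tau>: "\<bar>\<tau>\<bar> = 1" using disk_side_abs assms(2) .
  have "norm (a n z) \<le> c0 * c1 ^ n * M n" if z: "z \<in> ball 0 r" for n z
  proof (rule le_of_le_add_small[of "2 * s"])
    fix u :: real assume u: "0 < u" "u < 2 * s"
    define q where "q = lam + (\<tau> * u) *\<^sub>R lam"
    have q: "q \<in> tdisk lam \<tau> s" unfolding q_def by (rule tdisk_axis_mem[OF \<tau> assms(3) u])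
    have nq: "norm (q - lam) = u" using assms(3) u \<tau> by (simp add: q_def abs_mult)
    have "a n z * (q - lam) ^ n = (f q z - (\<Sum>n<n. a n z * (q - lam) ^ n)) - (f q z - (\<Sum>n<Suc n. a n z * (q - lam) ^ n))"
      by simp
    then have "norm (a n z * (q - lam) ^ n) \<le> c0 * c1 ^ n * M n * norm (q - lam) ^ n + c0 * c1 ^ Suc n * M (Suc n) * norm (q - lam) ^ Suc n"
      by (simp only:) (rule order.trans[OF norm_triangle_ineq4 add_mono[OF H(5)[OF q z, of n] H(5)[OF q z, of "Suc n"]]])
    then have "norm (a n z) * u ^ n \<le> (c0 * c1 ^ n * M n + c0 * c1 ^ Suc n * M (Suc n) * u) * u ^ n"
      by (simp add: norm_mult norm_power nq algebra_simps)
    then show "norm (a n z) \<le> c0 * c1 ^ n * M n + c0 * c1 ^ Suc n * M (Suc n) * u"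
      using u by (simp add: mult_le_cancel_right)
  qed (use H in auto)
  then show ?thesis using that H by blast
qed

text \<open>Strong induction, comparing the remainders of order n + 1 along the axis. The weights
  may differ because an expansion with respect to an arbitrary \<open>M\<close> has to be identified
  with the Gevrey one.\<close>

lemma carleman_expansion_unique:
  assumes a: "carleman_expansion U lam M r f a" and b: "carleman_expansion U lam M' r f b"
    and U: "disk_side U \<tau>" and lam: "norm lam = 1"
  shows "a = b"
proof -
  obtain s c0 c1 where A: "0 < s" "0 < c0" "0 < c1" "\<And>n. a n \<in> B_space r"
    "\<And>N q z. q \<in> tdisk lam \<tau> s \<Longrightarrow> z \<in> ball 0 r \<Longrightarrow>
       norm (f q z - (\<Sum>n<N. a n z * (q - lam) ^ n)) \<le> c0 * c1 ^ N * M N * norm (q - lam) ^ N"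
    by (rule carleman_expansionE[OF a U lam]) (rule that)
  obtain s' c0' c1' where B: "0 < s'" "0 < c0'" "0 < c1'" "\<And>n. b n \<in> B_space r"
    "\<And>N q z. q \<in> tdisk lam \<tau> s' \<Longrightarrow> z \<in> ball 0 r \<Longrightarrow>
       norm (f q z - (\<Sum>n<N. b n z * (q - lam) ^ n)) \<le> c0' * c1' ^ N * M' N * norm (q - lam) ^ N"
    by (rule carleman_expansionE[OF b U lam]) (rule that)
  have \<tau>: "\<bar>\<tau>\<bar> = 1" using disk_side_abs U .
  have "a n z = b n z" if z: "z \<in> ball 0 r" for n z
  proof (induction n rule: less_induct)
    case (less n)
    define K where "K = c0 * c1 ^ Suc n * M (Suc n) + c0' * c1' ^ Suc n * M' (Suc n)"
    have "norm (a n z - b n z) \<le> 0"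
    proof (rule le_of_le_add_small[of "2 * min s s'"])
      fix u :: real assume u: "0 < u" "u < 2 * min s s'"
      define q where "q = lam + (\<tau> * u) *\<^sub>R lam"
      have q: "q \<in> tdisk lam \<tau> s" "q \<in> tdisk lam \<tau> s'"
        unfolding q_def by (rule tdisk_axis_mem[OF \<tau> lam]; use u in simp)+
      have nq: "norm (q - lam) = u" using lam u \<tau> by (simp add: q_def abs_mult)
      have "(\<Sum>n<n. a n z * (q - lam) ^ n) = (\<Sum>n<n. b n z * (q - lam) ^ n)"
        using less.IH by simp
      then have "(a n z - b n z) * (q - lam) ^ n =
        (f q z - (\<Sum>n<Suc n. b n z * (q - lam) ^ n)) - (f q z - (\<Sum>n<Suc n. a n z * (q - lam) ^ n))"
        by (simp add: algebra_simps)
      then have "norm ((a n z - b n z) * (q - lam) ^ n) \<le>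
        c0' * c1' ^ Suc n * M' (Suc n) * norm (q - lam) ^ Suc n + c0 * c1 ^ Suc n * M (Suc n) * norm (q - lam) ^ Suc n"
        by (simp only:) (rule order.trans[OF norm_triangle_ineq4 add_mono[OF B(5)[OF q(2) z, of "Suc n"] A(5)[OF q(1) z, of "Suc n"]]])
      then have "norm (a n z - b n z) * u ^ n \<le> (0 + K * u) * u ^ n"
        unfolding norm_mult norm_power nq K_def by (simp add: algebra_simps)
      then show "norm (a n z - b n z) \<le> 0 + K * u"
        using u by (simp add: mult_le_cancel_right)
    qed (use A(1) B(1) in auto)
    then show ?case by simp
  qed
  moreover have "a n z = b n z" if "z \<notin> ball 0 r" for n z
    using that A(4)[of n] B(4)[of n] by (auto simp: B_space_def)
  ultimately show ?thesis by (intro ext) metis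
qed

lemma asym_exp_eq:
  assumes "carleman_expansion U lam M r f a" "disk_side U \<tau>" "norm lam = 1"
  shows "asym_exp U lam M r f = a"
  unfolding asym_exp_def using assms carleman_expansion_unique by blast

lemma gevrey2_exp_eq:
  assumes "gevrey2_expansion lam r f a" "norm lam = 1"
  shows "gevrey2_exp lam r f = a"
proof -
  have "disk_side inner_disc (-1)" by (simp add: disk_side_def)
  with assms show ?thesis
    unfolding gevrey2_exp_def gevrey2_expansion_def
    by (intro the_equality) (blast intro: carleman_expansion_unique)+
qed

section \<open>Flat functions and the failure of quasianalyticity\<close>

definition flat :: "real \<Rightarrow> complex \<Rightarrow> real \<Rightarrow> complex \<Rightarrow> complex \<Rightarrow> complex" where
  "flat r lam \<tau> q z = (if z \<in> ball 0 r then exp (- csqrt (\<tau> *\<^sub>R lam / (q - lam))) * z else 0)"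

text \<open>Inversion at \<open>lam\<close> sends a disc tangent there into a half plane, where the
  argument of the square root in \<open>flat\<close> stays off the branch cut. In the coordinate
  \<open>Q\<close> along the axis, |Q - s| < s forces Re Q > 0.\<close>

lemma tdisk_inversion:
  assumes "\<bar>\<tau>\<bar> = 1" "norm lam = 1" "q \<in> tdisk lam \<tau> s"
  shows "q \<noteq> lam" "Re (\<tau> *\<^sub>R lam / (q - lam)) > 0"
proof -
  define Q where "Q = (q - lam) / (\<tau> *\<^sub>R lam)"
  have l0: "\<tau> *\<^sub>R lam \<noteq> 0" using assms by auto
  have n1: "norm (\<tau> *\<^sub>R lam) = 1" using assms by simp
  have Q: "q - lam = (\<tau> *\<^sub>R lam) * Q" using l0 unfolding Q_def by (metis nonzero_mult_div_cancel_left times_divide_eq_right)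
  have "s > 0" using assms(3) by (metis mem_ball zero_le_dist order_le_less_trans)
  have "norm ((\<tau> *\<^sub>R lam) * (Q - of_real s)) < s"
    using assms(3) unfolding right_diff_distrib Q[symmetric]
    by (simp add: dist_norm norm_minus_commute scaleR_conv_of_real algebra_simps)
  then have "norm (Q - of_real s) < s" using n1 by (simp only: norm_mult)
  then have "(Re Q - s)\<^sup>2 + (Im Q)\<^sup>2 < s\<^sup>2"
    using power_strict_mono[of "norm (Q - of_real s)" s 2] by (simp add: cmod_power2)
  then have "(Re Q)\<^sup>2 + (Im Q)\<^sup>2 < 2 * (Re Q * s)"
    by (simp add: power2_eq_square algebra_simps)
  then have "0 < Re Q * s" using zero_le_power2[of "Re Q"] zero_le_power2[of "Im Q"] by linarith
  then have ReQ: "Re Q > 0" using \<open>s > 0\<close> by (simp add: zero_less_mult_iff)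
  then have "Q \<noteq> 0" by auto
  then show "q \<noteq> lam" using Q l0 by auto
  have "\<tau> *\<^sub>R lam / (q - lam) = inverse Q" using l0 by (simp add: Q_def field_simps)
  then show "Re (\<tau> *\<^sub>R lam / (q - lam)) > 0" using ReQ \<open>Q \<noteq> 0\<close>
    by (simp add: divide_pos_pos complex_neq_0)
qed

lemma B_space_scalar: "(\<lambda>z. if z \<in> ball 0 r then c * z else 0) \<in> B_space r"
proof -
  have "(\<lambda>z. if z \<in> ball 0 r then c * z else 0) holomorphic_on ball 0 r"
    by (rule holomorphic_transform[of "\<lambda>z. c * z"]) (auto intro!: holomorphic_intros)
  moreover have "bounded ((\<lambda>z. if z \<in> ball 0 r then c * z else 0) ` ball 0 r)"
    by (rule boundedI[of _ "norm c * r"]) (auto simp: norm_mult intro!: mult_left_mono)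
  ultimately show ?thesis by (auto simp: B_space_def)
qed

text \<open>\<open>flat\<close> is a scalar function of \<open>q\<close> times the fixed element z
  of the space, so the error of its difference quotient is at most \<open>r\<close> times the scalar
  error.\<close>

lemma flat_B_holomorphic:
  assumes "\<bar>\<tau>\<bar> = 1" "norm lam = 1" "0 < r"
  shows "B_holomorphic_on r (flat r lam \<tau>) (tdisk lam \<tau> s)"
  unfolding B_holomorphic_on_def
proof (intro ballI conjI)
  fix q assume q: "q \<in> tdisk lam \<tau> s"
  define \<phi> where "\<phi> = (\<lambda>q. exp (- csqrt (\<tau> *\<^sub>R lam / (q - lam))))"
  have fl: "flat r lam \<tau> q = (\<lambda>z. if z \<in> ball 0 r then \<phi> q * z else 0)" for q
    by (auto simp: flat_def \<phi>_def)
  show "flat r lam \<tau> q \<in> B_space r" unfolding fl by (rule B_space_scalar)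
  note inv = tdisk_inversion[OF assms(1,2) q]
  have "\<tau> *\<^sub>R lam / (q - lam) \<notin> \<real>\<^sub>\<le>\<^sub>0" using inv(2) by (auto simp: complex_nonpos_Reals_iff)
  then have "\<phi> field_differentiable at q"
    unfolding \<phi>_def using inv(1)
    by (intro derivative_intros field_differentiable_compose[of "\<lambda>q. \<tau> *\<^sub>R lam / (q - lam)" q csqrt, unfolded o_def]
        field_differentiable_compose[of "\<lambda>q. - csqrt (\<tau> *\<^sub>R lam / (q - lam))" q exp, unfolded o_def]
        field_differentiable_at_csqrt field_differentiable_within_exp) auto
  then obtain D where "(\<phi> has_field_derivative D) (at q)" by (auto simp: field_differentiable_def)
  then have lim: "((\<lambda>h. (\<phi> (q + h) - \<phi> q) / h - D) \<longlongrightarrow> 0) (at 0)"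
    unfolding DERIV_def by (rule LIM_zero)
  show "\<exists>d\<in>B_space r. ((\<lambda>h. B_norm r (\<lambda>z. (flat r lam \<tau> (q + h) z - flat r lam \<tau> q z) / h - d z)) \<longlongrightarrow> 0) (at 0)"
  proof (intro bexI)
    have le: "B_norm r (\<lambda>z. (flat r lam \<tau> (q + h) z - flat r lam \<tau> q z) / h - (if z \<in> ball 0 r then D * z else 0))
        \<le> r * norm ((\<phi> (q + h) - \<phi> q) / h - D)" for h
    proof (rule B_norm_leI[OF assms(3)])
      fix z :: complex assume z: "z \<in> ball 0 r"
      have "(flat r lam \<tau> (q + h) z - flat r lam \<tau> q z) / h - (if z \<in> ball 0 r then D * z else 0)
          = z * ((\<phi> (q + h) - \<phi> q) / h - D)"
        using z by (simp add: fl diff_divide_distrib algebra_simps)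
      then show "norm ((flat r lam \<tau> (q + h) z - flat r lam \<tau> q z) / h - (if z \<in> ball 0 r then D * z else 0))
          \<le> r * norm ((\<phi> (q + h) - \<phi> q) / h - D)"
        using z by (auto simp: norm_mult intro!: mult_right_mono)
    qed
    have ge: "0 \<le> B_norm r g" if "bounded (g ` ball 0 r)" for g
      using norm_le_B_norm[OF that, of 0] assms(3) order.trans[OF norm_ge_zero] by auto
    have bd: "bounded ((\<lambda>z. (flat r lam \<tau> (q + h) z - flat r lam \<tau> q z) / h - (if z \<in> ball 0 r then D * z else 0)) ` ball 0 r)" for h
    proof (rule boundedI[of _ "r * norm ((\<phi> (q + h) - \<phi> q) / h - D)"])
      fix x assume "x \<in> (\<lambda>z. (flat r lam \<tau> (q + h) z - flat r lam \<tau> q z) / h - (if z \<in> ball 0 r then D * z else 0)) ` ball 0 r"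
      then obtain z where z: "z \<in> ball 0 r" "x = (flat r lam \<tau> (q + h) z - flat r lam \<tau> q z) / h - (if z \<in> ball 0 r then D * z else 0)" by blast
      then have "x = z * ((\<phi> (q + h) - \<phi> q) / h - D)"
        by (simp add: fl diff_divide_distrib algebra_simps)
      then show "norm x \<le> r * norm ((\<phi> (q + h) - \<phi> q) / h - D)"
        using z by (auto simp: norm_mult intro!: mult_right_mono)
    qed
    have "((\<lambda>h. r * norm ((\<phi> (q + h) - \<phi> q) / h - D)) \<longlongrightarrow> 0) (at 0)"
      using tendsto_mult[OF tendsto_const[of r] tendsto_norm[OF lim]] by simp
    then show "((\<lambda>h. B_norm r (\<lambda>z. (flat r lam \<tau> (q + h) z - flat r lam \<tau> q z) / h -
        (if z \<in> ball 0 r then D * z else 0))) \<longlongrightarrow> 0) (at 0)"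
      by (rule tendsto_sandwich[OF always_eventually always_eventually tendsto_const, rotated 2])
         (use ge[OF bd] le in blast)+
  qed (rule B_space_scalar)
qed

text \<open>The exponential series dominates each of its terms.\<close>

lemma exp_neg_le_fact:
  fixes y :: real assumes "0 < y" shows "exp (- y) \<le> fact n / y ^ n"
proof -
  have "y ^ n / fact n \<le> exp y"
  proof -
    have s: "(\<lambda>n. y ^ n / fact n) sums exp y" using exp_converges[of y] by (simp add: field_simps)
    then have "sum (\<lambda>n. y ^ n / fact n) {n} \<le> exp y"
      using assms by (intro sum_le_suminf[of "\<lambda>n. y ^ n / fact n" "{n}", unfolded sums_unique[OF s, symmetric]])
        (auto simp: sums_iff)
    then show ?thesis by simp
  qed
  then show ?thesis using assms by (simp add: exp_minus field_simps)
qed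

text \<open>With y^2 comparable to 1 / |q - lam|, \<open>exp (- y)\<close> is at most (2 N)! / y^(2
  N), that is (2 N)! |q - lam|^N up to a geometric factor. The hypothesis on \<open>M\<close>
  absorbs the factorial.\<close>

lemma flat_expansion:
  assumes U: "disk_side U \<tau>" "norm lam = 1" "0 < r" "r < 1"
    and M: "0 < c" "0 < d" "\<And>N. c * d ^ N * fact (2 * N) \<le> M N"
  shows "carleman_expansion U lam M r (flat r lam \<tau>) (\<lambda>_ _. 0)"
proof -
  have \<tau>: "\<bar>\<tau>\<bar> = 1" using U disk_side_abs by blast
  have "B_norm r (\<lambda>z. flat r lam \<tau> q z - (\<Sum>n<N. 0 * (q - lam) ^ n)) \<le> (1/c) * (2/d) ^ N * M N * norm (q - lam) ^ N"
    if q: "q \<in> tdisk lam \<tau> (1/2)" for N q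
  proof (rule B_norm_leI[OF U(3)])
    fix z :: complex assume z: "z \<in> ball 0 r"
    define t where "t = \<tau> *\<^sub>R lam / (q - lam)"
    note inv = tdisk_inversion[OF \<tau> U(2) q]
    define y where "y = sqrt (norm t / 2)"
    have nt: "norm t = 1 / norm (q - lam)" using U \<tau> by (simp add: t_def norm_divide)
    have y0: "0 < y" "y\<^sup>2 = 1 / (2 * norm (q - lam))" using inv(1) by (auto simp: y_def nt)
    then have y: "0 < y" "y ^ (2 * N) = (1 / (2 * norm (q - lam))) ^ N" by (auto simp: power_mult)
    have "norm (flat r lam \<tau> q z) = exp (- Re (csqrt t)) * norm z" using z
      by (simp add: flat_def t_def norm_mult)
    also have "\<dots> \<le> exp (- Re (csqrt t)) * 1" using z U(4) by (intro mult_left_mono) auto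
    \<comment> \<open>The square of \<open>Re (csqrt t)\<close> is (|t| + Re t) / 2, and Re t >
      0.\<close>
    also have "Re (csqrt t) \<ge> y" unfolding y_def using inv(2) by (auto simp: t_def[symmetric])
    then have "exp (- Re (csqrt t)) \<le> exp (- y)" by simp
    also have "\<dots> \<le> fact (2 * N) / y ^ (2 * N)" by (rule exp_neg_le_fact[OF y(1)])
    also have "\<dots> = fact (2 * N) * 2 ^ N * norm (q - lam) ^ N"
      using inv(1) by (simp add: y power_divide power_mult_distrib)
    also have "fact (2 * N) \<le> M N / (c * d ^ N)" using M(1,2) M(3)[of N] by (simp add: field_simps)
    also have "M N / (c * d ^ N) * 2 ^ N * norm (q - lam) ^ N = (1/c) * (2/d) ^ N * M N * norm (q - lam) ^ N"
      by (simp add: power_divide)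
    finally show "norm (flat r lam \<tau> q z - (\<Sum>n<N. 0 * (q - lam) ^ n)) \<le> (1/c) * (2/d) ^ N * M N * norm (q - lam) ^ N"
      by (simp add: mult_right_mono)
  qed
  moreover have "(\<lambda>_. 0) \<in> B_space r" by (auto simp: B_space_def bounded_iff)
  moreover have "tangent_disk U lam (tdisk lam \<tau> (1/2))" by (rule tangent_disk_tdisk) (use U in auto)
  moreover have "B_holomorphic_on r (flat r lam \<tau>) (tdisk lam \<tau> (1/2))"
    by (rule flat_B_holomorphic) (use U \<tau> in auto)
  ultimately show ?thesis unfolding carleman_expansion_def using M
    by (intro conjI allI exI[of _ "tdisk lam \<tau> (1/2)"] exI[of _ "1/c"] exI[of _ "2/d"]) auto
qed

lemma zero_expansion:
  assumes U: "disk_side U \<tau>" "norm lam = 1" "0 < r" and M: "\<And>n. 0 < M n"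
  shows "carleman_expansion U lam M r (\<lambda>_ _. 0) (\<lambda>_ _. 0)"
proof -
  have B0: "B_norm r (\<lambda>z. 0) = 0" using U(3) by (simp add: B_norm_def)
  have Z: "(\<lambda>_. 0) \<in> B_space r" by (auto simp: B_space_def bounded_iff)
  have "tangent_disk U lam (tdisk lam \<tau> (1/2))" by (rule tangent_disk_tdisk) (use U in auto)
  moreover have "B_holomorphic_on r (\<lambda>_ _. 0) (tdisk lam \<tau> (1/2))"
    using Z by (auto simp: B_holomorphic_on_def B0 intro!: bexI[of _ "\<lambda>_. 0"])
  ultimately show ?thesis unfolding carleman_expansion_def using M Z
    by (intro conjI allI exI[of _ "tdisk lam \<tau> (1/2)"] exI[of _ 1]) (auto simp: B0 less_imp_le)
qed

text \<open>\<open>flat\<close> and the zero function share the zero expansion, yet an exponential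
  never vanishes.\<close>

lemma not_quasianalytic:
  assumes U: "disk_side U \<tau>" "norm lam = 1" "0 < r" "r < 1"
    and M: "0 < c" "0 < d" "\<And>N. c * d ^ N * fact (2 * N) \<le> M N"
  shows "\<not> quasianalytic U lam M r"
proof
  assume Q: "quasianalytic U lam M r"
  have Mpos: "0 < M n" for n using M(3)[of n] M(1,2)
    by (metis fact_gt_zero mult_pos_pos order_less_le_trans zero_less_power)
  note e = flat_expansion[OF assms] zero_expansion[OF U(1-3), of M, OF Mpos]
  have "asym_exp U lam M r (flat r lam \<tau>) = asym_exp U lam M r (\<lambda>_ _. 0)"
    using asym_exp_eq[OF e(1) U(1,2)] asym_exp_eq[OF e(2) U(1,2)] by simp
  moreover have "flat r lam \<tau> \<in> carleman_class U lam M r" "(\<lambda>_ _. 0) \<in> carleman_class U lam M r"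
    using e by (auto simp: carleman_class_def)
  ultimately obtain \<Delta> where D: "tangent_disk U lam \<Delta>" "\<And>q. q \<in> \<Delta> \<Longrightarrow> flat r lam \<tau> q = (\<lambda>_. 0)"
    using Q unfolding quasianalytic_def by blast
  obtain s where s: "0 < s" "\<Delta> = tdisk lam \<tau> s" using tangent_diskD[OF D(1) U(1,2)] .
  have "lam + (\<tau> * s) *\<^sub>R lam \<in> \<Delta>" using s by simp
  from fun_cong[OF D(2)[OF this], of "of_real (r/2)"] U(3) show False by (auto simp: flat_def)
qed

section \<open>Badly approximable numbers and Lagrange constants\<close>

definition badly_approx :: "real \<Rightarrow> real \<Rightarrow> bool" where
  "badly_approx c \<alpha> \<longleftrightarrow> 0 < c \<and> (\<forall>k::nat. \<forall>N::int. 1 \<le> k \<longrightarrow> c / k \<le> \<bar>k * \<alpha> - N\<bar>)"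

lemma badly_approxD:
  assumes "badly_approx c \<alpha>"
  shows "0 < c" "1 \<le> k \<Longrightarrow> c / real k \<le> \<bar>real k * \<alpha> - of_int N\<bar>"
  using assms by (auto simp: badly_approx_def)

text \<open>Liouville's argument. At x = N / k an integer quadratic polynomial takes a nonzero value
  that becomes an integer after multiplication by k^2. This value is (x - \<alpha>) times a
  cofactor, which \<open>K\<close> bounds as long as |x - \<alpha>| is at most 1.\<close>

lemma quadratic_irrational_badly_approx:
  assumes "quadratic_irrational \<alpha>"
  obtains c where "badly_approx c \<alpha>"
proof -
  from assms obtain p :: "rat poly" where irr: "\<alpha> \<notin> \<rat>" and p: "degree p = 2" "poly (map_poly of_rat p) \<alpha> = 0"
    by (auto simp: quadratic_irrational_def)
  obtain a1 b1 where 1: "coeff p 0 = Fract a1 b1" "b1 > 0" using Rat_cases by blast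
  obtain a2 b2 where 2: "coeff p 1 = Fract a2 b2" "b2 > 0" using Rat_cases by blast
  obtain a3 b3 where 3: "coeff p 2 = Fract a3 b3" "b3 > 0" using Rat_cases by blast
  have deg: "degree (map_poly of_rat p :: real poly) = 2"
    by (subst degree_map_poly) (use p in auto)
  have "poly (map_poly of_rat p) \<alpha> = of_rat (coeff p 0) + of_rat (coeff p 1) * \<alpha> + of_rat (coeff p 2) * \<alpha>\<^sup>2"
    unfolding poly_altdef deg by (simp add: coeff_map_poly eval_nat_numeral)
  then have eq: "of_int a1 / of_int b1 + of_int a2 / of_int b2 * \<alpha> + of_int a3 / of_int b3 * \<alpha>\<^sup>2 = (0::real)"
    using p(2) 1 2 3 by (simp add: of_rat_rat)
  have a3: "a3 \<noteq> 0" using 3 p(1) by (metis leading_coeff_0_iff degree_0 rat_number_collapse(1) zero_neq_numeral)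
  define A B C where "A = a3 * b1 * b2" and "B = a2 * b1 * b3" and "C = a1 * b2 * b3"
  have A0: "A \<noteq> 0" using a3 1 2 by (simp add: A_def)
  have eq: "of_int A * \<alpha>\<^sup>2 + of_int B * \<alpha> + of_int C = 0"
    using eq 1 2 3 by (simp add: A_def B_def C_def field_simps)
  define K where "K = \<bar>of_int A\<bar> * (2 * \<bar>\<alpha>\<bar> + 1) + \<bar>of_int B :: real\<bar>"
  have "0 < 2 * \<bar>\<alpha>\<bar> + 1" using abs_ge_zero[of \<alpha>] by linarith
  then have K: "K > 0" using A0 unfolding K_def by (simp add: add_pos_nonneg)
  have "min 1 (1 / K) / k \<le> \<bar>k * \<alpha> - N\<bar>" if k: "1 \<le> k" for k :: nat and N :: int
  proof (cases "\<bar>real k * \<alpha> - of_int N\<bar> \<le> 1")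
    case False
    have "min 1 (1 / K) / real k \<le> 1 / 1" using k K by (intro frac_le) auto
    then show ?thesis using False by linarith
  next
    case True
    define x where "x = of_int N / real k"
    have rx: "x \<in> \<rat>" by (simp add: x_def)
    have f: "of_int A * x\<^sup>2 + of_int B * x + of_int C = (x - \<alpha>) * (of_int A * (x + \<alpha>) + of_int B)"
      using eq by (simp add: algebra_simps power2_eq_square)
    \<comment> \<open>The zero of the cofactor is the conjugate root; if that were rational, so
      would be \<alpha>.\<close>
    have "of_int A * (x + \<alpha>) + of_int B \<noteq> 0"
    proof
      assume "of_int A * (x + \<alpha>) + of_int B = 0"
      then have "\<alpha> = - of_int B / of_int A - x" using A0 by (simp add: field_simps)
      then show False using irr rx by (metis Rats_diff Rats_divide Rats_minus_iff Rats_of_int)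
    qed
    moreover have "x \<noteq> \<alpha>" using rx irr by auto
    ultimately have "of_int A * x\<^sup>2 + of_int B * x + of_int C \<noteq> 0" unfolding f by simp
    moreover have I: "(of_int A * x\<^sup>2 + of_int B * x + of_int C) * (real k)\<^sup>2 = of_int (A * N\<^sup>2 + B * N * int k + C * (int k)\<^sup>2)"
      using k by (simp add: x_def field_simps power2_eq_square)
    ultimately have "A * N\<^sup>2 + B * N * int k + C * (int k)\<^sup>2 \<noteq> 0" using k
      by (metis mult_eq_0_iff of_int_0 of_nat_0_eq_iff not_one_le_zero power_eq_0_iff)
    then have "1 \<le> \<bar>(of_int A * x\<^sup>2 + of_int B * x + of_int C) * (real k)\<^sup>2\<bar>" unfolding I by linarith
    also have "\<dots> = \<bar>x - \<alpha>\<bar> * \<bar>of_int A * (x + \<alpha>) + of_int B\<bar> * (real k)\<^sup>2" unfolding f by (simp add: abs_mult)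
    also have "\<bar>x - \<alpha>\<bar> * real k = \<bar>real k * \<alpha> - of_int N\<bar>"
    proof -
      have "\<bar>x - \<alpha>\<bar> * real k = \<bar>(x - \<alpha>) * real k\<bar>" by (simp add: abs_mult)
      also have "(x - \<alpha>) * real k = - (real k * \<alpha> - of_int N)" using k by (simp add: x_def field_simps)
      finally show ?thesis by simp
    qed
    then have "\<bar>x - \<alpha>\<bar> * \<bar>of_int A * (x + \<alpha>) + of_int B\<bar> * (real k)\<^sup>2 = 
       \<bar>real k * \<alpha> - of_int N\<bar> * real k * \<bar>of_int A * (x + \<alpha>) + of_int B\<bar>" by (simp add: power2_eq_square mult_ac)
    also have "\<bar>of_int A * (x + \<alpha>) + of_int B\<bar> \<le> K"
    proof -
      have "\<bar>x - \<alpha>\<bar> * real k \<le> 1 * real k" using True k \<open>\<bar>x - \<alpha>\<bar> * real k = \<bar>real k * \<alpha> - of_int N\<bar>\<close> by auto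
      then have "\<bar>x - \<alpha>\<bar> \<le> 1" using k by (simp add: mult_le_cancel_right)
      then have "\<bar>x + \<alpha>\<bar> \<le> 2 * \<bar>\<alpha>\<bar> + 1" by linarith
      then have "\<bar>of_int A * (x + \<alpha>)\<bar> \<le> \<bar>of_int A\<bar> * (2 * \<bar>\<alpha>\<bar> + 1)" by (simp add: abs_mult mult_left_mono)
      then show ?thesis unfolding K_def by linarith
    qed
    finally have "1 \<le> \<bar>real k * \<alpha> - of_int N\<bar> * real k * K" by (simp add: mult_left_mono)
    then have "1 / K / real k \<le> \<bar>real k * \<alpha> - of_int N\<bar>" using K k by (simp add: field_simps)
    moreover have "min 1 (1 / K) / real k \<le> 1 / K / real k" by (intro divide_right_mono) auto
    ultimately show ?thesis by linarith
  qed
  then have "badly_approx (min 1 (1/K)) \<alpha>" using K by (auto simp: badly_approx_def)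
  then show ?thesis using that by blast
qed

text \<open>Solving p' q - p q' = s modulo q yields a neighbour of p / q at distance 1 / (q q') on
  the side prescribed by \<open>s\<close>.\<close>

lemma Bezout_neighbour:
  fixes p q s :: int
  assumes "coprime p q" "0 < q" "\<bar>s\<bar> = 1"
  obtains p' q' where "1 \<le> q'" "q' \<le> q" "p' * q - p * q' = s"
proof -
  obtain u v where uv: "u * p + v * q = 1" using assms(1) bezout_int[of p q] by auto
  \<comment> \<open>\<open>q'\<close> must be congruent to - s u; the shift by one, undone in
    \<open>q'\<close>, selects the representative between 1 and \<open>q\<close>, never 0.\<close>
  define t where "t = - s * u - 1"
  define q' where "q' = 1 + t mod q"
  have "q dvd p * q' + s"
  proof -
    have "p * q' + s = p * (1 + t) + s - p * q * (t div q)"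
      by (simp add: q'_def algebra_simps minus_mult_div_eq_mod[symmetric])
    also have "p * (1 + t) + s = s * (1 - u * p)" by (simp add: t_def algebra_simps)
    also have "\<dots> = q * (s * v)" using uv by (simp add: algebra_simps flip: uv)
    finally have "p * q' + s = q * (s * v - p * (t div q))" by (simp add: algebra_simps)
    then show ?thesis by simp
  qed
  then obtain p' where "p * q' + s = q * p'" by blast
  then have "p' * q - p * q' = s" by (simp add: mult.commute)
  moreover have "1 \<le> q'" "q' \<le> q" using pos_mod_bound[OF assms(2), of t] pos_mod_sign[OF assms(2), of t] unfolding q'_def by linarith+
  ultimately show ?thesis using that by blast
qed

text \<open>Dirichlet's theorem does not control the side of the approximation. If p / k lies on the
  wrong side, its neighbour in direction \<open>s\<close> overshoots \<alpha>, because |x| < 1 / (Q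
  k) is less than the step 1 / (k l), and it ends up closer to \<alpha> than that step.\<close>

lemma one_sided_approx:
  fixes K :: nat and s :: int
  assumes bad: "badly_approx c \<alpha>" and s: "\<bar>s\<bar> = 1"
  obtains k :: nat and N :: int where "K \<le> k" "1 \<le> k" "0 < s * (N / k - \<alpha>)" "(real k)\<^sup>2 * (s * (N / k - \<alpha>)) < 1"
proof -
  note c = badly_approxD(1)[OF bad]
  define c' where "c' = min c 1"
  have c': "0 < c'" "c' \<le> c" "c' \<le> 1" using c by (auto simp: c'_def)
  \<comment> \<open>One factor c' is lost in passing from \<open>Q\<close> to the Dirichlet
    denominator, another in passing to its neighbour.\<close>
  obtain Q :: nat where Q: "real K < c'\<^sup>2 * real Q" "Q > 0"
    using reals_Archimedean3[of "c'\<^sup>2"] c'(1) 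
    by (metis less_eq_real_def mult.commute of_nat_0 of_nat_0_le_iff gr0I mult_zero_right not_less zero_less_power)
  obtain p q where pq: "coprime p q" "0 < q" "q \<le> int Q" "\<bar>of_int q * \<alpha> - of_int p\<bar> < 1 / real Q"
    using Dirichlet_approx_coprime[OF Q(2)] .
  define k where "k = nat q"
  have k: "k \<ge> 1" "q = int k" "k \<le> Q" using pq by (auto simp: k_def)
  have "c' / k < 1 / real Q" using badly_approxD(2)[OF bad k(1), of p] pq(4) c'(2) k
    by (smt (verit) divide_right_mono of_int_of_nat_eq of_nat_0_le_iff)
  then have kQ: "c' * Q < k" using k Q by (simp add: field_simps)
  have c2: "c'\<^sup>2 * Q \<le> c' * Q" using c' Q(2) by (simp add: power2_eq_square mult_right_le_one_le)
  define x where "x = of_int p / real k - \<alpha>"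
  have x: "\<bar>x\<bar> * k < 1 / real Q"
  proof -
    have "of_int q * \<alpha> - of_int p = - (x * k)" using k by (simp add: x_def field_simps)
    then show ?thesis using pq(4) by (simp add: abs_mult)
  qed
  have x0: "x \<noteq> 0"
  proof
    assume "x = 0"
    then have "\<alpha> = of_int p / real k" by (simp add: x_def)
    then show False using badly_approxD(2)[OF bad k(1), of p] c k by (simp add: divide_le_0_iff)
  qed
  have ss: "(of_int s :: real) = 1 \<or> (of_int s :: real) = -1" using s by (auto simp: abs_if split: if_splits)
  show ?thesis
  proof (cases "0 < s * x")
    case True
    then have "s * x = \<bar>x\<bar>" using ss by auto
    then have "(real k)\<^sup>2 * (s * x) = (\<bar>x\<bar> * k) * k" by (simp add: power2_eq_square)
    also have "\<dots> < 1 / real Q * k" using x k by (intro mult_strict_right_mono) auto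
    also have "\<dots> \<le> 1" using k Q by (simp add: field_simps)
    finally show ?thesis using that[of k p] True kQ c2 Q k by (simp add: x_def)
  next
    case False
    then have sx: "s * x = - \<bar>x\<bar>" using ss by auto
    obtain p' q' where b: "1 \<le> q'" "q' \<le> q" "p' * q - p * q' = s" using Bezout_neighbour[OF pq(1,2) s] .
    define l where "l = nat q'"
    have l: "q' = int l" "1 \<le> l" "l \<le> k" using b k by (auto simp: l_def)
    define y where "y = of_int p' / real l - \<alpha>"
    have "of_int p' * real k - of_int p * real l = of_int s" using b(3) k l by (metis of_int_diff of_int_mult of_int_of_nat_eq)
    then have "y = x + s / (real k * real l)" using k l by (simp add: x_def y_def field_simps)
    then have "s * y = s * x + (s * s) / (real k * real l)" by (simp add: algebra_simps)
    then have sy: "s * y = 1 / (real k * real l) - \<bar>x\<bar>" using ss sx by auto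
    have "\<bar>x\<bar> * k * l < 1 / real Q * l" using x l by (intro mult_strict_right_mono) auto
    also have "\<dots> \<le> 1" using k l Q by (simp add: field_simps)
    finally have "0 < 1 / (real k * real l) - \<bar>x\<bar>" using k l by (simp add: field_simps)
    then have pos: "0 < s * y" by (simp only: sy)
    have up: "s * y < 1 / (real k * real l)" using x0 by (simp add: sy)
    have "(real l)\<^sup>2 * (s * y) < (real l)\<^sup>2 * (1 / (real k * real l))" using l up by (intro mult_strict_left_mono) auto
    also have "\<dots> \<le> 1" using k l by (simp add: field_simps power2_eq_square)
    finally have 1: "(real l)\<^sup>2 * (s * y) < 1" .
    have "real l * \<alpha> - of_int p' = - (real l * y)" using l by (simp add: y_def field_simps)
    then have "\<bar>real l * \<alpha> - of_int p'\<bar> = \<bar>- (real l * y)\<bar>" by simp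
    also have "\<dots> = real l * (s * y)" using pos ss by (auto simp: abs_mult)
    also have "\<dots> < real l * (1 / (real k * real l))" using l up by (intro mult_strict_left_mono) auto
    also have "\<dots> = 1 / k" using k l by simp
    finally have "\<bar>real l * \<alpha> - of_int p'\<bar> < 1 / k" .
    moreover have "c' / l \<le> c / l" using c'(2) by (intro divide_right_mono) auto
    ultimately have "c' / l < 1 / k" using badly_approxD(2)[OF bad l(2), of p'] by linarith
    then have "c' * k < l" using k l by (simp add: field_simps)
    moreover have "c' * (c' * Q) < c' * k" using kQ c' by simp
    ultimately have "K \<le> l" using Q(1) by (simp add: power2_eq_square)
    then show ?thesis using that[of l p'] pos 1 l by (simp add: y_def)
  qed
qed

text \<open>\<open>\<nu>\<close> is the lower limit of k^2 |N / k - \<alpha>| over the fractions on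
  the side \<open>s\<close> of \<alpha>. The clauses are separated by their use: convergence needs
  the lower bound, the natural boundary needs fractions that come close to it.\<close>

definition lagrange :: "real \<Rightarrow> int \<Rightarrow> real \<Rightarrow> bool" where
  "lagrange \<alpha> s \<nu> \<longleftrightarrow> 0 < \<nu> \<and>
     (\<forall>m<\<nu>. \<exists>K. \<forall>k\<ge>K. \<forall>N::int. 0 < s * (N / real k - \<alpha>) \<longrightarrow> m \<le> (real k)\<^sup>2 * (s * (N / real k - \<alpha>))) \<and>
     (\<forall>m>\<nu>. \<forall>K. \<exists>k\<ge>K. 1 \<le> k \<and> (\<exists>N::int. 0 < s * (N / real k - \<alpha>) \<and> (real k)\<^sup>2 * (s * (N / real k - \<alpha>)) < m))"

lemma eventually_approx_filter:
  "eventually P approx_filter \<longleftrightarrow> finite {p. 1 \<le> fst p \<and> \<not> P p}"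
  unfolding approx_filter_def eventually_inf_principal eventually_cofinite
  by (rule arg_cong[where f = finite]) auto

text \<open>Links the filter, which discards finite sets of pairs, with \<open>lagrange\<close>,
  which discards small denominators: for a bounded denominator only finitely many numerators stay
  close enough to \<alpha>.\<close>

lemma finite_numerators:
  "finite {p. fst p < K \<and> 1 \<le> fst p \<and> \<bar>of_int (snd p) / real (fst p) - \<alpha>\<bar> * (real (fst p))\<^sup>2 \<le> m}"
proof (rule finite_subset)
  define B where "B = \<lceil>m + real K * \<bar>\<alpha>\<bar>\<rceil>"
  show "{p. fst p < K \<and> 1 \<le> fst p \<and> \<bar>of_int (snd p) / real (fst p) - \<alpha>\<bar> * (real (fst p))\<^sup>2 \<le> m}
     \<subseteq> {..<K} \<times> {-B..B}"
  proof
    fix p assume p: "p \<in> {p. fst p < K \<and> 1 \<le> fst p \<and> \<bar>of_int (snd p) / real (fst p) - \<alpha>\<bar> * (real (fst p))\<^sup>2 \<le> m}"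
    obtain k N where kN: "p = (k, N)" by (cases p)
    have H: "k < K" "1 \<le> k" "\<bar>of_int N / real k - \<alpha>\<bar> * (real k)\<^sup>2 \<le> m" using p by (auto simp: kN)
    have "\<bar>of_int N / real k - \<alpha>\<bar> * real k * 1 \<le> \<bar>of_int N / real k - \<alpha>\<bar> * real k * real k"
      using H(2) by (intro mult_left_mono) auto
    also have "\<dots> \<le> m" using H(3) by (simp add: power2_eq_square mult.assoc)
    finally have "\<bar>(of_int N / real k - \<alpha>) * real k\<bar> \<le> m" by (simp add: abs_mult)
    also have "(of_int N / real k - \<alpha>) * real k = of_int N - real k * \<alpha>" using H by (simp add: field_simps)
    finally have "\<bar>real_of_int N\<bar> \<le> m + real k * \<bar>\<alpha>\<bar>" using abs_mult[of "real k" \<alpha>] by linarith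
    also have "\<dots> \<le> m + real K * \<bar>\<alpha>\<bar>" using H by (intro add_left_mono mult_right_mono) auto
    also have "\<dots> \<le> of_int B" by (simp add: B_def)
    finally show "p \<in> {..<K} \<times> {-B..B}" using H by (auto simp: kN)
  qed
qed auto

lemma finite_fst_bound:
  fixes S :: "(nat \<times> 'a) set"
  assumes "finite S"
  obtains K where "\<And>p. p \<in> S \<Longrightarrow> fst p < K"
  using finite_nat_set_iff_bounded[of "fst ` S"] assms by blast

text \<open>\<open>g\<close> is the reciprocal of k^2 s (N / k - \<alpha>), so its upper limit is
  the reciprocal of a lower limit. Fractions on the other side give negative values and do not
  interfere, since \<open>L\<close> is at least 1.\<close>

lemma lagrange_Limsup:
  assumes bad: "badly_approx c \<alpha>" and s: "\<bar>s\<bar> = 1"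
    and L: "L = Limsup approx_filter (\<lambda>(D, N). ereal (s * (inverse ((real D)\<^sup>2) * inverse (of_int N / real D - \<alpha>))))"
  shows "lagrange \<alpha> s (1 / real_of_ereal L)"
proof -
  define g where "g = (\<lambda>(D, N). s * (inverse ((real D)\<^sup>2) * inverse (of_int N / real D - \<alpha>)))"
  have L: "L = Limsup approx_filter (\<lambda>p. ereal (g p))" unfolding L g_def by (simp add: case_prod_unfold)
  have ss: "(of_int s :: real) = 1 \<or> (of_int s :: real) = -1" using s by (auto simp: abs_if split: if_splits)
  have g: "g (D, N) = inverse ((real D)\<^sup>2 * (s * (of_int N / real D - \<alpha>)))" for D N
    using ss by (auto simp: g_def)
  note c = badly_approxD(1)[OF bad]
  have lower: "c \<le> (real D)\<^sup>2 * (s * (of_int N / real D - \<alpha>))" if "1 \<le> D" "0 < s * (of_int N / real D - \<alpha>)" for D N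
  proof -
    have "\<bar>of_int N / real D - \<alpha>\<bar> = s * (of_int N / real D - \<alpha>)" using that ss by auto
    moreover have "\<bar>real D * \<alpha> - of_int N\<bar> = real D * \<bar>of_int N / real D - \<alpha>\<bar>"
    proof -
      have "real D * \<alpha> - of_int N = - (real D * (of_int N / real D - \<alpha>))" using that(1) by (simp add: field_simps)
      then show ?thesis by (simp add: abs_mult)
    qed
    ultimately have "c / real D \<le> real D * (s * (of_int N / real D - \<alpha>))"
      using badly_approxD(2)[OF bad that(1), of N] by simp
    then have "c \<le> real D * (s * (of_int N / real D - \<alpha>)) * real D"
      using that(1) by (simp only: pos_divide_le_eq of_nat_0_less_iff)
    then show ?thesis by (simp add: power2_eq_square mult_ac)
  qed
  have key: "1 / m < g (D, N) \<longleftrightarrow> 0 < s * (of_int N / real D - \<alpha>) \<and> (real D)\<^sup>2 * (s * (of_int N / real D - \<alpha>)) < m"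
    if "0 < m" "1 \<le> D" for m D N
  proof -
    define X where "X = s * (of_int N / real D - \<alpha>)"
    have "1 / m < inverse ((real D)\<^sup>2 * X) \<longleftrightarrow> 0 < X \<and> (real D)\<^sup>2 * X < m"
    proof (cases "X > 0")
      case True
      then show ?thesis using that by (simp add: field_simps)
    next
      case False
      then have "inverse ((real D)\<^sup>2 * X) \<le> 0" by (simp add: mult_nonneg_nonpos)
      then show ?thesis using that(1) False by (smt (verit) divide_pos_pos)
    qed
    then show ?thesis by (simp add: g X_def)
  qed
  have "L \<le> ereal (2 / c)"
    unfolding L
  proof (rule Limsup_bounded, unfold eventually_approx_filter)
    have "g (D, N) \<le> 2 / c" if "1 \<le> D" for D N
    proof (rule ccontr)
      assume "\<not> g (D, N) \<le> 2 / c"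
      then have "1 / (c/2) < g (D, N)" by simp
      then have "0 < s * (of_int N / real D - \<alpha>)" "(real D)\<^sup>2 * (s * (of_int N / real D - \<alpha>)) < c / 2"
        using key[of "c/2" D N] c that by (simp_all only: half_gt_zero)
      then show False using lower[OF that, of N] c by linarith
    qed
    then have "{p. 1 \<le> fst p \<and> \<not> ereal (g p) \<le> ereal (2 / c)} = {}" by auto
    then show "finite {p. 1 \<le> fst p \<and> \<not> ereal (g p) \<le> ereal (2 / c)}" by (simp only: finite.emptyI)
  qed
  \<comment> \<open>Excludes an upper limit that is 0 or negative, for which the reciprocal would be
    meaningless. This is where approximations from the prescribed side are needed.\<close>
  moreover have "ereal 1 \<le> L"
  proof (rule ccontr)
    assume "\<not> ereal 1 \<le> L"
    then have "Limsup approx_filter (\<lambda>p. ereal (g p)) < ereal 1" unfolding L by simp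
    from Limsup_lessD[OF this] have fin: "finite {p. 1 \<le> fst p \<and> \<not> g p < 1}"
      by (simp add: eventually_approx_filter)
    obtain K where K: "\<And>p. p \<in> {p. 1 \<le> fst p \<and> \<not> g p < 1} \<Longrightarrow> fst p < K"
      by (rule finite_fst_bound[OF fin]) (rule that)
    obtain k N where k: "K \<le> k" "1 \<le> k" "0 < s * (of_int N / real k - \<alpha>)" "(real k)\<^sup>2 * (s * (of_int N / real k - \<alpha>)) < 1"
      using one_sided_approx[OF bad s] .
    have "1 / 1 < g (k, N)" using key[of 1 k N] k by simp
    then have "(k, N) \<in> {p. 1 \<le> fst p \<and> \<not> g p < 1}" using k by auto
    from K[OF this] show False using k by simp
  qed
  ultimately obtain l where l: "L = ereal l" "1 \<le> l"
    by (cases L) auto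
  define \<nu> where "\<nu> = 1 / l"
  have \<nu>: "0 < \<nu>" using l by (simp add: \<nu>_def)
  have i: "\<exists>K. \<forall>k\<ge>K. \<forall>N::int. 0 < s * (N / real k - \<alpha>) \<longrightarrow> m \<le> (real k)\<^sup>2 * (s * (N / real k - \<alpha>))" if m: "m < \<nu>" for m
  proof (cases "m > 0")
    case True
    then have "l < 1 / m" using m l(2) by (simp add: \<nu>_def field_simps)
    then have "Limsup approx_filter (\<lambda>p. ereal (g p)) < ereal (1 / m)" unfolding L[symmetric] l(1) by simp
    from Limsup_lessD[OF this] have fin: "finite {p. 1 \<le> fst p \<and> \<not> g p < 1 / m}"
      by (simp add: eventually_approx_filter)
    obtain K where K: "\<And>p. p \<in> {p. 1 \<le> fst p \<and> \<not> g p < 1 / m} \<Longrightarrow> fst p < K"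
      by (rule finite_fst_bound[OF fin]) (rule that)
    have "m \<le> (real k)\<^sup>2 * (s * (N / real k - \<alpha>))" if k: "k \<ge> Suc K" and p: "0 < s * (N / real k - \<alpha>)" for k and N :: int
    proof (rule ccontr)
      assume "\<not> m \<le> (real k)\<^sup>2 * (s * (N / real k - \<alpha>))"
      moreover have "1 \<le> k" using k by simp
      ultimately have "(k, N) \<in> {p. 1 \<le> fst p \<and> \<not> g p < 1 / m}" using key[OF True, of k N] p by auto
      from K[OF this] show False using k by simp
    qed
    then show ?thesis by blast
  next
    case False
    have "m \<le> (real k)\<^sup>2 * (s * (N / real k - \<alpha>))" if p: "0 < s * (N / real k - \<alpha>)" for k and N :: int
    proof -
      have "0 \<le> (real k)\<^sup>2 * (s * (N / real k - \<alpha>))" using p by (intro mult_nonneg_nonneg[OF zero_le_power2]) (rule less_imp_le)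
      then show ?thesis using False by linarith
    qed
    then show ?thesis by blast
  qed
  have ii: "\<exists>k\<ge>K. 1 \<le> k \<and> (\<exists>N::int. 0 < s * (N / real k - \<alpha>) \<and> (real k)\<^sup>2 * (s * (N / real k - \<alpha>)) < m)"
    if m: "m > \<nu>" for m K
  proof (rule ccontr)
    assume neg: "\<not> (\<exists>k\<ge>K. 1 \<le> k \<and> (\<exists>N::int. 0 < s * (N / real k - \<alpha>) \<and> (real k)\<^sup>2 * (s * (N / real k - \<alpha>)) < m))"
    have m0: "0 < m" using m \<nu> by simp
    have "finite {p. 1 \<le> fst p \<and> \<not> g p \<le> 1 / m}"
    proof (rule finite_subset[OF _ finite_numerators[of K \<alpha> m]], clarify)
      fix k N assume H: "1 \<le> fst (k, N)" "\<not> g (k, N) \<le> 1 / m"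
      then have k: "1 \<le> k" "0 < s * (of_int N / real k - \<alpha>)" "(real k)\<^sup>2 * (s * (of_int N / real k - \<alpha>)) < m"
        using key[OF m0, of k N] by auto
      then have "k < K" using neg by (meson not_le)
      moreover have "\<bar>of_int N / real k - \<alpha>\<bar> = s * (of_int N / real k - \<alpha>)" using k ss by auto
      ultimately show "fst (k, N) < K \<and> 1 \<le> fst (k, N) \<and> \<bar>of_int (snd (k, N)) / real (fst (k, N)) - \<alpha>\<bar> * (real (fst (k, N)))\<^sup>2 \<le> m"
        using k by (simp add: mult.commute)
    qed
    then have "eventually (\<lambda>p. ereal (g p) \<le> ereal (1 / m)) approx_filter"
      by (simp add: eventually_approx_filter)
    from Limsup_bounded[OF this] have "l \<le> 1 / m" unfolding L[symmetric] l(1) by simp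
    then show False using m m0 l(2) by (simp add: \<nu>_def field_simps)
  qed
  show ?thesis unfolding l(1) real_of_ereal.simps \<nu>_def[symmetric] lagrange_def using \<nu> i ii by blast
qed

lemma angle_exp:
  assumes "0 < \<alpha>" "\<alpha> < 1"
  shows "angle (exp (2 * of_real pi * \<i> * of_real \<alpha>)) = \<alpha>"
  unfolding angle_def
proof (rule the_equality)
  fix \<beta> assume b: "0 < \<beta> \<and> \<beta> < 1 \<and> exp (2 * of_real pi * \<i> * of_real \<alpha>) = exp (2 * of_real pi * \<i> * of_real \<beta>)"
  then obtain n :: int where "2 * of_real pi * \<i> * of_real \<alpha> = 2 * of_real pi * \<i> * of_real \<beta> + (of_int (2 * n) * pi) * \<i>"
    using exp_eq[of "2 * of_real pi * \<i> * of_real \<alpha>" "2 * of_real pi * \<i> * of_real \<beta>"] by auto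
  then have "Im (2 * of_real pi * \<i> * of_real \<alpha>) = Im (2 * of_real pi * \<i> * of_real \<beta> + (of_int (2 * n) * pi) * \<i>)" by (rule arg_cong)
  then have "pi * (2 * \<alpha>) = pi * (2 * (\<beta> + of_int n))" by (simp add: algebra_simps)
  then have "\<alpha> = \<beta> + of_int n" by simp
  then have "\<bar>of_int n :: real\<bar> < 1" using assms b by linarith
  then have "n = 0" by linarith
  then show "\<beta> = \<alpha>" using \<open>\<alpha> = \<beta> + of_int n\<close> by simp
qed (use assms in auto)

lemma lagrange_nu:
  assumes "badly_approx c \<alpha>" "angle lam = \<alpha>"
  shows "lagrange \<alpha> 1 (nu_plus lam)" "lagrange \<alpha> (-1) (nu_minus lam)"
proof -
  show "lagrange \<alpha> 1 (nu_plus lam)" unfolding nu_plus_def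
    by (rule lagrange_Limsup[OF assms(1)]) (auto simp: assms(2) approx_quality_def)
  have "- Liminf approx_filter (approx_quality \<alpha>) = Limsup approx_filter (\<lambda>p. - approx_quality \<alpha> p)"
    by (simp add: ereal_Limsup_uminus)
  then show "lagrange \<alpha> (-1) (nu_minus lam)" unfolding nu_minus_def
    by (intro lagrange_Limsup[OF assms(1)]) (auto simp: assms(2) approx_quality_def case_prod_unfold)
qed

section \<open>Roots of unity and partial fractions\<close>

lemma norm_cis_diff: "norm (cis a - cis b) = 2 * \<bar>sin ((a - b) / 2)\<bar>"
proof -
  have "cis a - cis b = cis b * (exp (\<i> * of_real (a - b)) - 1)"
    unfolding right_diff_distrib cis_conv_exp[symmetric] cis_mult by simp
  then show ?thesis by (simp only: norm_mult norm_cis dist_exp_i_1 mult_1)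
qed

lemma norm_cis_diff_le: "norm (cis a - cis b) \<le> \<bar>a - b\<bar>"
  using abs_sin_x_le_abs_x[of "(a - b) / 2"] by (simp add: norm_cis_diff)

text \<open>With y = x / 2 one has sin x = 2 tan y (cos y)^2; |tan y| is at least |y|, and (cos y)^2
  is at least 1/2 because cos x is nonnegative.\<close>

lemma abs_sin_ge:
  fixes x :: real assumes "\<bar>x\<bar> \<le> pi / 2" shows "\<bar>x\<bar> / 2 \<le> \<bar>sin x\<bar>"
proof -
  define y where "y = x / 2"
  have "\<bar>y\<bar> = \<bar>x\<bar> / 2" by (simp add: y_def)
  then have y: "\<bar>y\<bar> < pi / 2" using assms pi_gt_zero by linarith
  have "cos y > 0" using y by (simp add: cos_gt_zero_pi abs_less_iff)
  have "cos x \<ge> 0" using assms by (intro cos_ge_zero) auto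
  then have c2: "1 / 2 \<le> (cos y)\<^sup>2" using cos_double_cos[of y] by (simp add: y_def)
  have "\<bar>y\<bar> * (cos y)\<^sup>2 \<le> \<bar>tan y\<bar> * (cos y)\<^sup>2" by (intro mult_right_mono abs_tan_ge y) auto
  also have "\<dots> = \<bar>sin y * cos y\<bar>" using \<open>cos y > 0\<close> by (simp add: tan_def abs_mult power2_eq_square)
  also have "\<dots> = \<bar>sin x\<bar> / 2" using sin_double[of y] by (simp add: y_def)
  finally have "\<bar>y\<bar> * (cos y)\<^sup>2 \<le> \<bar>sin x\<bar> / 2" .
  moreover have "\<bar>y\<bar> * (1/2) \<le> \<bar>y\<bar> * (cos y)\<^sup>2" using c2 by (intro mult_left_mono) auto
  ultimately show ?thesis by (simp add: y_def)
qed

definition rt :: "nat \<Rightarrow> nat \<Rightarrow> complex" where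
  "rt k j = cis (2 * pi * (real j / real k))"

lemma norm_rt [simp]: "norm (rt k j) = 1"
  by (simp add: rt_def)

lemma rt_power: "rt k j ^ i = cis (2 * pi * real i / real k) ^ j"
  unfolding rt_def Complex.DeMoivre by (rule arg_cong[where f = cis]) (simp add: mult_ac)

lemma rt_power_self: "1 \<le> k \<Longrightarrow> rt k j ^ k = 1"
  by (simp add: rt_power Complex.DeMoivre)

lemma sum_rt_power:
  assumes "1 \<le> k" "0 < i" "i < k"
  shows "(\<Sum>j<k. rt k j ^ i) = 0"
proof -
  define w where "w = cis (2 * pi * real i / real k)"
  have "w \<noteq> 1"
  proof
    assume "w = 1"
    then have "norm (cis (2 * pi * real i / real k) - cis 0) = 0" by (simp add: w_def)
    moreover have "(2 * pi * real i / real k - 0) / 2 = pi * (real i / real k)" by simp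
    ultimately have "sin (pi * (real i / real k)) = 0" unfolding norm_cis_diff by simp
    moreover have "0 < pi * (real i / real k)" "pi * (real i / real k) < pi" using assms by (auto simp: field_simps)
    ultimately show False using sin_gt_zero by fastforce
  qed
  moreover have "w ^ k = 1" using assms by (simp add: w_def Complex.DeMoivre)
  ultimately show ?thesis by (simp add: rt_power w_def[symmetric] sum_gp_strict)
qed

text \<open>Each L / (q - L) is expanded through the factorisation of q^k - L^k = q^k - 1; summation
  over the roots then kills every power of L except the k-th.\<close>

lemma partial_fractions:
  assumes k: "1 \<le> k" and q: "q ^ k \<noteq> 1"
  shows "1 / (q ^ k - 1) = (1 / of_nat k) * (\<Sum>j<k. rt k j / (q - rt k j))"
proof -
  have "rt k j / (q - rt k j) = (\<Sum>m<k. q ^ (k - 1 - m) * rt k j ^ Suc m) / (q ^ k - 1)" for j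
  proof -
    have "q \<noteq> rt k j" using q rt_power_self[OF k] by metis
    moreover have "q ^ k - 1 = (q - rt k j) * (\<Sum>m<k. rt k j ^ m * q ^ (k - 1 - m))"
      using diff_power_eq_sum[of q "k - 1" "rt k j"] sum.nat_diff_reindex[of "\<lambda>m. rt k j ^ m * q ^ (k - 1 - m)" k] 
        rt_power_self[OF k, of j] k
      by (simp add: mult.commute lessThan_Suc_atMost)
    moreover have "(\<Sum>m<k. q ^ (k - 1 - m) * rt k j ^ Suc m) = rt k j * (\<Sum>m<k. rt k j ^ m * q ^ (k - 1 - m))"
      by (simp add: sum_distrib_left mult_ac)
    moreover define S where "S = (\<Sum>m<k. rt k j ^ m * q ^ (k - 1 - m))"
    ultimately have "q - rt k j \<noteq> 0" "q ^ k - 1 = (q - rt k j) * S" 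
      "(\<Sum>m<k. q ^ (k - 1 - m) * rt k j ^ Suc m) = rt k j * S" by auto
    moreover from this(2) q have "S \<noteq> 0" by auto
    ultimately show ?thesis by simp
  qed
  then have "(\<Sum>j<k. rt k j / (q - rt k j)) = (\<Sum>m<k. q ^ (k - 1 - m) * (\<Sum>j<k. rt k j ^ Suc m)) / (q ^ k - 1)"
    by (simp add: sum_distrib_left flip: sum_divide_distrib) (subst sum.swap, simp)
  also have "(\<Sum>m<k. q ^ (k - 1 - m) * (\<Sum>j<k. rt k j ^ Suc m)) = (\<Sum>m\<in>{k - 1}. q ^ (k - 1 - m) * (\<Sum>j<k. rt k j ^ Suc m))"
    by (rule sum.mono_neutral_right) (use k sum_rt_power[OF k] in \<open>auto simp del: power_Suc\<close>)
  also have "\<dots> = of_nat k" using k rt_power_self[OF k] by (simp del: power_Suc)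
  finally show ?thesis using k q by (simp add: field_simps)
qed

text \<open>The factor 1 / k in the partial fractions makes the sums over roots averages, so bounds
  uniform in \<open>j\<close> carry over without loss.\<close>

lemma norm_average_le:
  fixes f :: "nat \<Rightarrow> complex"
  assumes "1 \<le> k" "\<And>j. j < k \<Longrightarrow> norm (f j) \<le> K"
  shows "norm ((1 / of_nat k) * (\<Sum>j<k. f j)) \<le> K"
proof -
  have "norm (\<Sum>j<k. f j) \<le> of_nat (card {..<k}) * K" by (rule sum_norm_bound) (use assms in auto)
  then show ?thesis using assms(1) by (simp add: norm_mult norm_divide field_simps)
qed

text \<open>Comparing k-th powers avoids a search for the nearest root: L^k = 1, the point lam^k has
  distance at least of order c / k from 1, and the k-th power stretches distances on the circle by
  at most k.\<close>

lemma rt_gap: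
  assumes bad: "badly_approx c \<alpha>" and k: "1 \<le> k"
  shows "2 * c / (real k)\<^sup>2 \<le> norm (rt k j - cis (2 * pi * \<alpha>))"
proof -
  define N where "N = round (real k * \<alpha>)"
  define y where "y = real k * \<alpha> - of_int N"
  have y: "\<bar>y\<bar> \<le> 1/2" using of_int_round_abs_le[of "real k * \<alpha>"] by (simp add: y_def N_def abs_minus_commute)
  have cy: "c / real k \<le> \<bar>y\<bar>" using badly_approxD(2)[OF bad k] by (simp add: y_def)
  have "cis (2 * pi * \<alpha>) ^ k = cis (2 * pi * y)"
  proof -
    have "2 * pi * y = real k * (2 * pi * \<alpha>) + 2 * pi * of_int (- N)" by (simp add: y_def algebra_simps)
    then have "cis (2 * pi * y) = cis (real k * (2 * pi * \<alpha>)) * cis (2 * pi * of_int (- N))"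
      by (simp only: cis_mult)
    also have "cis (2 * pi * of_int (- N)) = 1" by (rule cis_multiple_2pi) auto
    finally show ?thesis by (simp only: Complex.DeMoivre mult_1_right)
  qed
  then have "norm (cis (2 * pi * y) - cis 0) = norm (rt k j ^ k - cis (2 * pi * \<alpha>) ^ k)"
    using rt_power_self[OF k] by (simp add: norm_minus_commute)
  also have "\<dots> \<le> real k * norm (rt k j - cis (2 * pi * \<alpha>))" by (rule norm_power_diff) auto
  finally have "2 * \<bar>sin (pi * y)\<bar> \<le> real k * norm (rt k j - cis (2 * pi * \<alpha>))" unfolding norm_cis_diff by simp
  moreover have "\<bar>pi * y\<bar> / 2 \<le> \<bar>sin (pi * y)\<bar>" using y by (intro abs_sin_ge) (simp add: abs_mult)
  ultimately have "pi * \<bar>y\<bar> \<le> real k * norm (rt k j - cis (2 * pi * \<alpha>))" by (simp add: abs_mult)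
  moreover have "2 * \<bar>y\<bar> \<le> pi * \<bar>y\<bar>" using pi_ge_two by (intro mult_right_mono) auto
  ultimately have "2 * (c / real k) \<le> real k * norm (rt k j - cis (2 * pi * \<alpha>))" using cy by linarith
  then show ?thesis using k by (simp add: field_simps power2_eq_square)
qed

text \<open>Coefficient of \<open>z ^ Suc m\<close> in F_n. About \<open>lam\<close>, L / (q - L) is
  minus the geometric series with terms L (q - lam)^n / (L - lam)^(n + 1), whence the sign and the
  exponent.\<close>

definition coefF :: "complex \<Rightarrow> nat \<Rightarrow> nat \<Rightarrow> complex" where
  "coefF lam n m = - ((1 / of_nat (Suc m)) * (\<Sum>j<Suc m. rt (Suc m) j / (rt (Suc m) j - lam) ^ Suc n))"

text \<open>Half of the decay of r^k pays for k^p, at the price p! / a^p. For p about 2 N this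
  factorial is the source of the Gevrey order 2.\<close>

lemma power_geometric_bound:
  fixes r :: real
  assumes "0 < r" "r < 1"
  obtains a where "0 < a" "\<And>p k. 1 \<le> k \<Longrightarrow> real k ^ p * r ^ k \<le> fact p / a ^ p * sqrt r ^ k"
proof -
  define a where "a = - ln r / 2"
  have a: "0 < a" using assms by (simp add: a_def)
  have "real k ^ p * r ^ k \<le> fact p / a ^ p * sqrt r ^ k" if "1 \<le> k" for p k
  proof -
    have "exp (- a) = sqrt r" using assms powr_half_sqrt[of r] by (simp add: a_def powr_def)
    then have e: "exp (- (a * real k)) = sqrt r ^ k" by (metis exp_of_nat2_mult minus_mult_left)
    have "exp (- (a * real k)) \<le> fact p / (a * real k) ^ p" using a that by (intro exp_neg_le_fact) auto
    then have "real k ^ p * sqrt r ^ k \<le> fact p / a ^ p"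
      using a that by (simp add: e power_mult_distrib field_simps)
    then have "real k ^ p * sqrt r ^ k * sqrt r ^ k \<le> fact p / a ^ p * sqrt r ^ k"
      using assms by (intro mult_right_mono) auto
    also have "real k ^ p * sqrt r ^ k * sqrt r ^ k = real k ^ p * r ^ k"
      using assms by (simp add: mult.assoc flip: power_mult_distrib)
    finally show ?thesis .
  qed
  then show ?thesis using that a by blast
qed

lemma summable_sqrt_geometric:
  fixes r :: real assumes "0 < r" "r < 1" shows "summable (\<lambda>m. sqrt r ^ Suc m)"
proof -
  have "\<bar>sqrt r\<bar> < 1" using assms by simp
  then have "summable (\<lambda>m. sqrt r ^ m)" by (intro summable_geometric) simp
  then show ?thesis by (subst summable_Suc_iff)
qed

lemma summable_poly_geometric:
  fixes r :: real assumes "0 < r" "r < 1" shows "summable (\<lambda>m. real (Suc m) ^ p * r ^ Suc m)"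
proof -
  obtain a where a: "0 < a" "\<And>p k. 1 \<le> k \<Longrightarrow> real k ^ p * r ^ k \<le> fact p / a ^ p * sqrt r ^ k"
    using power_geometric_bound[OF assms] by blast
  show ?thesis
    by (rule summable_comparison_test'[OF summable_mult[OF summable_sqrt_geometric[OF assms], of "fact p / a ^ p"], of 0])
       (use a(2)[of "Suc _" p] assms in \<open>simp del: power_Suc\<close>)
qed

section \<open>Convergence and holomorphy of \<open>f_delta\<close> off the unit circle\<close>

lemma f_delta_pser: "f_delta r q = pser r (\<lambda>m. 1 / (q ^ Suc m - 1))"
  by (auto simp: f_delta_def pser_def fun_eq_iff)

lemma unit_dist: "norm L = 1 \<Longrightarrow> \<bar>norm q - 1\<bar> \<le> norm (q - L)"
  using norm_triangle_ineq3[of q L] by simp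

lemma power_ne_1:
  fixes q :: complex assumes "norm q \<noteq> 1" "1 \<le> k" shows "q ^ k \<noteq> 1"
proof
  assume "q ^ k = 1"
  then have "norm q ^ k = 1" by (metis norm_one norm_power)
  then show False using power_eq_imp_eq_base[of "norm q" k 1] assms by simp
qed

lemma asum_bounded:
  assumes "0 < r" "r < 1" "\<And>m. norm (c m) \<le> K"
  shows "asum r c" "(\<Sum>m. norm (c m) * r ^ Suc m) \<le> K * (\<Sum>m. r ^ Suc m)"
proof -
  have s: "summable (\<lambda>m. r ^ Suc m)" using summable_poly_geometric[OF assms(1,2), of 0] by simp
  have le: "norm (c m) * r ^ Suc m \<le> K * r ^ Suc m" for m
    using assms by (intro mult_right_mono) auto
  show *: "asum r c"
    by (rule summable_comparison_test'[OF summable_mult[OF s, of K], of 0]) (use le assms(1) in auto)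
  show "(\<Sum>m. norm (c m) * r ^ Suc m) \<le> K * (\<Sum>m. r ^ Suc m)"
    unfolding suminf_mult[OF s, symmetric] by (rule suminf_le[OF le * summable_mult[OF s]])
qed

lemma f_delta_asum:
  assumes "0 < r" "r < 1" "norm q \<noteq> 1"
  shows "asum r (\<lambda>m. 1 / (q ^ Suc m - 1))"
proof (rule asum_bounded[OF assms(1,2), of _ "1 / \<bar>norm q - 1\<bar>"])
  fix m
  have "norm ((1 / of_nat (Suc m)) * (\<Sum>j<Suc m. rt (Suc m) j / (q - rt (Suc m) j))) \<le> 1 / \<bar>norm q - 1\<bar>"
    by (rule norm_average_le) (use unit_dist[of "rt (Suc m) _" q] assms in \<open>auto simp: norm_divide intro!: divide_left_mono mult_pos_pos\<close>)
  then show "norm (1 / (q ^ Suc m - 1)) \<le> 1 / \<bar>norm q - 1\<bar>"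
    using partial_fractions[of "Suc m" q] power_ne_1[OF assms(3), of "Suc m"] by simp
qed

text \<open>The derivative is taken termwise in the partial fractions. All roots of unity keep a
  fixed distance from \<open>q\<close>, so the error of the difference quotient is O(h) uniformly in
  \<open>m\<close>, which gives convergence in the norm.\<close>

lemma f_delta_B_holomorphic:
  assumes r: "0 < r" "r < 1" and U: "\<And>q. q \<in> U \<Longrightarrow> norm q \<noteq> 1"
  shows "B_holomorphic_on r (f_delta r) U"
  unfolding B_holomorphic_on_def
proof (intro ballI conjI)
  fix q assume "q \<in> U"
  then have q: "norm q \<noteq> 1" using U by blast
  show "f_delta r q \<in> B_space r" unfolding f_delta_pser by (rule pser_in_B_space[OF f_delta_asum[OF r q] r(1)])
  \<comment> \<open>Half of the distance to the circle: for |h| < \<delta> the point q + h still has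
    distance at least \<delta> from every root.\<close>
  define \<delta> where "\<delta> = \<bar>norm q - 1\<bar> / 2"
  have \<delta>: "\<delta> > 0" using q by (simp add: \<delta>_def)
  define d where "d = (\<lambda>m. - ((1 / of_nat (Suc m)) * (\<Sum>j<Suc m. rt (Suc m) j / (q - rt (Suc m) j)\<^sup>2)))"
  have far: "2 * \<delta> \<le> norm (q - rt k j)" for k j using unit_dist[of "rt k j" q] by (simp add: \<delta>_def)
  have "norm (d m) \<le> 1 / (2 * \<delta>)\<^sup>2" for m
    unfolding d_def norm_minus_cancel
  proof (rule norm_average_le)
    fix j
    have "(2 * \<delta>)\<^sup>2 \<le> norm (q - rt (Suc m) j) ^ 2" using far[of "Suc m" j] \<delta> by (intro power_mono) auto
    then show "norm (rt (Suc m) j / (q - rt (Suc m) j)\<^sup>2) \<le> 1 / (2 * \<delta>)\<^sup>2"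
      unfolding norm_divide norm_power norm_rt using \<delta> by (intro divide_left_mono) (auto intro!: mult_pos_pos)
  qed simp
  note d = asum_bounded(1)[where c = d, OF r this]
  define S where "S = (\<Sum>m. r ^ Suc m)"
  have main: "B_norm r (\<lambda>z. (f_delta r (q + h) z - f_delta r q z) / h - pser r d z) \<le> norm h / (4 * \<delta> ^ 3) * S"
    "0 \<le> B_norm r (\<lambda>z. (f_delta r (q + h) z - f_delta r q z) / h - pser r d z)"
    if h: "norm h < \<delta>" "h \<noteq> 0" for h
  proof -
    have qh: "norm (q + h) \<noteq> 1"
    proof
      assume "norm (q + h) = 1"
      then have "\<bar>norm q - 1\<bar> \<le> norm h" using norm_triangle_ineq3[of q "q + h"] by simp
      then show False using h \<delta> by (simp add: \<delta>_def)
    qed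
    have far': "\<delta> \<le> norm (q + h - rt k j)" for k j
      using far[of k j] h(1) norm_triangle_ineq2[of "q - rt k j" "- h"] by (simp add: algebra_simps)
    define e where "e = (\<lambda>m. (1 / ((q + h) ^ Suc m - 1) - 1 / (q ^ Suc m - 1)) / h - d m)"
    have "pser r e z = (f_delta r (q + h) z - f_delta r q z) / h - pser r d z" for z
    proof (cases "norm z < r")
      case True
      have "(\<lambda>m. (1 / ((q + h) ^ Suc m - 1) * z ^ Suc m - 1 / (q ^ Suc m - 1) * z ^ Suc m) / h - d m * z ^ Suc m)
         sums ((f_delta r (q + h) z - f_delta r q z) / h - pser r d z)"
        unfolding f_delta_pser
        by (intro sums_diff sums_divide pser_sums f_delta_asum r q qh True d)
      also have "(\<lambda>m. (1 / ((q + h) ^ Suc m - 1) * z ^ Suc m - 1 / (q ^ Suc m - 1) * z ^ Suc m) / h - d m * z ^ Suc m)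
         = (\<lambda>m. e m * z ^ Suc m)" by (simp add: e_def diff_divide_distrib left_diff_distrib)
      finally show ?thesis using True by (simp add: pser_def sums_iff)
    qed (simp add: pser_def f_delta_def)
    then have eq: "(\<lambda>z. (f_delta r (q + h) z - f_delta r q z) / h - pser r d z) = pser r e" by auto
    have "norm (e m) \<le> norm h / (4 * \<delta> ^ 3)" for m
    proof -
      define k where "k = Suc m"
      have pf: "1 / ((q + h) ^ k - 1) = (1 / of_nat k) * (\<Sum>j<k. rt k j / (q + h - rt k j))"
        "1 / (q ^ k - 1) = (1 / of_nat k) * (\<Sum>j<k. rt k j / (q - rt k j))"
        using partial_fractions[of k] power_ne_1[OF q, of k] power_ne_1[OF qh, of k] by (auto simp: k_def simp del: power_Suc)
      have alg: "(c * a - c * b) / h - - (c * s) = c * ((a - b) / h + s)" for a b c s :: complex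
        by (simp add: algebra_simps diff_divide_distrib)
      have "e m = (1 / of_nat k) * (\<Sum>j<k. (rt k j / (q + h - rt k j) - rt k j / (q - rt k j)) / h + rt k j / (q - rt k j)\<^sup>2)"
        unfolding e_def d_def k_def[symmetric] pf alg
        by (simp only: sum.distrib sum_subtractf sum_divide_distrib[symmetric])
      also have "(\<lambda>j. (rt k j / (q + h - rt k j) - rt k j / (q - rt k j)) / h + rt k j / (q - rt k j)\<^sup>2)
         = (\<lambda>j. rt k j * h / ((q + h - rt k j) * (q - rt k j)\<^sup>2))"
      proof
        fix j
        have nz: "q + h - rt k j \<noteq> 0" "q - rt k j \<noteq> 0" using far[of k j] far'[of k j] \<delta> by auto
        define A where "A = q - rt k j"
        have A: "q + h - rt k j = A + h" by (simp add: A_def)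
        show "(rt k j / (q + h - rt k j) - rt k j / (q - rt k j)) / h + rt k j / (q - rt k j)\<^sup>2
           = rt k j * h / ((q + h - rt k j) * (q - rt k j)\<^sup>2)"
          using nz h(2) unfolding A A_def[symmetric] by (simp add: divide_simps power2_eq_square) (simp add: algebra_simps)
      qed
      also have "norm ((1 / of_nat k) * (\<Sum>j<k. rt k j * h / ((q + h - rt k j) * (q - rt k j)\<^sup>2))) \<le> norm h / (4 * \<delta> ^ 3)"
      proof (rule norm_average_le)
        fix j
        have "\<delta> * (2 * \<delta>)\<^sup>2 \<le> norm (q + h - rt k j) * norm (q - rt k j) ^ 2"
          using far[of k j] far'[of k j] \<delta> by (intro mult_mono power_mono) auto
        moreover have "\<delta> * (2 * \<delta>)\<^sup>2 = 4 * \<delta> ^ 3" "0 < 4 * \<delta> ^ 3"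
          using \<delta> by (simp_all add: power2_eq_square power3_eq_cube)
        ultimately show "norm (rt k j * h / ((q + h - rt k j) * (q - rt k j)\<^sup>2)) \<le> norm h / (4 * \<delta> ^ 3)"
          unfolding norm_divide norm_mult norm_power norm_rt mult_1
          by (intro frac_le order_refl norm_ge_zero) linarith+
      qed (simp add: k_def)
      finally show ?thesis .
    qed
    note e = asum_bounded[where c = e, OF r this]
    show "B_norm r (\<lambda>z. (f_delta r (q + h) z - f_delta r q z) / h - pser r d z) \<le> norm h / (4 * \<delta> ^ 3) * S"
      unfolding eq S_def using B_norm_pser_le[OF e(1) r(1)] e(2) by linarith
    have "bounded (pser r e ` ball 0 r)" using pser_in_B_space[OF e(1) r(1)] by (simp add: B_space_def)
    from norm_le_B_norm[OF this, of 0] r(1)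
    show "0 \<le> B_norm r (\<lambda>z. (f_delta r (q + h) z - f_delta r q z) / h - pser r d z)"
      unfolding eq by (simp add: order.trans[OF norm_ge_zero])
  qed
  have ev: "eventually (\<lambda>h. norm h < \<delta> \<and> h \<noteq> 0) (at (0::complex))"
    unfolding eventually_at using \<delta> by (intro exI[of _ \<delta>]) auto
  have "((\<lambda>h::complex. norm h / (4 * \<delta> ^ 3) * S) \<longlongrightarrow> 0) (at 0)"
    using \<delta> by (auto intro!: tendsto_eq_intros)
  then have "((\<lambda>h. B_norm r (\<lambda>z. (f_delta r (q + h) z - f_delta r q z) / h - pser r d z)) \<longlongrightarrow> 0) (at 0)"
    by (rule tendsto_sandwich[OF _ _ tendsto_const, rotated 2])
       (use main in \<open>auto intro: eventually_mono[OF ev]\<close>)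
  then show "\<exists>d\<in>B_space r. ((\<lambda>h. B_norm r (\<lambda>z. (f_delta r (q + h) z - f_delta r q z) / h - d z)) \<longlongrightarrow> 0) (at 0)"
    using pser_in_B_space[OF d r(1)] by blast
qed

section \<open>The Gevrey expansion\<close>

text \<open>A circle touching the unit circle at \<open>lam\<close> leaves it quadratically. The
  distance D of L from the centre satisfies D^2 - 1/4 = (1 + u) |L - lam|^2; here 1 + u is at least
  1/2 and D + 1/2 is at most 3, whence the constant 6.\<close>

lemma tdisk_root_distance:
  assumes "\<bar>\<tau>\<bar> = 1" "norm lam = 1" "norm L = 1" "q \<in> tdisk lam \<tau> (1/2)"
  shows "(norm (L - lam))\<^sup>2 / 6 \<le> norm (q - L)"
proof -
  define d where "d = norm (L - lam)"
  define w where "w = L / lam"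
  have lam0: "lam \<noteq> 0" using assms(2) by auto
  have L: "L = lam * w" using lam0 by (simp add: w_def)
  have nw: "norm w = 1" using assms by (simp add: w_def norm_divide)
  then have w2: "(Re w)\<^sup>2 + (Im w)\<^sup>2 = 1" by (metis cmod_power2 one_power2)
  define u where "u = \<tau> / 2"
  have u: "\<bar>u\<bar> = 1/2" using assms(1) by (simp add: u_def)
  have c: "lam + (\<tau> * (1/2)) *\<^sub>R lam = lam * of_real (1 + u)" by (simp add: u_def scaleR_conv_of_real algebra_simps)
  have d2: "d\<^sup>2 = 2 - 2 * Re w"
  proof -
    have "L - lam = lam * (w - 1)" by (simp add: L algebra_simps)
    then have "d = norm (w - 1)" using assms(2) by (simp add: d_def norm_mult)
    then have "d\<^sup>2 = (Re w - 1)\<^sup>2 + (Im w)\<^sup>2" by (simp add: cmod_power2)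
    then show ?thesis using w2 by (simp add: power2_eq_square algebra_simps)
  qed
  define D where "D = norm (L - lam * of_real (1 + u))"
  have D2: "D\<^sup>2 = 1/4 + (1 + u) * d\<^sup>2"
  proof -
    have "L - lam * of_real (1 + u) = lam * (w - of_real (1 + u))" by (simp add: L algebra_simps)
    then have "D = norm (w - of_real (1 + u))" using assms(2) by (simp add: D_def norm_mult)
    then have "D\<^sup>2 = (Re w - (1 + u))\<^sup>2 + (Im w)\<^sup>2" by (simp add: cmod_power2)
    also have "\<dots> = 1 - 2 * (1 + u) * Re w + (1 + u)\<^sup>2" using w2 by (simp add: power2_eq_square algebra_simps)
    also have "u\<^sup>2 = 1/4" using u by (metis power2_abs power_one_over four_x_squared one_power2 power2_eq_square numeral_Bit0 mult_2 numeral_One one_add_one power_divide)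
    then have "1 - 2 * (1 + u) * Re w + (1 + u)\<^sup>2 = 1/4 + (1 + u) * (2 - 2 * Re w)"
      by (simp add: power2_eq_square algebra_simps)
    finally show ?thesis by (simp only: d2)
  qed
  have "D \<le> norm L + norm (lam * of_real (1 + u))" unfolding D_def by (rule norm_triangle_ineq4)
  then have D: "0 \<le> D" "D \<le> 5/2" using assms u by (auto simp: D_def norm_mult simp flip: of_real_add)
  have "(D - 1/2) * (D + 1/2) = (1 + u) * d\<^sup>2" using D2 by (simp add: power2_eq_square algebra_simps)
  moreover have "1/2 * d\<^sup>2 \<le> (1 + u) * d\<^sup>2" using u by (intro mult_right_mono) auto
  ultimately have 1: "1/2 * d\<^sup>2 \<le> (D - 1/2) * (D + 1/2)" by simp
  moreover have "0 \<le> d\<^sup>2" by simp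
  ultimately have "0 \<le> (D - 1/2) * (D + 1/2)" by linarith
  then have "0 \<le> D - 1/2" using D(1) by (auto simp: zero_le_mult_iff)
  then have "(D - 1/2) * (D + 1/2) \<le> (D - 1/2) * 3" using D by (intro mult_left_mono) auto
  then have 2: "d\<^sup>2 / 6 \<le> D - 1/2" using 1 by simp
  have "norm (q - lam * of_real (1 + u)) < 1/2" using assms(4) unfolding c by (simp add: dist_norm norm_minus_commute)
  moreover have "D \<le> norm (L - q) + norm (q - lam * of_real (1 + u))"
    unfolding D_def using norm_triangle_ineq[of "L - q" "q - lam * of_real (1 + u)"] by simp
  ultimately show ?thesis using 2 by (simp add: d_def norm_minus_commute)
qed

lemma geometric_remainder:
  fixes Q v :: complex
  assumes "v \<noteq> 0" "Q \<noteq> v"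
  shows "1 / (Q - v) + (\<Sum>i<N. Q ^ i / v ^ Suc i) = Q ^ N / (v ^ N * (Q - v))"
proof -
  have Qv: "Q - v \<noteq> 0" using assms by simp
  show ?thesis
  proof (induction N)
    case (Suc N)
    have "1 / (Q - v) + (\<Sum>i<Suc N. Q ^ i / v ^ Suc i) = Q ^ N / (v ^ N * (Q - v)) + Q ^ N / v ^ Suc N"
      using Suc.IH by simp
    also have "\<dots> = Q ^ Suc N / (v ^ Suc N * (Q - v))" using assms Qv
      by (simp add: divide_simps) (simp add: algebra_simps)
    finally show ?case .
  qed simp
qed

context
  fixes lam :: complex and C r :: real
  assumes lam: "norm lam = 1" and C: "0 < C" and r: "0 < r" "r < 1"
    and gap: "\<And>k j. 1 \<le> k \<Longrightarrow> C / (real k)\<^sup>2 \<le> norm (rt k j - lam)"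
begin

lemma gap_pos: "1 \<le> k \<Longrightarrow> 0 < C / (real k)\<^sup>2" "1 \<le> k \<Longrightarrow> rt k j \<noteq> lam"
  using gap[of k j] C by (auto simp: divide_le_0_iff)

lemma norm_gap_power:
  assumes "1 \<le> k" shows "norm (1 / (rt k j - lam) ^ n) \<le> (real k) ^ (2 * n) / C ^ n"
proof -
  have "norm (1 / (rt k j - lam) ^ n) \<le> 1 / (C / (real k)\<^sup>2) ^ n"
    unfolding norm_divide norm_power norm_one using gap_pos[OF assms] gap[OF assms]
    by (intro divide_left_mono power_mono mult_pos_pos zero_less_power) auto
  then show ?thesis by (simp add: power_divide power_mult)
qed

lemma norm_coefF_le: "norm (coefF lam n m) \<le> (real (Suc m)) ^ (2 * Suc n) / C ^ Suc n"
  unfolding coefF_def norm_minus_cancel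
proof (rule norm_average_le)
  fix j show "norm (rt (Suc m) j / (rt (Suc m) j - lam) ^ Suc n) \<le> (real (Suc m)) ^ (2 * Suc n) / C ^ Suc n"
    using norm_gap_power[of "Suc m" j "Suc n"] by (simp only: norm_divide norm_rt norm_one)
qed simp

lemma asum_poly:
  assumes "\<And>m. norm (c m) \<le> K * real (Suc m) ^ p"
  shows "asum r c"
  by (rule summable_comparison_test'[OF summable_mult[OF summable_poly_geometric[OF r, of p], of K], of 0])
     (use assms r in \<open>auto simp: mult.assoc[symmetric] simp del: power_Suc of_nat_Suc intro!: mult_right_mono\<close>)

lemma asum_coefF: "asum r (coefF lam n)"
  by (rule asum_poly[of _ "1 / C ^ Suc n" "2 * Suc n"]) (use norm_coefF_le[of n] in simp)

text \<open>Each of the N factors 1 / (L - lam) costs k^2. The last denominator q - L is bounded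
  below only by the square of the gap, because the disc is tangent to the circle, and costs
  k^4.\<close>

lemma remainder_coeff:
  assumes \<tau>: "\<bar>\<tau>\<bar> = 1" and q: "q \<in> tdisk lam \<tau> (1/2)" "norm q \<noteq> 1"
  shows "norm (1 / (q ^ Suc m - 1) - (\<Sum>i<N. coefF lam i m * (q - lam) ^ i))
     \<le> norm (q - lam) ^ N * (6 / C ^ (N + 2)) * real (Suc m) ^ (2 * N + 4)"
proof -
  define k where "k = Suc m"
  define Q where "Q = q - lam"
  have k: "1 \<le> k" by (simp add: k_def)
  have ne: "q \<noteq> rt k j" for j using q(2) by auto
  have Qv: "Q - (rt k j - lam) = q - rt k j" for j by (simp add: Q_def)
  have "coefF lam i m * Q ^ i = - ((1 / of_nat k) * ((\<Sum>j<k. rt k j / (rt k j - lam) ^ Suc i) * Q ^ i))" for i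
    by (simp only: coefF_def k_def mult_minus_left mult.assoc)
  then have "(\<Sum>i<N. coefF lam i m * Q ^ i) = - ((1 / of_nat k) * (\<Sum>i<N. (\<Sum>j<k. rt k j / (rt k j - lam) ^ Suc i) * Q ^ i))"
    by (simp only: sum_negf sum_distrib_left)
  then have "1 / (q ^ k - 1) - (\<Sum>i<N. coefF lam i m * Q ^ i)
     = (1 / of_nat k) * ((\<Sum>j<k. rt k j / (q - rt k j)) + (\<Sum>i<N. (\<Sum>j<k. rt k j / (rt k j - lam) ^ Suc i) * Q ^ i))"
    by (simp only: partial_fractions[OF k power_ne_1[OF q(2) k]] distrib_left diff_minus_eq_add)
  also have "(\<Sum>i<N. (\<Sum>j<k. rt k j / (rt k j - lam) ^ Suc i) * Q ^ i) = (\<Sum>j<k. \<Sum>i<N. rt k j / (rt k j - lam) ^ Suc i * Q ^ i)"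
    unfolding sum_distrib_right by (rule sum.swap)
  also have "(\<Sum>j<k. rt k j / (q - rt k j)) + \<dots> = (\<Sum>j<k. rt k j * (1 / (q - rt k j) + (\<Sum>i<N. Q ^ i / (rt k j - lam) ^ Suc i)))"
    by (simp add: sum.distrib distrib_left sum_distrib_left)
  also have "\<dots> = (\<Sum>j<k. rt k j * (Q ^ N / ((rt k j - lam) ^ N * (q - rt k j))))"
  proof (rule sum.cong[OF refl])
    fix j
    have "rt k j - lam \<noteq> 0" "Q \<noteq> rt k j - lam" using gap_pos(2)[OF k, of j] ne[of j] by (auto simp: Q_def)
    from geometric_remainder[OF this, of N]
    show "rt k j * (1 / (q - rt k j) + (\<Sum>i<N. Q ^ i / (rt k j - lam) ^ Suc i)) = rt k j * (Q ^ N / ((rt k j - lam) ^ N * (q - rt k j)))"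
      by (simp only: Qv)
  qed
  finally have eq: "1 / (q ^ k - 1) - (\<Sum>i<N. coefF lam i m * Q ^ i) = (1 / of_nat k) * (\<Sum>j<k. rt k j * (Q ^ N / ((rt k j - lam) ^ N * (q - rt k j))))" .
  have "norm (1 / (q ^ k - 1) - (\<Sum>i<N. coefF lam i m * Q ^ i)) \<le> norm Q ^ N * (6 / C ^ (N + 2)) * real k ^ (2 * N + 4)"
    unfolding eq
  proof (rule norm_average_le[OF k])
    fix j
    define d where "d = norm (rt k j - lam)"
    have d: "C / (real k)\<^sup>2 \<le> d" "0 < C / (real k)\<^sup>2" using gap[OF k] gap_pos[OF k] by (auto simp: d_def)
    have "(C / (real k)\<^sup>2) ^ N * ((C / (real k)\<^sup>2)\<^sup>2 / 6) \<le> d ^ N * (d\<^sup>2 / 6)"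
      using d by (intro mult_mono power_mono divide_right_mono) auto
    also have "\<dots> \<le> d ^ N * norm (q - rt k j)"
      using tdisk_root_distance[OF \<tau> lam norm_rt q(1)] by (intro mult_left_mono) (auto simp: d_def)
    finally have le: "(C / (real k)\<^sup>2) ^ N * ((C / (real k)\<^sup>2)\<^sup>2 / 6) \<le> d ^ N * norm (q - rt k j)" .
    have eq: "(C / (real k)\<^sup>2) ^ N * ((C / (real k)\<^sup>2)\<^sup>2 / 6) = C ^ (N + 2) / (6 * real k ^ (2 * N + 4))"
      by (simp add: power_divide power_add flip: power_mult) (simp add: power2_eq_square mult_ac)
    have "norm (rt k j * (Q ^ N / ((rt k j - lam) ^ N * (q - rt k j)))) = norm Q ^ N / (d ^ N * norm (q - rt k j))"
      by (simp add: norm_mult norm_divide norm_power d_def)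
    also have "\<dots> \<le> norm Q ^ N / (C ^ (N + 2) / (6 * real k ^ (2 * N + 4)))"
      using le C k unfolding eq by (intro frac_le) auto
    also have "\<dots> = norm Q ^ N * (6 / C ^ (N + 2)) * real k ^ (2 * N + 4)" by simp
    finally show "norm (rt k j * (Q ^ N / ((rt k j - lam) ^ N * (q - rt k j)))) \<le> norm Q ^ N * (6 / C ^ (N + 2)) * real k ^ (2 * N + 4)" .
  qed
  then show ?thesis by (simp only: k_def Q_def)
qed

text \<open>The four extra powers of k turn (2 N)! into (2 N + 4)!; undoing this costs a geometric
  factor only, by a bound on a binomial coefficient.\<close>

lemma fact_add4_le: "fact (n + 4) \<le> (fact n * (24 * 2 ^ (n + 4)) :: real)"
proof -
  have "fact 4 * fact n * ((n + 4) choose 4) = (fact (n + 4) :: nat)"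
    using binomial_fact_lemma[of 4 "n + 4"] by simp
  then have "(fact (n + 4) :: real) = fact 4 * fact n * real ((n + 4) choose 4)"
    by (metis of_nat_fact of_nat_mult)
  also have "real ((n + 4) choose 4) \<le> 2 ^ (n + 4)"
    using binomial_le_pow2[of "n + 4" 4] by (metis of_nat_le_iff of_nat_numeral of_nat_power)
  finally show ?thesis by (simp add: fact_numeral mult_ac mult_left_mono)
qed

lemma f_delta_expansion:
  assumes U: "disk_side U \<tau>"
  shows "carleman_expansion U lam (\<lambda>n. Gamma (1 + 2 * real n)) r (f_delta r) (\<lambda>n. pser r (coefF lam n))"
proof -
  have \<tau>: "\<bar>\<tau>\<bar> = 1" using U by (rule disk_side_abs)
  have td: "tangent_disk U lam (tdisk lam \<tau> (1/2))" by (rule tangent_disk_tdisk) (use U lam in auto)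
  have nq: "norm q \<noteq> 1" if "q \<in> tdisk lam \<tau> (1/2)" for q
  proof -
    have "q \<in> U" using td that unfolding tangent_disk_def by blast
    then show ?thesis using U by (auto simp: disk_side_def inner_disc_def outer_disc_def)
  qed
  obtain a where a: "0 < a" "\<And>p k. 1 \<le> k \<Longrightarrow> real k ^ p * r ^ k \<le> fact p / a ^ p * sqrt r ^ k"
    using power_geometric_bound[OF r] by blast
  define S where "S = (\<Sum>m. sqrt r ^ Suc m)"
  have S: "0 < S" unfolding S_def using r by (intro suminf_pos summable_sqrt_geometric) auto
  \<comment> \<open>\<open>c0\<close> and \<open>c1\<close> collect 6 / C^(N + 2) from the
    remainder, the factors 24, 2^(2 N + 4) and 1 / a^(2 N + 4) from the factorial, and the sum
    \<open>S\<close>.\<close>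
  define c0 where "c0 = 6 / C\<^sup>2 * S * (24 * 2 ^ 4) / a ^ 4"
  define c1 where "c1 = 4 / (a\<^sup>2 * C)"
  have c: "0 < c0" "0 < c1" using S a C by (auto simp: c0_def c1_def)
  have bound: "B_norm r (\<lambda>z. f_delta r q z - (\<Sum>n<N. pser r (coefF lam n) z * (q - lam) ^ n))
      \<le> c0 * c1 ^ N * Gamma (1 + 2 * real N) * norm (q - lam) ^ N"
    if q: "q \<in> tdisk lam \<tau> (1/2)" for N q
  proof -
    define e where "e = (\<lambda>m. 1 / (q ^ Suc m - 1) - (\<Sum>i<N. coefF lam i m * (q - lam) ^ i))"
    have eq: "(\<lambda>z. f_delta r q z - (\<Sum>n<N. pser r (coefF lam n) z * (q - lam) ^ n)) = pser r e"
      unfolding f_delta_pser e_def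
      by (rule ext, rule pser_sum_diff) (use f_delta_asum[OF r nq[OF q]] asum_coefF in auto)
    define K where "K = norm (q - lam) ^ N * (6 / C ^ (N + 2))"
    have K: "0 \<le> K" using C by (simp add: K_def)
    have e: "norm (e m) \<le> K * real (Suc m) ^ (2 * N + 4)" for m
      unfolding e_def K_def by (rule remainder_coeff[OF \<tau> q nq[OF q]])
    define P where "P = fact (2 * N + 4) / a ^ (2 * N + 4)"
    have term_le: "norm (e m) * r ^ Suc m \<le> K * P * sqrt r ^ Suc m" for m
    proof -
      have "norm (e m) * r ^ Suc m \<le> K * real (Suc m) ^ (2 * N + 4) * r ^ Suc m"
        using e[of m] r by (intro mult_right_mono) auto
      also have "\<dots> \<le> K * (P * sqrt r ^ Suc m)"
        unfolding mult.assoc P_def using K a(2)[of "Suc m" "2 * N + 4"] by (intro mult_left_mono) auto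
      finally show ?thesis by (simp add: mult.assoc)
    qed
    have "asum r e" by (rule asum_poly) (rule e)
    have "B_norm r (pser r e) \<le> (\<Sum>m. norm (e m) * r ^ Suc m)" by (rule B_norm_pser_le[OF \<open>asum r e\<close> r(1)])
    also have "\<dots> \<le> (\<Sum>m. K * P * sqrt r ^ Suc m)"
      by (rule suminf_le[OF term_le \<open>asum r e\<close> summable_mult[OF summable_sqrt_geometric[OF r]]])
    also have "\<dots> = K * P * S" unfolding S_def by (rule suminf_mult[OF summable_sqrt_geometric[OF r]])
    also have "\<dots> \<le> K * (fact (2 * N) * (24 * 2 ^ (2 * N + 4)) / a ^ (2 * N + 4)) * S"
      unfolding P_def using K S a fact_add4_le[of "2 * N"] by (intro mult_right_mono mult_left_mono divide_right_mono) auto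
    also have "\<dots> = c0 * c1 ^ N * fact (2 * N) * norm (q - lam) ^ N"
      unfolding K_def c0_def c1_def power_add power_mult power_divide power_mult_distrib by (simp add: mult_ac)
    also have "(fact (2 * N) :: real) = Gamma (1 + 2 * real N)"
      using Gamma_fact[of "2 * N", where 'a = real] by simp
    finally show ?thesis unfolding eq .
  qed
  have hol: "B_holomorphic_on r (f_delta r) (tdisk lam \<tau> (1/2))" by (rule f_delta_B_holomorphic[OF r nq])
  show ?thesis unfolding carleman_expansion_def
    by (intro conjI allI ballI exI[of _ "tdisk lam \<tau> (1/2)"] exI[of _ c0] exI[of _ c1]
          td c hol bound pser_in_B_space[OF asum_coefF r(1)])
qed

lemma f_delta_gevrey: "gevrey2_expansion lam r (f_delta r) (\<lambda>n. pser r (coefF lam n))"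
  unfolding gevrey2_expansion_def
  using f_delta_expansion[of inner_disc "-1"] f_delta_expansion[of outer_disc 1] by (simp add: disk_side_def)

end

section \<open>Growth of the coefficients\<close>

text \<open>Index differences beyond k / 2 are reflected to k - d, since the sine is symmetric about
  pi / 2.\<close>

lemma rt_separation:
  assumes "i < k" "j < k" "i \<noteq> j"
  shows "pi / real k \<le> norm (rt k i - rt k j)"
proof -
  have *: "pi / (2 * real k) \<le> \<bar>sin (pi * (real d / real k))\<bar>" if d: "0 < d" "d < k" for d
  proof -
    have le: "pi / (2 * real k) \<le> \<bar>sin (pi * (real e / real k))\<bar>" if e: "0 < e" "2 * e \<le> k" for e
    proof -
      have "\<bar>pi * (real e / real k)\<bar> = pi * (real e / real k)" using e by simp
      moreover have "pi * (real e / real k) \<le> pi * (1/2)" using e by (intro mult_left_mono) (auto simp: field_simps)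
      ultimately have "pi * (real e / real k) / 2 \<le> \<bar>sin (pi * (real e / real k))\<bar>"
        using abs_sin_ge[of "pi * (real e / real k)"] by simp
      moreover have "pi / (2 * real k) \<le> pi * (real e / real k) / 2" using e d by (simp add: field_simps)
      ultimately show ?thesis by linarith
    qed
    show ?thesis
    proof (cases "2 * d \<le> k")
      case True then show ?thesis using le d by blast
    next
      case False
      have "pi * (real d / real k) = pi - pi * (real (k - d) / real k)" using d by (simp add: of_nat_diff field_simps)
      then have "sin (pi * (real d / real k)) = sin (pi * (real (k - d) / real k))" by (simp only: sin_pi_minus)
      then show ?thesis using le[of "k - d"] False d by simp
    qed
  qed
  define d where "d = (if i < j then j - i else i - j)"
  have d: "0 < d" "d < k" using assms by (auto simp: d_def)
  have "norm (rt k i - rt k j) = 2 * \<bar>sin (pi * ((real i - real j) / real k))\<bar>"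
    unfolding rt_def norm_cis_diff by (simp add: diff_divide_distrib right_diff_distrib)
  also have "\<bar>sin (pi * ((real i - real j) / real k))\<bar> = \<bar>sin (pi * (real d / real k))\<bar>"
  proof (cases "i < j")
    case True
    then have "real i - real j = - real d" by (simp add: d_def of_nat_diff)
    then show ?thesis by (simp only:) simp
  qed (use assms in \<open>simp add: d_def of_nat_diff\<close>)
  finally show ?thesis using *[OF d] by simp
qed

text \<open>The numerator supplied by Dirichlet's theorem need not lie between 0 and k - 1;
  reduction modulo k leaves the root unchanged.\<close>

lemma rt_eq_cis_int:
  assumes "1 \<le> k" shows "rt k (nat (h mod int k)) = cis (2 * pi * (of_int h / real k))"
proof -
  have "real (nat (h mod int k)) = of_int (h mod int k)" using assms by simp
  also have "\<dots> = of_int h - real k * of_int (h div int k)"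
    by (metis of_int_diff of_int_mult of_int_of_nat_eq minus_mult_div_eq_mod)
  finally have e: "of_int h = real (nat (h mod int k)) + real k * of_int (h div int k)" by linarith
  have "2 * pi * (of_int h / real k) = 2 * pi * (real (nat (h mod int k)) / real k) + 2 * pi * of_int (h div int k)"
    using assms by (subst e) (simp add: add_divide_distrib distrib_left)
  then have "cis (2 * pi * (of_int h / real k)) = rt k (nat (h mod int k)) * cis (2 * pi * of_int (h div int k))"
    by (simp only: rt_def cis_mult)
  then show ?thesis by (simp add: cis_multiple_2pi)
qed

text \<open>For \<open>n\<close> large the root of unity closest to \<open>lam\<close> dominates the coefficient.\<close>

lemma coefF_lower:
  assumes bad: "badly_approx c \<alpha>" and lam: "lam = cis (2 * pi * \<alpha>)" and n: "8 \<le> n"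
  obtains m where "Suc m \<le> n" "(c / 8) ^ Suc n * real n ^ (2 * n) / 2 \<le> norm (coefF lam n m)"
proof -
  note c = badly_approxD(1)[OF bad]
  obtain h q where hq: "0 < q" "q \<le> int n" "\<bar>of_int q * \<alpha> - of_int h\<bar> < 1 / real n"
    by (rule Dirichlet_approx[of n \<alpha>]) (use n in simp, rule that)
  define k where "k = nat q"
  have k: "1 \<le> k" "k \<le> n" "q = int k" using hq by (auto simp: k_def)
  define j where "j = nat (h mod int k)"
  have j: "j < k" using k by (simp add: j_def nat_less_iff)
  have gap: "2 * c / (real k)\<^sup>2 \<le> norm (rt k i - lam)" for i using rt_gap[OF bad k(1)] by (simp add: lam)
  have "c / real k < 1 / real n" using badly_approxD(2)[OF bad k(1), of h] hq(3) k(3) by simp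
  \<comment> \<open>Bad approximability makes the Dirichlet denominator comparable to n, so that 1 /
    (n k) is of order 1 / n^2.\<close>
  then have ck: "c * real n < real k" using k n by (simp add: field_simps)
  define v where "v = (\<lambda>i. rt k i - lam)"
  have vpos: "0 < norm (v i)" for i using gap[of i] c k(1)
    by (metis v_def divide_pos_pos mult_pos_pos of_nat_0_less_iff order_less_le_trans zero_less_numeral zero_less_power less_le_trans zero_less_one)
  define V where "V = norm (v j)"
  have V: "0 < V" using vpos by (simp add: V_def)
  have Vle: "V \<le> 2 * pi / (real n * real k)"
  proof -
    have "V = norm (cis (2 * pi * (of_int h / real k)) - cis (2 * pi * \<alpha>))"
      unfolding V_def v_def j_def rt_eq_cis_int[OF k(1)] lam ..
    also have "\<dots> \<le> \<bar>2 * pi * (of_int h / real k) - 2 * pi * \<alpha>\<bar>" by (rule norm_cis_diff_le)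
    also have "2 * pi * (of_int h / real k) - 2 * pi * \<alpha> = 2 * pi / real k * - (of_int q * \<alpha> - of_int h)"
      using k by (simp add: field_simps)
    also have "\<bar>\<dots>\<bar> = 2 * pi / real k * \<bar>of_int q * \<alpha> - of_int h\<bar>" by (simp add: abs_mult abs_minus_commute)
    also have "\<dots> \<le> 2 * pi / real k * (1 / real n)" using hq(3) by (intro mult_left_mono) auto
    finally show ?thesis by (simp add: mult.commute)
  qed
  \<comment> \<open>Another root is at least pi / k away from the nearest one, hence at least pi /
    (2 k) from \<open>lam\<close>, against V at most 2 pi / (n k): the ratio is at least n /
    4.\<close>
  have other: "1 / norm (v i) ^ Suc n \<le> (4 / real n) ^ Suc n * (1 / V ^ Suc n)" if i: "i < k" "i \<noteq> j" for i
  proof -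
    have "pi / real k \<le> norm (rt k i - rt k j)" by (rule rt_separation[OF i(1) j i(2)])
    also have "\<dots> \<le> norm (v i) + V" unfolding v_def V_def using norm_triangle_ineq4[of "rt k i - lam" "rt k j - lam"] by simp
    finally have 1: "pi / real k - 2 * pi / (real n * real k) \<le> norm (v i)" using Vle by linarith
    have "pi / (2 * real k) \<le> pi / real k - 2 * pi / (real n * real k)" using n k by (simp add: field_simps)
    then have 2: "pi / (2 * real k) \<le> norm (v i)" using 1 by linarith
    have "V * real n \<le> 4 * (pi / (2 * real k))" using Vle k n by (simp add: field_simps)
    then have "V * real n \<le> 4 * norm (v i)" using 2 by linarith
    then have "1 / norm (v i) \<le> (4 / real n) * (1 / V)" using V vpos[of i] n by (simp add: field_simps)
    then have "(1 / norm (v i)) ^ Suc n \<le> ((4 / real n) * (1 / V)) ^ Suc n" using vpos[of i] by (intro power_mono) auto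
    then show ?thesis by (simp add: power_divide power_mult_distrib del: power_Suc)
  qed
  define T where "T = (\<Sum>i<k. rt k i / v i ^ Suc n)"
  have "T = rt k j / v j ^ Suc n + (\<Sum>i\<in>{..<k} - {j}. rt k i / v i ^ Suc n)"
    unfolding T_def using j by (subst sum.remove[of _ j]) auto
  moreover have "norm (rt k j / v j ^ Suc n) = 1 / V ^ Suc n" by (simp only: norm_divide norm_power norm_rt V_def)
  \<comment> \<open>At most n other terms, each smaller by (4 / n)^(n + 1); for n at least 8 their
    total is at most half of the dominant term.\<close>
  moreover have "norm (\<Sum>i\<in>{..<k} - {j}. rt k i / v i ^ Suc n) \<le> 1 / 2 * (1 / V ^ Suc n)"
  proof -
    have "norm (\<Sum>i\<in>{..<k} - {j}. rt k i / v i ^ Suc n) \<le> of_nat (card ({..<k} - {j})) * ((4 / real n) ^ Suc n * (1 / V ^ Suc n))"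
      by (rule sum_norm_bound) (use other in \<open>auto simp only: norm_divide norm_power norm_rt lessThan_iff DiffD1 DiffD2 singleton_iff Diff_iff\<close>)
    also have "\<dots> \<le> real n * ((4 / real n) ^ Suc n * (1 / V ^ Suc n))"
      using j k V by (intro mult_right_mono) auto
    also have "\<dots> = (real n * (4 / real n) ^ Suc n) * (1 / V ^ Suc n)" by simp
    also have "real n * (4 / real n) ^ Suc n = 4 * (4 / real n) ^ n" using n by simp
    also have "4 * (4 / real n) ^ n * (1 / V ^ Suc n) \<le> 1 / 2 * (1 / V ^ Suc n)"
    proof -
      have "(4 / real n) ^ n \<le> (1/2) ^ n" using n by (intro power_mono) (auto simp: field_simps)
      also have "((1/2) ^ n :: real) \<le> (1/2) ^ 8" using n by (intro power_decreasing) auto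
      also have "((1/2) ^ 8 :: real) = 1 / 256" by (simp add: power_divide)
      finally have "4 * (4 / real n) ^ n \<le> 1 / 2" by linarith
      then show ?thesis using V by (intro mult_right_mono) auto
    qed
    finally show ?thesis .
  qed
  ultimately have "1 / V ^ Suc n - 1 / 2 * (1 / V ^ Suc n) \<le> norm T"
    using norm_triangle_ineq2[of "rt k j / v j ^ Suc n" "- (\<Sum>i\<in>{..<k} - {j}. rt k i / v i ^ Suc n)"]
    by (simp only: diff_minus_eq_add norm_minus_cancel)
  then have T: "1 / (2 * V ^ Suc n) \<le> norm T" by simp
  \<comment> \<open>From V at most 2 pi / (n k) and k > c n, with 2 pi below 8.\<close>
  have "1 / V \<ge> c / 8 * real n * real n"
  proof -
    have "V * (c * real n * real n) \<le> 2 * pi / (real n * real k) * (c * real n * real n)"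
      using Vle c by (intro mult_right_mono) auto
    also have "\<dots> = 2 * pi * (c * real n) / real k" using n by simp
    also have "\<dots> \<le> 2 * pi" using ck k by (simp add: field_simps)
    also have "\<dots> \<le> 8" using pi_less_4 by simp
    finally show ?thesis using V by (simp add: field_simps)
  qed
  then have "(c / 8 * real n * real n) ^ Suc n \<le> (1 / V) ^ Suc n" using c by (intro power_mono) auto
  then have h: "(c / 8 * real n * real n) ^ Suc n / 2 \<le> norm T" using T by (simp add: power_divide del: power_Suc)
  define X where "X = (c / 8) ^ Suc n * real n ^ (2 * n)"
  have e: "(c / 8 * real n * real n) ^ Suc n = X * (real n * real n)"
    unfolding power_mult_distrib X_def by (simp add: mult_2 power_add)
  have "X * (real n * real n) / 2 \<le> norm T" using h by (simp only: e)
  then have "X * (real n * real n) / 2 / real n \<le> norm T / real n" by (rule divide_right_mono) simp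
  also have "\<dots> \<le> norm T / real k" using k by (intro divide_left_mono) auto
  also have "\<dots> = norm (coefF lam n (k - 1))"
    using k by (simp add: coefF_def T_def v_def norm_mult norm_divide del: power_Suc)
  finally have "X * real n / 2 \<le> norm (coefF lam n (k - 1))" using n by simp
  moreover have "X * 1 \<le> X * real n" using n c by (intro mult_left_mono) (auto simp: X_def)
  ultimately have "X / 2 \<le> norm (coefF lam n (k - 1))" by simp
  then have "(c / 8) ^ Suc n * real n ^ (2 * n) / 2 \<le> norm (coefF lam n (k - 1))" by (simp only: X_def)
  then show ?thesis using that[of "k - 1"] k by simp
qed

text \<open>A bound on F_n bounds its large coefficient, whose index m is below n, at the cost of a
  factor at most (2 / r)^n; and n^(2 n) is at least (2 n)! / 4^n.\<close>

lemma weights_lower: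
  assumes bad: "badly_approx c \<alpha>" and lam: "lam = cis (2 * pi * \<alpha>)" and r: "0 < r" "r < 1"
    and M: "\<And>n. 0 < M n" and A: "0 < A" "0 < B"
    and bound: "\<And>n z. z \<in> ball 0 r \<Longrightarrow> norm (pser r (coefF lam n) z) \<le> A * B ^ n * M n"
  obtains c' d where "0 < c'" "0 < d" "\<And>n. c' * d ^ n * fact (2 * n) \<le> M n"
proof -
  note c = badly_approxD(1)[OF bad]
  have asum: "asum r (coefF lam n)" for n
  proof (rule asum_coefF)
    show "norm lam = 1" by (simp add: lam)
    show "0 < 2 * c" using c by simp
    show "2 * c / (real k)\<^sup>2 \<le> norm (rt k j - lam)" if "1 \<le> k" for k j using rt_gap[OF bad that] by (simp add: lam)
  qed (use r in auto)
  define d where "d = (c / 8) * (r / 2) / (4 * B)"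
  have d: "0 < d" using c r A by (simp add: d_def)
  define c1 where "c1 = c / (16 * A)"
  have c1: "0 < c1" using c A by (simp add: c1_def)
  have large: "c1 * d ^ n * fact (2 * n) \<le> M n" if n: "8 \<le> n" for n
  proof -
    obtain m where m: "Suc m \<le> n" "(c / 8) ^ Suc n * real n ^ (2 * n) / 2 \<le> norm (coefF lam n m)"
      using coefF_lower[OF bad lam n] .
    have "(r / 2) ^ n \<le> (r / 2) ^ Suc m" using m(1) r by (intro power_decreasing) auto
    then have "((c / 8) ^ Suc n * real n ^ (2 * n) / 2) * (r / 2) ^ n \<le> norm (coefF lam n m) * (r / 2) ^ Suc m"
      using m(2) c r by (intro mult_mono) auto
    also have "\<dots> \<le> A * B ^ n * M n" by (rule pser_coeff[OF asum r(1)]) (use bound in auto)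
    finally have 1: "((c / 8) ^ Suc n * real n ^ (2 * n) / 2) * (r / 2) ^ n \<le> A * B ^ n * M n" .
    have "(fact (2 * n) :: real) \<le> of_nat ((2 * n) ^ (2 * n))" by (rule fact_le_power)
    also have "\<dots> = 4 ^ n * real n ^ (2 * n)" by (simp add: power_mult_distrib power_mult)
    finally have 2: "(fact (2 * n) :: real) \<le> 4 ^ n * real n ^ (2 * n)" .
    have "c1 * d ^ n * fact (2 * n) \<le> c1 * d ^ n * (4 ^ n * real n ^ (2 * n))" using c1 d 2 by (intro mult_left_mono) auto
    also have "\<dots> = ((c / 8) ^ Suc n * real n ^ (2 * n) / 2) * (r / 2) ^ n / (A * B ^ n)"
      unfolding c1_def d_def power_mult_distrib power_divide by (simp add: mult_ac)
    also have "\<dots> \<le> A * B ^ n * M n / (A * B ^ n)" using 1 A by (intro divide_right_mono) auto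
    also have "\<dots> = M n" using A by simp
    finally show ?thesis .
  qed
  \<comment> \<open>The coefficient bound starts at n = 8; the smaller n are covered by lowering the
    constant, as the weights are positive.\<close>
  define S where "S = insert c1 ((\<lambda>n. M n / (d ^ n * fact (2 * n))) ` {..<8})"
  define c' where "c' = Min S"
  have S: "finite S" "S \<noteq> {}" by (auto simp: S_def)
  have "0 < c'" unfolding c'_def using S by (subst Min_gr_iff) (auto simp: S_def c1 M d)
  moreover have "c' * d ^ n * fact (2 * n) \<le> M n" for n
  proof (cases "8 \<le> n")
    case True
    have "c' \<le> c1" unfolding c'_def using S by (auto simp: S_def)
    then have "c' * (d ^ n * fact (2 * n)) \<le> c1 * (d ^ n * fact (2 * n))" using d by (intro mult_right_mono) auto
    then show ?thesis using large[OF True] by (simp add: mult.assoc)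
  next
    case False
    then have "c' \<le> M n / (d ^ n * fact (2 * n))" unfolding c'_def using S by (intro Min_le) (auto simp: S_def)
    then show ?thesis using d by (simp add: field_simps)
  qed
  ultimately show ?thesis using that d by blast
qed

section \<open>A gap theorem for exponential series\<close>

text \<open>Upper Stirling bound; with x = n + 1 the induction step reduces to (1 - 1 / x)^x being
  at most 1 / e.\<close>

lemma fact_le_exp_power:
  assumes "1 \<le> n" shows "(fact n :: real) \<le> exp 1 * n * (real n ^ n * exp (- real n))"
  using assms
proof (induction n rule: nat_induct_at_least)
  case base show ?case by (simp add: exp_minus)
next
  case (Suc n)
  define x where "x = real (Suc n)"
  have x: "x > 0" "real n = x - 1" by (auto simp: x_def)
  have "(1 - 1 / x) ^ Suc n \<le> exp (- (1 / x)) ^ Suc n"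
    using exp_ge_add_one_self[of "- (1 / x)"] x(1) by (intro power_mono) (auto simp: x_def)
  also have "\<dots> = exp (- 1)" using x(1) unfolding exp_of_nat_mult[symmetric] by (simp add: x_def[symmetric] del: of_nat_Suc)
  also have "1 - 1 / x = real n / x" using x by (simp add: field_simps)
  finally have "real n ^ Suc n / x ^ Suc n \<le> exp (- 1)" by (simp only: power_divide)
  then have *: "real n ^ Suc n \<le> exp (- 1) * x ^ Suc n" using x by (simp add: pos_divide_le_eq del: power_Suc)
  have "(fact (Suc n) :: real) = x * fact n" by (simp add: x_def)
  also have "\<dots> \<le> x * (exp 1 * n * (real n ^ n * exp (- real n)))" using Suc.IH x by (intro mult_left_mono) auto
  also have "\<dots> = x * exp 1 * exp (- real n) * real n ^ Suc n" by simp
  also have "\<dots> \<le> x * exp 1 * exp (- real n) * (exp (- 1) * x ^ Suc n)" using * x by (intro mult_left_mono) auto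
  also have "exp (- real n) = exp 1 * exp (- x)" by (simp add: x_def flip: exp_add)
  also have "x * exp 1 * (exp 1 * exp (- x)) * (exp (- 1) * x ^ Suc n) = exp 1 * x * (x ^ Suc n * exp (- x))"
    by (simp add: exp_minus)
  finally show ?case by (simp only: x_def)
qed

text \<open>The function u exp (1 - u) has its maximum 1 at u = 1. The gain away from the peak must
  also grow with u, so that its n-th power leaves a factor that makes the sum over all frequencies
  converge.\<close>

lemma mult_exp_le_off_one:
  fixes u \<eta> :: real
  assumes "0 < \<eta>" "0 \<le> u" "\<eta> \<le> \<bar>u - 1\<bar>"
  shows "u * exp (1 - u) \<le> exp (- ((\<eta> / (2 + \<eta>))\<^sup>2 / 2) * (1 + u))"
proof (cases "u = 0")
  case False
  then have u: "0 < u" using assms by simp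
  define v where "v = sqrt u"
  have v: "0 < v" "v\<^sup>2 = u" using u by (auto simp: v_def)
  \<comment> \<open>Applying the inequality ln v \<le> v - 1 to the square root of u, not to u,
    leaves the square of v - 1 as the gain.\<close>
  have "ln u = 2 * ln v" using v ln_realpow[of v 2] by simp
  also have "\<dots> \<le> 2 * (v - 1)" using ln_le_minus_one[OF v(1)] by simp
  finally have 1: "ln u + (1 - u) \<le> - (v - 1)\<^sup>2" using v by (simp add: power2_eq_square algebra_simps)
  \<comment> \<open>The least value of |u - 1| / (u + 1) for |u - 1| at least \<eta>, reached at u =
    1 + \<eta>.\<close>
  define t where "t = \<eta> / (2 + \<eta>)"
  have t: "0 < t" using assms by (simp add: t_def)
  have "t * (1 + u) \<le> \<bar>u - 1\<bar>"
  proof -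
    have "\<eta> * (1 + u) \<le> \<bar>u - 1\<bar> * (2 + \<eta>)"
    proof (cases "u \<ge> 1")
      case True
      then have "u - 1 \<ge> \<eta>" using assms by simp
      then have "\<eta> * 2 \<le> (u - 1) * 2" by simp
      then show ?thesis using True by (simp add: algebra_simps)
    next
      case False
      then have "1 - u \<ge> \<eta>" using assms by simp
      have n: "0 \<le> \<eta> * (1 - u)" using assms False by (intro mult_nonneg_nonneg) auto
      have "\<eta> * (1 + u) \<le> \<eta> * 2" using assms False by (intro mult_left_mono) auto
      also have "\<dots> \<le> 2 * (1 - u) + \<eta> * (1 - u)" using n \<open>1 - u \<ge> \<eta>\<close> by simp
      also have "\<dots> = (1 - u) * (2 + \<eta>)" by (simp add: algebra_simps)
      finally have "\<eta> * (1 + u) \<le> (1 - u) * (2 + \<eta>)" .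
      then show ?thesis using False by simp
    qed
    then show ?thesis using assms by (simp add: t_def pos_divide_le_eq)
  qed
  then have "(t * (1 + u))\<^sup>2 \<le> (u - 1)\<^sup>2" using t u
    by (intro abs_le_square_iff[THEN iffD1]) (simp add: abs_mult)
  also have "(u - 1)\<^sup>2 = (v - 1)\<^sup>2 * (v + 1)\<^sup>2" using v by (simp add: power2_eq_square algebra_simps flip: v(2))
  also have "(v + 1)\<^sup>2 \<le> 2 * (1 + u)" using zero_le_power2[of "v - 1"] v by (simp add: power2_eq_square algebra_simps)
  then have "(v - 1)\<^sup>2 * (v + 1)\<^sup>2 \<le> (v - 1)\<^sup>2 * (2 * (1 + u))" by (intro mult_left_mono) auto
  finally have "(t * (1 + u))\<^sup>2 \<le> (v - 1)\<^sup>2 * (2 * (1 + u))" .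
  moreover have "(t\<^sup>2 / 2 * (1 + u)) * (2 * (1 + u)) = (t * (1 + u))\<^sup>2" by (simp add: power2_eq_square)
  ultimately have "(t\<^sup>2 / 2 * (1 + u)) * (2 * (1 + u)) \<le> (v - 1)\<^sup>2 * (2 * (1 + u))" by (simp only:)
  then have 2: "t\<^sup>2 / 2 * (1 + u) \<le> (v - 1)\<^sup>2" using u by (simp add: mult_le_cancel_right)
  have "u * exp (1 - u) = exp (ln u + (1 - u))" using u by (simp add: exp_add)
  also have "\<dots> \<le> exp (- (t\<^sup>2 / 2) * (1 + u))" using 1 2 by simp
  finally show ?thesis by (simp only: t_def)
qed simp

text \<open>Exponential series with terms a_k exp (b_k s) whose frequencies lie within
  \<open>B\<close> of the nonnegative real axis. Up to the factor exp (B |s|) they act like |b_k|,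
  so the series converges for Re s < 0, and 0 is the boundary point under study.\<close>

locale lacunary =
  fixes a b :: "nat \<Rightarrow> complex" and B :: real
  assumes b: "\<And>k. norm (b k - of_real (norm (b k))) \<le> B"
    and summ: "\<And>\<sigma>. 0 < \<sigma> \<Longrightarrow> summable (\<lambda>k. norm (a k) * exp (- \<sigma> * norm (b k)))"
begin

lemma B_nonneg: "0 \<le> B"
  using b[of 0] norm_ge_zero order.trans by blast

lemma Re_b: "Re (b k * s) \<le> norm (b k) * Re s + B * norm s" "norm (b k) * Re s - B * norm s \<le> Re (b k * s)"
proof -
  have "Re (b k * s) = norm (b k) * Re s + Re ((b k - of_real (norm (b k))) * s)"
    by (simp add: algebra_simps)
  moreover have "\<bar>Re ((b k - of_real (norm (b k))) * s)\<bar> \<le> B * norm s"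
    using abs_Re_le_cmod[of "(b k - of_real (norm (b k))) * s"] mult_right_mono[OF b[of k], of "norm s"]
    by (simp add: norm_mult)
  ultimately show "Re (b k * s) \<le> norm (b k) * Re s + B * norm s" "norm (b k) * Re s - B * norm s \<le> Re (b k * s)"
    by linarith+
qed

text \<open>The powers of the frequencies are paid for with half of the exponential decay.\<close>

lemma summable_derivs:
  assumes "0 < \<sigma>" shows "summable (\<lambda>k. norm (a k) * norm (b k) ^ n * exp (- \<sigma> * norm (b k)))"
proof -
  define K where "K = (fact n :: real) / (\<sigma> / 2) ^ n"
  have "norm (b k) ^ n * exp (- \<sigma> * norm (b k)) \<le> K * exp (- (\<sigma> / 2) * norm (b k))" for k
  proof (cases "b k = 0")
    case True
    then show ?thesis using assms by (cases n) (auto simp: K_def)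
  next
    case False
    have e: "exp (- \<sigma> * norm (b k)) = exp (- (\<sigma> / 2 * norm (b k))) * exp (- (\<sigma> / 2) * norm (b k))"
      by (simp add: algebra_simps flip: exp_add)
    have "exp (- (\<sigma> / 2 * norm (b k))) \<le> fact n / (\<sigma> / 2 * norm (b k)) ^ n"
      using assms False by (intro exp_neg_le_fact) auto
    also have "\<dots> = K / norm (b k) ^ n" by (simp only: K_def power_mult_distrib divide_divide_eq_left)
    finally have "norm (b k) ^ n * exp (- (\<sigma> / 2 * norm (b k))) \<le> K"
      using False by (simp add: field_simps)
    then have "norm (b k) ^ n * exp (- (\<sigma> / 2 * norm (b k))) * exp (- (\<sigma> / 2) * norm (b k)) \<le> K * exp (- (\<sigma> / 2) * norm (b k))"
      by (intro mult_right_mono) auto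
    then show ?thesis unfolding e by (simp only: mult.assoc)
  qed
  then have *: "norm (a k) * (norm (b k) ^ n * exp (- \<sigma> * norm (b k))) \<le> norm (a k) * (K * exp (- (\<sigma> / 2) * norm (b k)))" for k
    by (intro mult_left_mono) auto
  have "summable (\<lambda>k. K * (norm (a k) * exp (- (\<sigma> / 2) * norm (b k))))" using assms by (intro summable_mult summ) simp
  then show ?thesis
    by (rule summable_comparison_test'[of _ 0]) (use * in \<open>simp add: mult_ac\<close>)
qed

definition H :: "nat \<Rightarrow> complex \<Rightarrow> complex" where
  "H n s = (\<Sum>k. a k * b k ^ n * exp (b k * s))"

lemma H_deriv:
  assumes "Re s < 0"
  shows "(\<lambda>k. a k * b k ^ n * exp (b k * s)) sums H n s" "(H n has_field_derivative H (Suc n) s) (at s)"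
proof -
  have loc: "\<exists>d h. 0 < d \<and> summable h \<and> (\<forall>\<^sub>F k in sequentially. \<forall>y\<in>ball x d \<inter> {s. Re s < 0}. norm (a k * b k ^ n * exp (b k * y)) \<le> h k)"
    if "x \<in> {s. Re s < 0}" for x n
  proof -
    define d where "d = - Re x / 2"
    have d: "0 < d" using that by (simp add: d_def)
    define h where "h = (\<lambda>k. exp (B * (norm x + d)) * (norm (a k) * norm (b k) ^ n * exp (- d * norm (b k))))"
    have hs: "summable h" unfolding h_def by (intro summable_mult summable_derivs d)
    have hb: "norm (a k * b k ^ n * exp (b k * y)) \<le> h k" if y: "y \<in> ball x d" for k y
    proof -
      have "norm (y - x) < d" using y by (simp add: dist_norm norm_minus_commute)
      moreover from this have "\<bar>Re (y - x)\<bar> < d" using abs_Re_le_cmod[of "y - x"] by linarith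
      ultimately have y: "Re y \<le> - d" "norm y \<le> norm x + d"
        using norm_triangle_ineq2[of y x] by (auto simp: d_def)
      have "Re (b k * y) \<le> norm (b k) * Re y + B * norm y" by (rule Re_b)
      also have "\<dots> \<le> norm (b k) * (- d) + B * (norm x + d)" using y B_nonneg by (intro add_mono mult_left_mono) auto
      finally have "exp (Re (b k * y)) \<le> exp (B * (norm x + d)) * exp (- d * norm (b k))"
        by (simp add: mult.commute flip: exp_add)
      then have "(norm (a k) * norm (b k) ^ n) * exp (Re (b k * y)) \<le> (norm (a k) * norm (b k) ^ n) * (exp (B * (norm x + d)) * exp (- d * norm (b k)))"
        by (intro mult_left_mono) auto
      then show ?thesis by (simp add: h_def norm_mult norm_power mult_ac)
    qed
    show ?thesis
      by (intro exI[of _ d] exI[of _ h] conjI d hs always_eventually allI ballI) (use hb in auto)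
  qed
  have hfd: "((\<lambda>s. a k * b k ^ n * exp (b k * s)) has_field_derivative a k * b k ^ Suc n * exp (b k * x)) (at x)" for k n x
    by (auto intro!: derivative_eq_intros)
  have op: "open {s. Re s < 0}" by (simp add: open_halfspace_Re_lt)
  from series_and_derivative_comparison_local[OF op hfd loc]
  obtain g g' where g: "\<And>x. x \<in> {s. Re s < 0} \<Longrightarrow> (\<lambda>k. a k * b k ^ n * exp (b k * x)) sums g x"
    "\<And>x. x \<in> {s. Re s < 0} \<Longrightarrow> (\<lambda>k. a k * b k ^ Suc n * exp (b k * x)) sums g' x"
    "\<And>x. x \<in> {s. Re s < 0} \<Longrightarrow> (g has_field_derivative g' x) (at x)"
    by blast
  have gH: "g x = H n x" if "x \<in> {s. Re s < 0}" for x using g(1)[OF that] by (simp add: H_def sums_iff)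
  have gH': "g' x = H (Suc n) x" if "x \<in> {s. Re s < 0}" for x using g(2)[OF that] by (simp add: H_def sums_iff)
  have s: "s \<in> {s. Re s < 0}" using assms by simp
  show "(\<lambda>k. a k * b k ^ n * exp (b k * s)) sums H n s" using g(1)[OF s] gH[OF s] by simp
  show "(H n has_field_derivative H (Suc n) s) (at s)"
    using has_field_derivative_transform_within_open[OF g(3)[OF s] op s, of "H n"] gH gH'[OF s] by simp
qed

lemma H_higher_deriv: "Re s < 0 \<Longrightarrow> (deriv ^^ n) (H 0) s = H n s"
proof (induction n arbitrary: s)
  case (Suc n)
  have "(deriv ^^ Suc n) (H 0) s = deriv ((deriv ^^ n) (H 0)) s" by simp
  also have "\<dots> = deriv (H n) s"
    by (rule deriv_cong_ev[OF eventually_mono[OF eventually_nhds_in_open[of "{s. Re s < 0}"]]])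
       (use Suc in \<open>auto simp: open_halfspace_Re_lt\<close>)
  also have "\<dots> = H (Suc n) s" by (rule DERIV_imp_deriv[OF H_deriv(2)[OF Suc.prems]])
  finally show ?case .
qed simp

lemma H_holomorphic: "H n holomorphic_on {s. Re s < 0}"
  using H_deriv(2) by (auto simp: holomorphic_on_open open_halfspace_Re_lt)

text \<open>
  The \<open>n\<close>-th Taylor coefficient at \<open>-1\<close>, with \<open>n\<close> close to the frequency of index \<open>J\<close>, isolates
  \<open>a J\<close>; if the sum continues across 0 then its Taylor series at \<open>-1\<close> has radius greater than 1.
\<close>

lemma deriv_bound:
  assumes "0 < \<rho>" and hol: "g holomorphic_on ball 0 \<rho>"
    and agree: "\<And>s. s \<in> ball 0 \<rho> \<Longrightarrow> Re s < 0 \<Longrightarrow> g s = H 0 s"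
  obtains K R where "1 < R" "0 < K" "\<And>n. norm (H n (- 1)) \<le> fact n * K / R ^ n"
proof -
  define f where "f = (\<lambda>s. if Re s < 0 then H 0 s else g s)"
  have "f holomorphic_on {s. Re s < 0}"
    by (rule holomorphic_transform[OF H_holomorphic[of 0]]) (simp add: f_def)
  moreover have "f holomorphic_on ball 0 \<rho>"
    by (rule holomorphic_transform[OF hol]) (use agree in \<open>auto simp: f_def\<close>)
  ultimately have f: "f holomorphic_on ({s. Re s < 0} \<union> ball 0 \<rho>)"
    by (intro holomorphic_on_Un) (auto simp: open_halfspace_Re_lt)
  \<comment> \<open>A point of this disc about -1 with Re s nonnegative satisfies |s|^2 \<le> R^2 -
    1 = \<rho>^2 / 2, so it lies in the disc on which \<open>g\<close> is given.\<close>
  define R where "R = sqrt (1 + \<rho>\<^sup>2 / 2)"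
  have R: "1 < R" "R\<^sup>2 = 1 + \<rho>\<^sup>2 / 2" using assms(1) by (auto simp: R_def)
  have sub: "cball (- 1) R \<subseteq> {s. Re s < 0} \<union> ball 0 \<rho>"
  proof
    fix s :: complex assume "s \<in> cball (- 1) R"
    then have "norm (s + 1) \<le> R" by (simp add: dist_norm norm_minus_commute)
    then have "(norm (s + 1))\<^sup>2 \<le> R\<^sup>2" by (intro power_mono) auto
    then have *: "(Re s + 1)\<^sup>2 + (Im s)\<^sup>2 \<le> 1 + \<rho>\<^sup>2 / 2" unfolding R(2) by (simp add: cmod_power2)
    show "s \<in> {s. Re s < 0} \<union> ball 0 \<rho>"
    proof (cases "Re s < 0")
      case False
      have "(norm s)\<^sup>2 = (Re s)\<^sup>2 + (Im s)\<^sup>2" by (rule cmod_power2)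
      also have "\<dots> \<le> \<rho>\<^sup>2 / 2" using * False by (simp add: power2_eq_square algebra_simps)
      also have "\<dots> < \<rho>\<^sup>2" using assms(1) by simp
      finally have "norm s < \<rho>" using assms(1) by (simp add: power_less_imp_less_base)
      then show ?thesis by simp
    qed simp
  qed
  have fR: "f holomorphic_on cball (- 1) R" using f sub by (rule holomorphic_on_subset)
  have cont: "continuous_on (cball (- 1) R) f" by (rule holomorphic_on_imp_continuous_on[OF fR])
  then have "bounded (f ` cball (- 1) R)" by (intro compact_imp_bounded compact_continuous_image) auto
  then obtain K where K: "0 < K" "\<And>s. s \<in> cball (- 1) R \<Longrightarrow> norm (f s) \<le> K"
    unfolding bounded_pos by auto
  have "norm (H n (- 1)) \<le> fact n * K / R ^ n" for n
  proof -
    have "norm ((deriv ^^ n) f (- 1)) \<le> fact n * K / R ^ n"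
    proof (rule Cauchy_inequality)
      show "f holomorphic_on ball (- 1) R" using fR ball_subset_cball by (rule holomorphic_on_subset)
    qed (use cont R K in \<open>auto simp: dist_norm\<close>)
    moreover have "(deriv ^^ n) f (- 1) = (deriv ^^ n) (H 0) (- 1)"
      by (rule higher_deriv_cong_ev[OF eventually_mono[OF eventually_nhds_in_open[of "{s. Re s < 0}"]]])
         (auto simp: open_halfspace_Re_lt f_def)
    ultimately show ?thesis using H_higher_deriv[of "- 1" n] by simp
  qed
  then show ?thesis using that R(1) K(1) by blast
qed

text \<open>A gap theorem of Hadamard type. In the n-th derivative at -1 every other term is below
  the scale n^n exp (-n) of the J-th by exp (- c (n + |b_i|)), thanks to \<open>sep\<close>. The
  derivative itself is geometrically below that scale, hence so is \<open>a J\<close>.\<close>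

theorem gap:
  assumes "0 < \<rho>" and hol: "g holomorphic_on ball 0 \<rho>"
    and agree: "\<And>s. s \<in> ball 0 \<rho> \<Longrightarrow> Re s < 0 \<Longrightarrow> g s = H 0 s"
    and \<eta>: "0 < \<eta>"
    and sep: "\<And>i k. a i \<noteq> 0 \<Longrightarrow> a k \<noteq> 0 \<Longrightarrow> i \<noteq> k \<Longrightarrow> \<eta> * norm (b k) \<le> \<bar>norm (b i) - norm (b k)\<bar>"
  obtains C c where "0 < c" "0 < C" "\<And>k. norm (a k) \<le> C * exp (- c * norm (b k))"
proof -
  obtain K R where R: "1 < R" "0 < K" "\<And>n. norm (H n (- 1)) \<le> fact n * K / R ^ n"
    using deriv_bound[OF assms(1-3)] by blast
  \<comment> \<open>\<open>mult_exp_le_off_one\<close> is applied with \<eta> / 2: passing from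
    |b_J| to the integer below it may cost half of the separation.\<close>
  define c where "c = (\<eta> / 2 / (2 + \<eta> / 2))\<^sup>2 / 2"
  have c: "0 < c" using \<eta> by (simp add: c_def)
  define A where "A = (\<Sum>k. norm (a k) * exp (- c * norm (b k)))"
  have A: "0 \<le> A" unfolding A_def by (intro suminf_nonneg summ c) auto
  \<comment> \<open>At most half of ln R is kept; what remains absorbs the factor n of the Stirling
    bound.\<close>
  define t where "t = min c (ln R / 2)"
  have t: "0 < t" "t \<le> c" "2 * t \<le> ln R" using c R(1) by (auto simp: t_def)
  have off: "norm (b i) ^ n * exp (- norm (b i)) \<le> (real n ^ n * exp (- real n)) * (exp (- c * real n) * exp (- c * norm (b i)))"
    if J: "a J \<noteq> 0" "a i \<noteq> 0" "i \<noteq> J" and n: "real n \<le> norm (b J)" "norm (b J) < real n + 1" "2 / \<eta> \<le> real n" "1 \<le> n" for i J n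
  proof -
    define u where "u = norm (b i) / real n"
    have n0: "0 < real n" using n by simp
    have "2 \<le> \<eta> * real n" using n(3) \<eta> by (simp add: field_simps)
    then have "\<eta> * real n \<le> \<bar>norm (b i) - norm (b J)\<bar>" "2 \<le> \<eta> * real n"
      using sep[OF J(2,1,3)] mult_left_mono[OF n(1), of \<eta>] \<eta> by linarith+
    then have "\<eta> / 2 * real n \<le> \<bar>norm (b i) - real n\<bar>" using n(1,2) by linarith
    also have "norm (b i) - real n = (u - 1) * real n" using n0 by (simp add: u_def field_simps)
    finally have "\<eta> / 2 \<le> \<bar>u - 1\<bar>" using n0 by (simp add: abs_mult)
    from mult_exp_le_off_one[OF _ _ this] \<eta> have "u * exp (1 - u) \<le> exp (- c * (1 + u))" by (simp add: u_def c_def)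
    then have "(u * exp (1 - u)) ^ n \<le> exp (- c * (1 + u)) ^ n" by (intro power_mono) (auto simp: u_def)
    moreover have "exp (- c * (1 + u)) ^ n = exp (- c * real n) * exp (- c * norm (b i))"
    proof -
      have "real n * (- c * (1 + u)) = - c * real n + - c * norm (b i)" using n0 by (simp add: u_def field_simps)
      then show ?thesis by (simp only: exp_of_nat_mult[symmetric] exp_add[symmetric])
    qed
    moreover have "norm (b i) ^ n * exp (- norm (b i)) = (real n ^ n * exp (- real n)) * (u * exp (1 - u)) ^ n"
    proof -
      have "exp (1 - u) ^ n = exp (real n) * exp (- norm (b i))"
      proof -
        have "real n * (1 - u) = real n + - norm (b i)" using n0 by (simp add: u_def field_simps)
        then show ?thesis by (simp only: exp_of_nat_mult[symmetric] exp_add[symmetric])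
      qed
      then show ?thesis using n0 by (simp add: power_mult_distrib u_def power_divide exp_minus)
    qed
    ultimately show ?thesis by (simp add: mult_left_mono)
  qed
  have large: "norm (a J) \<le> exp (1 + B) * (exp 1 * K / t + exp B * A) * exp (- t * real n)"
    if J: "a J \<noteq> 0" and n: "real n \<le> norm (b J)" "norm (b J) < real n + 1" "2 / \<eta> \<le> real n" "1 \<le> n" for J n
  proof -
    define W where "W = real n ^ n * exp (- real n)"
    have W: "0 < W" using n by (simp add: W_def)
    define \<phi> where "\<phi> = (\<lambda>k. a k * b k ^ n * exp (b k * (- 1)))"
    have s: "\<phi> sums H n (- 1)" unfolding \<phi>_def by (rule H_deriv) simp
    have up: "norm (\<phi> k) \<le> norm (a k) * norm (b k) ^ n * (exp B * exp (- norm (b k)))" for k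
      using Re_b(1)[of k "- 1"] unfolding \<phi>_def norm_mult norm_power norm_exp_eq_Re
      by (intro mult_left_mono) (auto simp flip: exp_add)
    have sn: "summable (\<lambda>k. norm (\<phi> k))"
      by (rule summable_comparison_test'[OF summable_mult[OF summable_derivs[of 1 n], of "exp B"], of 0])
         (use up in \<open>simp_all add: mult_ac\<close>)
    \<comment> \<open>The loss exp (-1) comes from |b_J| < n + 1, the loss exp (-B) from the
      deviation of b_J from |b_J|.\<close>
    have low: "norm (a J) * (W * exp (- 1) * exp (- B)) \<le> norm (\<phi> J)"
    proof -
      have "real n ^ n \<le> norm (b J) ^ n" using n by (intro power_mono) auto
      moreover have "exp (- real n) * exp (- 1) * exp (- B) \<le> exp (Re (b J * (- 1)))"
        using Re_b(2)[of J "- 1"] n(2) by (simp flip: exp_add)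
      ultimately have "norm (a J) * (real n ^ n * (exp (- real n) * exp (- 1) * exp (- B))) \<le> norm (a J) * (norm (b J) ^ n * exp (Re (b J * (- 1))))"
        by (intro mult_left_mono mult_mono) auto
      then show ?thesis by (simp add: W_def \<phi>_def norm_mult norm_power mult_ac)
    qed
    have other: "norm (if k = J then 0 else \<phi> k) \<le> exp B * W * exp (- c * real n) * (norm (a k) * exp (- c * norm (b k)))" for k
    proof (cases "k = J \<or> a k = 0")
      case True
      then show ?thesis using W by (auto simp: \<phi>_def)
    next
      case False
      have "norm (\<phi> k) \<le> norm (a k) * exp B * (norm (b k) ^ n * exp (- norm (b k)))" using up[of k] by (simp add: mult_ac)
      also have "\<dots> \<le> norm (a k) * exp B * (W * (exp (- c * real n) * exp (- c * norm (b k))))"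
        unfolding W_def using off[OF J _ _ n, of k] False by (intro mult_left_mono) auto
      finally show ?thesis using False by (simp add: mult_ac)
    qed
    have sums': "(\<lambda>k. if k = J then 0 else \<phi> k) sums (H n (- 1) - \<phi> J)"
    proof -
      have "(\<lambda>k. \<phi> k - (if k = J then \<phi> J else 0)) sums (H n (- 1) - \<phi> J)"
        by (intro sums_diff s sums_single)
      also have "(\<lambda>k. \<phi> k - (if k = J then \<phi> J else 0)) = (\<lambda>k. if k = J then 0 else \<phi> k)" by auto
      finally show ?thesis .
    qed
    have sm: "summable (\<lambda>k. exp B * W * exp (- c * real n) * (norm (a k) * exp (- c * norm (b k))))"
      by (intro summable_mult summ c)
    have "norm (H n (- 1) - \<phi> J) \<le> (\<Sum>k. exp B * W * exp (- c * real n) * (norm (a k) * exp (- c * norm (b k))))"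
      unfolding sums_unique[OF sums'] by (rule norm_suminf_le[OF other sm])
    also have "\<dots> = exp B * W * exp (- c * real n) * A" unfolding A_def by (intro suminf_mult summ c)
    finally have rest: "norm (H n (- 1) - \<phi> J) \<le> exp B * W * exp (- c * real n) * A" .
    have "fact n * K / R ^ n \<le> W * (exp 1 * K / t) * exp (- t * real n)"
    proof -
      have "1 / R ^ n = exp (- (real n * ln R))" using R(1) by (simp add: exp_minus exp_of_nat_mult divide_inverse)
      also have "\<dots> \<le> exp (- (2 * t) * real n)" using t(3) mult_left_mono[of "2 * t" "ln R" "real n"] by (simp add: mult_ac)
      finally have "K * (1 / R ^ n) \<le> K * exp (- (2 * t) * real n)" using R(2) by (intro mult_left_mono) auto
      then have KR: "K / R ^ n \<le> K * exp (- (2 * t) * real n)" by simp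
      have "fact n * (K / R ^ n) \<le> (exp 1 * n * W) * (K / R ^ n)"
        using fact_le_exp_power[OF n(4)] R unfolding W_def by (intro mult_right_mono) auto
      also have "\<dots> \<le> exp 1 * n * W * (K * exp (- (2 * t) * real n))" using KR W by (intro mult_left_mono) auto
      also have "exp (- (2 * t) * real n) = exp (- t * real n) * exp (- t * real n)" by (simp flip: exp_add)
      also have "exp 1 * n * W * (K * (exp (- t * real n) * exp (- t * real n))) = (t * n * exp (- t * real n)) * (W * (exp 1 * K / t) * exp (- t * real n))"
        using t(1) by (simp add: field_simps)
      also have "\<dots> \<le> 1 * (W * (exp 1 * K / t) * exp (- t * real n))"
      proof (rule mult_right_mono)
        have "t * real n \<le> exp (t * real n)" using exp_ge_add_one_self[of "t * real n"] by linarith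
        then show "t * real n * exp (- t * real n) \<le> 1" by (simp add: exp_minus field_simps)
      qed (use W R t in auto)
      finally show ?thesis by simp
    qed
    moreover have "norm (\<phi> J) \<le> norm (H n (- 1)) + norm (H n (- 1) - \<phi> J)"
      using norm_triangle_ineq4[of "H n (- 1)" "H n (- 1) - \<phi> J"] by simp
    ultimately have "norm (a J) * (W * exp (- 1) * exp (- B)) \<le> W * (exp 1 * K / t) * exp (- t * real n) + exp B * W * exp (- c * real n) * A"
      using low rest R(3)[of n] by linarith
    also have "exp B * W * exp (- c * real n) * A \<le> exp B * W * exp (- t * real n) * A"
      using A W t(2) by (intro mult_right_mono mult_left_mono) (auto intro: mult_right_mono)
    finally have "norm (a J) * (W * exp (- 1) * exp (- B)) \<le> W * (exp 1 * K / t) * exp (- t * real n) + exp B * W * exp (- t * real n) * A"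
      by simp
    moreover have "exp (- (1 + B)) = exp (- 1) * exp (- B)" by (simp flip: exp_add)
    then have "norm (a J) * exp (- (1 + B)) * W = norm (a J) * (W * exp (- 1) * exp (- B))" by (simp only: mult_ac)
    moreover have "W * (exp 1 * K / t) * exp (- t * real n) + exp B * W * exp (- t * real n) * A
       = ((exp 1 * K / t + exp B * A) * exp (- t * real n)) * W" by (simp add: algebra_simps)
    ultimately have "norm (a J) * exp (- (1 + B)) * W \<le> ((exp 1 * K / t + exp B * A) * exp (- t * real n)) * W"
      by (simp only:)
    then have "norm (a J) * exp (- (1 + B)) \<le> (exp 1 * K / t + exp B * A) * exp (- t * real n)"
      using W by (simp add: mult_le_cancel_right)
    then have "exp (1 + B) * (norm (a J) * exp (- (1 + B))) \<le> exp (1 + B) * ((exp 1 * K / t + exp B * A) * exp (- t * real n))"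
      by (intro mult_left_mono) auto
    moreover have "exp (1 + B) * (norm (a J) * exp (- (1 + B))) = norm (a J)"
      using exp_minus_inverse[of "1 + B"] by (metis mult.left_commute mult.right_neutral)
    ultimately show ?thesis by (simp only: mult.assoc)
  qed
  define C1 where "C1 = exp (1 + B) * (exp 1 * K / t + exp B * A) * exp t"
  define A1 where "A1 = (\<Sum>k. norm (a k) * exp (- 1 * norm (b k)))"
  \<comment> \<open>Beyond X the integer part n of |b_J| is at least 2 / \<eta> and at least 1.
    Below X the crude bound A1 exp |b_J| suffices, with the missing decay put into the
    constant.\<close>
  define X where "X = 2 / \<eta> + 2"
  define C where "C = C1 + A1 * exp X * exp (t * X) + 1"
  have C1: "0 \<le> C1" using A R t B_nonneg by (auto simp: C1_def)
  have A1: "0 \<le> A1" unfolding A1_def by (intro suminf_nonneg summ) auto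
  have "norm (a J) \<le> C * exp (- t * norm (b J))" for J
  proof (cases "a J = 0")
    case False
    show ?thesis
    proof (cases "norm (b J) \<ge> X")
      case True
      define n where "n = nat \<lfloor>norm (b J)\<rfloor>"
      have n: "real n \<le> norm (b J)" "norm (b J) < real n + 1" unfolding n_def by (auto simp: of_nat_nat)
      have "0 < 2 / \<eta>" using \<eta> by simp
      then have n': "2 / \<eta> \<le> real n" "1 \<le> n" using n(2) True unfolding X_def by linarith+
      have "norm (a J) \<le> exp (1 + B) * (exp 1 * K / t + exp B * A) * exp (- t * real n)"
        by (rule large[OF False n n'])
      also have "\<dots> \<le> exp (1 + B) * (exp 1 * K / t + exp B * A) * (exp t * exp (- t * norm (b J)))"
        using A R t B_nonneg n mult_left_mono[of "norm (b J)" "real n + 1" t]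
        by (intro mult_left_mono) (auto simp: algebra_simps simp flip: exp_add)
      also have "\<dots> = C1 * exp (- t * norm (b J))" by (simp add: C1_def)
      also have "\<dots> \<le> C * exp (- t * norm (b J))" using A1 by (intro mult_right_mono) (auto simp: C_def)
      finally show ?thesis .
    next
      case False
      have "norm (a J) * exp (- 1 * norm (b J)) \<le> A1"
        unfolding A1_def using sum_le_suminf[OF summ[of 1], of "{J}"] by simp
      then have "norm (a J) \<le> A1 * exp (norm (b J))" by (simp add: exp_minus field_simps)
      also have "\<dots> \<le> A1 * (exp X * exp (t * X) * exp (- t * norm (b J)))"
      proof (rule mult_left_mono[OF _ A1])
        have "t * norm (b J) \<le> t * X" using False t by (intro mult_left_mono) auto
        then have "norm (b J) \<le> X + t * X + - t * norm (b J)" using False by linarith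
        then have "exp (norm (b J)) \<le> exp (X + t * X + - t * norm (b J))" by simp
        then show "exp (norm (b J)) \<le> exp X * exp (t * X) * exp (- t * norm (b J))" by (simp only: exp_add)
      qed
      also have "\<dots> = A1 * exp X * exp (t * X) * exp (- t * norm (b J))" by simp
      also have "\<dots> \<le> C * exp (- t * norm (b J))" using C1 by (intro mult_right_mono) (auto simp: C_def)
      finally show ?thesis .
    qed
  next
    case True
    then show ?thesis using C1 A1 by (simp add: C_def add_nonneg_nonneg)
  qed
  moreover have "0 < C" using C1 A1 by (simp add: C_def add_nonneg_pos)
  ultimately show ?thesis using that t(1) by blast
qed

end

section \<open>Growth and holomorphy of the continuation\<close>

lemma norm_cosh_le: "norm (cosh y) \<le> exp \<bar>Re y\<bar>" for y :: complex
proof -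
  have "norm (cosh y) = norm (exp y + exp (- y)) / 2" by (simp add: cosh_field_def norm_divide)
  also have "\<dots> \<le> (norm (exp y) + norm (exp (- y))) / 2" by (intro divide_right_mono norm_triangle_ineq) auto
  also have "norm (exp y) \<le> exp \<bar>Re y\<bar>" by simp
  also have "norm (exp (- y)) \<le> exp \<bar>Re y\<bar>" by simp
  finally show ?thesis by simp
qed

lemma norm_sinh_le: "norm (sinh y) \<le> exp \<bar>Re y\<bar>" for y :: complex
proof -
  have "norm (sinh y) = norm (exp y - exp (- y)) / 2" by (simp add: sinh_field_def norm_divide)
  also have "\<dots> \<le> (norm (exp y) + norm (exp (- y))) / 2" by (intro divide_right_mono norm_triangle_ineq4) auto
  also have "norm (exp y) \<le> exp \<bar>Re y\<bar>" by simp
  also have "norm (exp (- y)) \<le> exp \<bar>Re y\<bar>" by simp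
  finally show ?thesis by simp
qed

text \<open>Determines |Re y| from y^2 alone, so that no branch of a square root has to be
  tracked.\<close>

lemma Re_square: "2 * (Re y)\<^sup>2 = norm (y\<^sup>2) + Re (y\<^sup>2)"
  by (simp add: norm_power cmod_power2) (simp add: power2_eq_square)

lemma cis_minus_one_approx: "norm (cis t - 1 - \<i> * of_real t) \<le> t\<^sup>2"
proof -
  have "norm (exp (\<i> * of_real t) - (\<Sum>k\<le>1. (\<i> * of_real t) ^ k / fact k))
      \<le> exp \<bar>Re (\<i> * of_real t)\<bar> * norm (\<i> * of_real t) ^ Suc 1 / fact 1"
    by (rule Taylor_exp)
  then show ?thesis by (simp add: cis_conv_exp norm_mult power2_eq_square diff_diff_eq)
qed

text \<open>1 / x is the principal part at 0, and d keeps x away from the poles at 1 and -1. For |x|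
  at most 1/2 the Taylor bound gives 4 pi; elsewhere the two terms are bounded separately.\<close>

lemma inverse_cis_minus_one:
  fixes x d :: real
  assumes "x \<noteq> 0" "\<bar>x\<bar> \<le> 1 - d" "0 < d"
  shows "norm (2 * of_real pi * \<i> / (cis (2 * pi * x) - 1) - 1 / of_real x) \<le> 4 * pi + (2 / d + 2)"
proof -
  define v where "v = cis (2 * pi * x) - 1"
  have nv: "norm v = 2 * \<bar>sin (pi * x)\<bar>" using norm_cis_diff[of "2 * pi * x" 0] by (simp add: v_def)
  show ?thesis
  proof (cases "\<bar>x\<bar> \<le> 1/2")
    case True
    then have "\<bar>pi * x\<bar> / 2 \<le> \<bar>sin (pi * x)\<bar>" by (intro abs_sin_ge) (simp add: abs_mult)
    then have v: "pi * \<bar>x\<bar> \<le> norm v" by (simp add: nv abs_mult)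
    then have "0 < norm v" using assms(1) by (intro order_less_le_trans[OF _ v]) simp
    then have v0: "v \<noteq> 0" by simp
    have "2 * of_real pi * \<i> / v - 1 / of_real x = - (v - \<i> * of_real (2 * pi * x)) / (of_real x * v)"
      using v0 assms(1) by (simp add: field_simps)
    then have "norm (2 * of_real pi * \<i> / v - 1 / of_real x) = norm (v - \<i> * of_real (2 * pi * x)) / (\<bar>x\<bar> * norm v)"
      by (simp only: norm_divide norm_minus_cancel norm_mult norm_of_real)
    also have "\<dots> \<le> (2 * pi * x)\<^sup>2 / (\<bar>x\<bar> * (pi * \<bar>x\<bar>))"
      using cis_minus_one_approx[of "2 * pi * x"] v assms(1) unfolding v_def[symmetric]
      by (intro frac_le mult_left_mono) auto
    also have "\<dots> = 4 * pi" using assms(1) by (simp add: power2_eq_square field_simps)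
    finally have "norm (2 * of_real pi * \<i> / v - 1 / of_real x) \<le> 4 * pi" .
    moreover have "0 < 2 / d" using assms(3) by simp
    ultimately show ?thesis unfolding v_def[symmetric] by linarith
  next
    case False
    have "sin (pi * \<bar>x\<bar>) = sin (pi - pi * \<bar>x\<bar>)" by (rule sin_pi_minus[symmetric])
    then have "sin (pi * \<bar>x\<bar>) = sin (pi * (1 - \<bar>x\<bar>))" by (simp add: right_diff_distrib)
    moreover have "\<bar>pi * (1 - \<bar>x\<bar>)\<bar> / 2 \<le> \<bar>sin (pi * (1 - \<bar>x\<bar>))\<bar>"
    proof (rule abs_sin_ge)
      have "pi * \<bar>1 - \<bar>x\<bar>\<bar> \<le> pi * (1/2)" using False assms by (intro mult_left_mono) auto
      then show "\<bar>pi * (1 - \<bar>x\<bar>)\<bar> \<le> pi / 2" by (simp add: abs_mult)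
    qed
    moreover have "\<bar>sin (pi * x)\<bar> = \<bar>sin (pi * \<bar>x\<bar>)\<bar>" by (cases "x \<ge> 0") (auto simp: abs_if)
    moreover have "pi * d \<le> \<bar>pi * (1 - \<bar>x\<bar>)\<bar>" using assms by (simp add: abs_mult)
    ultimately have v: "pi * d \<le> norm v" unfolding nv by linarith
    have "norm (2 * of_real pi * \<i> / v - 1 / of_real x) \<le> norm (2 * of_real pi * \<i> / v) + norm (1 / of_real x :: complex)"
      by (rule norm_triangle_ineq4)
    also have "norm (2 * of_real pi * \<i> / v) = 2 * pi / norm v" by (simp add: norm_divide norm_mult)
    also have "2 * pi / norm v \<le> 2 * pi / (pi * d)" using v assms by (intro frac_le) auto
    also have "2 * pi / (pi * d) = 2 / d" by simp
    also have "norm (1 / of_real x :: complex) \<le> 2" using False by (simp add: norm_divide field_simps)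
    finally have "norm (2 * of_real pi * \<i> / v - 1 / of_real x) \<le> 2 / d + 2" by simp
    then show ?thesis using pi_gt_zero unfolding v_def by linarith
  qed
qed

section \<open>The continued series, restricted to sets of indices\<close>

definition gam :: "complex \<Rightarrow> nat \<Rightarrow> nat \<Rightarrow> complex" where
  "gam lam k j = 1 / csqrt (rt k j - lam)"

lemma gam_square: "(gam lam k j)\<^sup>2 = 1 / (rt k j - lam)"
  by (simp add: gam_def power_divide)

text \<open>Summation over n turns the powers 1 / (L - lam)^(n + 1) into gam^2 cosh (\<xi> gam).
  This is even in \<open>gam\<close>, so the branch chosen there is harmless. The set
  \<open>T\<close> serves to split off the terms that diverge beyond a side.\<close>

definition coefG :: "complex \<Rightarrow> (nat \<times> nat) set \<Rightarrow> nat \<Rightarrow> complex \<Rightarrow> complex" where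
  "coefG lam T k \<xi> = - ((1 / of_nat k) *
     (\<Sum>j<k. if (k, j) \<in> T then rt k j * (gam lam k j)\<^sup>2 * cosh (\<xi> * gam lam k j) else 0))"

definition coefG' :: "complex \<Rightarrow> (nat \<times> nat) set \<Rightarrow> nat \<Rightarrow> complex \<Rightarrow> complex" where
  "coefG' lam T k \<xi> = - ((1 / of_nat k) *
     (\<Sum>j<k. if (k, j) \<in> T then rt k j * (gam lam k j)\<^sup>2 * (sinh (\<xi> * gam lam k j) * gam lam k j) else 0))"

definition GT :: "complex \<Rightarrow> (nat \<times> nat) set \<Rightarrow> complex \<times> complex \<Rightarrow> complex" where
  "GT lam T p = (\<Sum>m. coefG lam T (Suc m) (fst p) * snd p ^ Suc m)"

lemma coefG_deriv: "(coefG lam T k has_field_derivative coefG' lam T k \<xi>) (at \<xi>)"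
  unfolding coefG_def[abs_def] coefG'_def
proof (intro DERIV_minus DERIV_cmult DERIV_sum)
  fix j
  show "((\<lambda>\<xi>. if (k, j) \<in> T then rt k j * (gam lam k j)\<^sup>2 * cosh (\<xi> * gam lam k j) else 0) has_field_derivative
     (if (k, j) \<in> T then rt k j * (gam lam k j)\<^sup>2 * (sinh (\<xi> * gam lam k j) * gam lam k j) else 0)) (at \<xi>)"
    by (cases "(k, j) \<in> T") (auto intro!: derivative_eq_intros)
qed

text \<open>
  In the coordinate \<open>\<omega> = \<xi> / e\<close> the summand with index \<open>(k, j)\<close> is \<open>cosh (\<omega> * bet k j)\<close>, where
  \<open>(bet k j)\<^sup>2\<close> is close to \<open>1 / X k j\<close>. Two choices of \<open>e\<close> for each sign \<open>s\<close> turn any of the four sides of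
  the rectangle into the side on the right.
\<close>

locale rotated =
  fixes c \<alpha> :: real and lam e :: complex and s :: int
  assumes bad: "badly_approx c \<alpha>" and \<alpha>: "0 < \<alpha>" "\<alpha> < 1" and lam: "lam = cis (2 * pi * \<alpha>)"
    and s: "\<bar>s\<bar> = 1" and e: "e\<^sup>2 = 2 * of_real pi * \<i> * lam * of_int s"
begin

definition X :: "nat \<Rightarrow> nat \<Rightarrow> real" where
  "X k j = of_int s * (real j / real k - \<alpha>)"

definition bet :: "nat \<Rightarrow> nat \<Rightarrow> complex" where
  "bet k j = e * gam lam k j"

lemma c: "0 < c" using badly_approxD(1)[OF bad] .

lemma s_cases: "(of_int s :: real) = 1 \<or> (of_int s :: real) = -1" "(of_int s :: complex) = 1 \<or> (of_int s :: complex) = -1"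
  using s by (auto simp: abs_if split: if_splits)

lemma e0: "e \<noteq> 0"
  using e s lam by (auto simp: power2_eq_square)

lemma X_lower: "1 \<le> k \<Longrightarrow> c \<le> (real k)\<^sup>2 * \<bar>X k j\<bar>"
proof -
  assume k: "1 \<le> k"
  have "real k * \<alpha> - of_int (int j) = - (real k * (real j / real k - \<alpha>))" using k by (simp add: field_simps)
  then have "\<bar>real k * \<alpha> - of_int (int j)\<bar> = real k * \<bar>real j / real k - \<alpha>\<bar>" by (simp add: abs_mult)
  moreover have "\<bar>X k j\<bar> = \<bar>real j / real k - \<alpha>\<bar>" using s_cases(1) by (auto simp: X_def)
  ultimately have "c / real k \<le> real k * \<bar>X k j\<bar>" using badly_approxD(2)[OF bad k, of "int j"] by simp
  then have "c \<le> real k * \<bar>X k j\<bar> * real k" using k by (simp only: pos_divide_le_eq of_nat_0_less_iff)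
  then show ?thesis by (simp add: power2_eq_square mult_ac)
qed

lemma X_ne_0: "1 \<le> k \<Longrightarrow> X k j \<noteq> 0"
  using X_lower[of k j] c by auto

lemma bet_square: "(bet k j)\<^sup>2 = 2 * of_real pi * \<i> * of_int s / (cis (2 * pi * (real j / real k - \<alpha>)) - 1)"
proof -
  have "rt k j = lam * cis (2 * pi * (real j / real k - \<alpha>))"
    unfolding lam rt_def cis_mult by (rule arg_cong[where f = cis]) (simp add: algebra_simps)
  then have "rt k j - lam = lam * (cis (2 * pi * (real j / real k - \<alpha>)) - 1)" by (simp add: algebra_simps)
  moreover have "lam \<noteq> 0" by (simp add: lam)
  ultimately show ?thesis by (simp add: bet_def power_mult_distrib gam_square e)
qed

lemma bet_square_approx:
  obtains K where "0 < K" "\<And>k j. 1 \<le> k \<Longrightarrow> j < k \<Longrightarrow> norm ((bet k j)\<^sup>2 - of_real (1 / X k j)) \<le> K"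
proof -
  \<comment> \<open>Both j / k and \<alpha> lie in the unit interval, so |x| stays below 1 by the
    distance of \<alpha> from its end points.\<close>
  define d where "d = min \<alpha> (1 - \<alpha>)"
  have d: "0 < d" using \<alpha> by (simp add: d_def)
  have "norm ((bet k j)\<^sup>2 - of_real (1 / X k j)) \<le> 4 * pi + (2 / d + 2)" if k: "1 \<le> k" "j < k" for k j
  proof -
    define x where "x = real j / real k - \<alpha>"
    have Xx: "X k j = of_int s * x" by (simp add: X_def x_def)
    have "real j / real k < 1" "0 \<le> real j / real k" using k by auto
    moreover have "\<bar>y - \<alpha>\<bar> \<le> 1 - d" if "y < 1" "0 \<le> y" for y
      using that \<alpha> by (auto simp: d_def abs_if min_def)
    ultimately have "\<bar>x\<bar> \<le> 1 - d" by (simp only: x_def)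
    moreover have "x \<noteq> 0" using X_ne_0[OF k(1), of j] by (auto simp: Xx)
    ultimately have *: "norm (2 * of_real pi * \<i> / (cis (2 * pi * x) - 1) - 1 / of_real x) \<le> 4 * pi + (2 / d + 2)"
      using inverse_cis_minus_one d by blast
    have "(bet k j)\<^sup>2 - of_real (1 / X k j) = of_int s * (2 * of_real pi * \<i> / (cis (2 * pi * x) - 1) - 1 / of_real x)"
      unfolding bet_square Xx x_def[symmetric] using s_cases by auto
    moreover have "norm (of_int s :: complex) = 1" using s by (metis norm_of_int of_int_1 of_int_abs)
    ultimately have "norm ((bet k j)\<^sup>2 - of_real (1 / X k j)) = norm (2 * of_real pi * \<i> / (cis (2 * pi * x) - 1) - 1 / of_real x)"
      by (simp only: norm_mult mult_1)
    then show ?thesis using * by simp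
  qed
  moreover have "0 < 4 * pi + (2 / d + 2)" using d by (simp add: add_pos_pos)
  ultimately show ?thesis using that by blast
qed

definition D :: real where "D = 1 / sqrt (2 * c)"

lemma D: "0 < D" using c by (simp add: D_def)

lemma norm_gam_le: "1 \<le> k \<Longrightarrow> norm (gam lam k j) \<le> D * real k"
proof (rule power2_le_imp_le)
  assume k: "1 \<le> k"
  have "2 * c / (real k)\<^sup>2 \<le> norm (rt k j - lam)" using rt_gap[OF bad k] by (simp add: lam)
  then have "1 / norm (rt k j - lam) \<le> 1 / (2 * c / (real k)\<^sup>2)" using c k by (intro frac_le) auto
  moreover have "(norm (gam lam k j))\<^sup>2 = 1 / norm (rt k j - lam)"
    by (simp add: gam_square norm_divide flip: norm_power)
  ultimately show "(norm (gam lam k j))\<^sup>2 \<le> (D * real k)\<^sup>2"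
    using c by (simp add: D_def power_mult_distrib power_divide)
qed (use D in simp)

text \<open>\<open>bet k j\<close> is nearly real for X > 0 and nearly imaginary for X < 0, so Re (w
  bet) sees mainly Re w or mainly Im w. The estimate goes through \<open>Re_square\<close>; the
  error of bet^2 enters with its square root.\<close>

lemma Re_bet:
  obtains K where "0 \<le> K"
    "\<And>k j w. 1 \<le> k \<Longrightarrow> j < k \<Longrightarrow> 0 < X k j \<Longrightarrow> \<bar>Re (w * bet k j)\<bar> \<le> \<bar>Re w\<bar> / sqrt (X k j) + K * norm w"
    "\<And>k j w. 1 \<le> k \<Longrightarrow> j < k \<Longrightarrow> X k j < 0 \<Longrightarrow> \<bar>Re (w * bet k j)\<bar> \<le> \<bar>Im w\<bar> / sqrt (- X k j) + K * norm w"
proof -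
  obtain K where K: "0 < K" "\<And>k j. 1 \<le> k \<Longrightarrow> j < k \<Longrightarrow> norm ((bet k j)\<^sup>2 - of_real (1 / X k j)) \<le> K"
    by (rule bet_square_approx) (rule that)
  have sq: "(Re (w * bet k j))\<^sup>2 \<le> ((norm w)\<^sup>2 / \<bar>X k j\<bar> + Re (w\<^sup>2) / X k j) / 2 + K * (norm w)\<^sup>2"
    if "1 \<le> k" "j < k" for k j w
  proof -
    define y where "y = w\<^sup>2 * of_real (1 / X k j)"
    have dy: "norm ((w * bet k j)\<^sup>2 - y) \<le> K * (norm w)\<^sup>2"
    proof -
      have "(w * bet k j)\<^sup>2 - y = w\<^sup>2 * ((bet k j)\<^sup>2 - of_real (1 / X k j))" by (simp add: y_def power_mult_distrib algebra_simps)
      then show ?thesis using mult_left_mono[OF K(2)[OF that], of "(norm w)\<^sup>2"]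
        by (simp only: norm_mult norm_power mult.commute[of K]) simp
    qed
    have lin: "q \<le> (a + b) / 2 + t" if "2 * q = n + u" "n \<le> a + t" "u \<le> b + t" for q a b t n u :: real
      using that by (simp add: field_simps)
    have "2 * (Re (w * bet k j))\<^sup>2 = norm ((w * bet k j)\<^sup>2) + Re ((w * bet k j)\<^sup>2)" by (rule Re_square)
    moreover have "norm ((w * bet k j)\<^sup>2) \<le> norm y + K * (norm w)\<^sup>2" using norm_triangle_ineq2[of "(w * bet k j)\<^sup>2" y] dy by linarith
    moreover have "Re ((w * bet k j)\<^sup>2) \<le> Re y + K * (norm w)\<^sup>2"
      using abs_Re_le_cmod[of "(w * bet k j)\<^sup>2 - y"] dy unfolding minus_complex.sel by linarith
    ultimately have "(Re (w * bet k j))\<^sup>2 \<le> (norm y + Re y) / 2 + K * (norm w)\<^sup>2" by (rule lin)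
    moreover have "norm y = (norm w)\<^sup>2 / \<bar>X k j\<bar>" by (simp add: y_def norm_mult norm_power norm_divide)
    moreover have "Re y = Re (w\<^sup>2) / X k j" by (simp add: y_def)
    ultimately show ?thesis by (simp only:)
  qed
  have root: "\<bar>q\<bar> \<le> p + sqrt K * n" if "q\<^sup>2 \<le> p\<^sup>2 + K * n\<^sup>2" "0 \<le> p" "0 \<le> n" for p q n :: real
  proof (rule power2_le_imp_le)
    have "\<bar>q\<bar>\<^sup>2 \<le> p\<^sup>2 + (sqrt K * n)\<^sup>2" using that K(1) by (simp add: power_mult_distrib)
    also have "\<dots> \<le> (p + sqrt K * n)\<^sup>2" using that K(1) by (simp add: power2_sum)
    finally show "\<bar>q\<bar>\<^sup>2 \<le> (p + sqrt K * n)\<^sup>2" .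
  qed (use that K in auto)
  show ?thesis
  proof (rule that[of "sqrt K"])
    fix k j w assume k: "1 \<le> k" "j < k" "0 < X k j"
    have "((norm w)\<^sup>2 / \<bar>X k j\<bar> + Re (w\<^sup>2) / X k j) / 2 = (\<bar>Re w\<bar> / sqrt (X k j))\<^sup>2"
      using k(3) by (simp add: cmod_power2 power_divide field_simps) (simp add: power2_eq_square algebra_simps)
    then show "\<bar>Re (w * bet k j)\<bar> \<le> \<bar>Re w\<bar> / sqrt (X k j) + sqrt K * norm w"
      using sq[OF k(1,2), of w] k(3) by (intro root) auto
  next
    fix k j w assume k: "1 \<le> k" "j < k" "X k j < 0"
    have "((norm w)\<^sup>2 / \<bar>X k j\<bar> + Re (w\<^sup>2) / X k j) / 2 = (\<bar>Im w\<bar> / sqrt (- X k j))\<^sup>2"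
      using k(3) by (simp add: cmod_power2 power_divide field_simps) (simp add: power2_eq_square algebra_simps)
    then show "\<bar>Re (w * bet k j)\<bar> \<le> \<bar>Im w\<bar> / sqrt (- X k j) + sqrt K * norm w"
      using sq[OF k(1,2), of w] k(3) by (intro root) auto
  qed (use K in auto)
qed

text \<open>For large k, 1 / sqrt |X| is at most k / m1 on one side and k / m2 on the other. Thus
  \<open>m1\<close> and \<open>m2\<close> play the role of the kappas for the index set
  \<open>T\<close>: its series converges in rectangles with sides proportional to them.\<close>

definition sparse_set :: "(nat \<times> nat) set \<Rightarrow> real \<Rightarrow> real \<Rightarrow> bool" where
  "sparse_set T m1 m2 \<longleftrightarrow> 0 < m1 \<and> 0 < m2 \<and> (\<exists>K0. \<forall>k\<ge>K0. \<forall>j<k. (k, j) \<in> T \<longrightarrow>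
     (0 < X k j \<longrightarrow> m1\<^sup>2 \<le> (real k)\<^sup>2 * X k j) \<and> (X k j < 0 \<longrightarrow> m2\<^sup>2 \<le> (real k)\<^sup>2 * (- X k j)))"

text \<open>In the rectangle with half sides m1 L and m2 L the exponents grow at most like k L,
  which z^k beats once |z| < exp (-L).\<close>

lemma growth:
  assumes T: "sparse_set T m1 m2" and L: "0 \<le> L" and W: "0 \<le> W"
  obtains C where "\<And>k j \<xi>. 1 \<le> k \<Longrightarrow> j < k \<Longrightarrow> (k, j) \<in> T \<Longrightarrow> \<bar>Re (\<xi> / e)\<bar> \<le> m1 * L \<Longrightarrow> \<bar>Im (\<xi> / e)\<bar> \<le> m2 * L \<Longrightarrow>
     norm (\<xi> / e) \<le> W \<Longrightarrow> \<bar>Re (\<xi> * gam lam k j)\<bar> \<le> C + real k * L"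
proof -
  obtain K where K: "0 \<le> K"
    "\<And>k j w. 1 \<le> k \<Longrightarrow> j < k \<Longrightarrow> 0 < X k j \<Longrightarrow> \<bar>Re (w * bet k j)\<bar> \<le> \<bar>Re w\<bar> / sqrt (X k j) + K * norm w"
    "\<And>k j w. 1 \<le> k \<Longrightarrow> j < k \<Longrightarrow> X k j < 0 \<Longrightarrow> \<bar>Re (w * bet k j)\<bar> \<le> \<bar>Im w\<bar> / sqrt (- X k j) + K * norm w"
    by (rule Re_bet) (rule that)
  obtain K0 where m: "0 < m1" "0 < m2" and K0: "\<And>k j. K0 \<le> k \<Longrightarrow> j < k \<Longrightarrow> (k, j) \<in> T \<Longrightarrow> 0 < X k j \<Longrightarrow> m1\<^sup>2 \<le> (real k)\<^sup>2 * X k j"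
     "\<And>k j. K0 \<le> k \<Longrightarrow> j < k \<Longrightarrow> (k, j) \<in> T \<Longrightarrow> X k j < 0 \<Longrightarrow> m2\<^sup>2 \<le> (real k)\<^sup>2 * (- X k j)"
    using T unfolding sparse_set_def by blast
  have quot: "p / sqrt x \<le> real k * L" if "0 < x" "0 < m" "m\<^sup>2 \<le> (real k)\<^sup>2 * x" "0 \<le> p" "p \<le> m * L" for p x m k
  proof -
    have "m \<le> real k * sqrt x" using real_sqrt_le_mono[OF that(3)] that by (simp add: real_sqrt_mult)
    then have "m * L \<le> real k * sqrt x * L" using L by (intro mult_right_mono) auto
    then show ?thesis using that by (simp add: divide_le_eq mult_ac)
  qed
  \<comment> \<open>Below \<open>K0\<close> nothing is known about \<open>T\<close>, and the general
    bound D k on \<open>gam\<close> is used.\<close>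
  define C where "C = K * W + norm e * W * D * real K0"
  have C: "K * W \<le> C" "norm e * W * D * real K0 \<le> C" using K(1) W D by (auto simp: C_def)
  show ?thesis
  proof (rule that[of C])
    fix k j \<xi> assume k: "1 \<le> k" "j < k" "(k, j) \<in> T" and re: "\<bar>Re (\<xi> / e)\<bar> \<le> m1 * L" and im: "\<bar>Im (\<xi> / e)\<bar> \<le> m2 * L" and w: "norm (\<xi> / e) \<le> W"
    have eq: "\<xi> * gam lam k j = \<xi> / e * bet k j" using e0 by (simp add: bet_def)
    have KW: "K * norm (\<xi> / e) \<le> K * W" using K(1) w by (rule mult_left_mono[rotated])
    show "\<bar>Re (\<xi> * gam lam k j)\<bar> \<le> C + real k * L"
    proof (cases "K0 \<le> k")
      case True
      show ?thesis
      proof (cases "0 < X k j")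
        case True
        have "\<bar>Re (\<xi> / e)\<bar> / sqrt (X k j) \<le> real k * L"
          by (rule quot[OF True m(1) K0(1)[OF \<open>K0 \<le> k\<close> k(2,3) True] _ re]) simp
        then show ?thesis using K(2)[OF k(1,2) True, of "\<xi> / e"] KW C unfolding eq by linarith
      next
        case False
        then have neg: "X k j < 0" using X_ne_0[OF k(1), of j] by simp
        have "\<bar>Im (\<xi> / e)\<bar> / sqrt (- X k j) \<le> real k * L"
          by (rule quot[OF _ m(2) K0(2)[OF \<open>K0 \<le> k\<close> k(2,3) neg] _ im]) (use neg in simp_all)
        then show ?thesis using K(3)[OF k(1,2) neg, of "\<xi> / e"] KW C unfolding eq by linarith
      qed
    next
      case False
      have "\<bar>Re (\<xi> * gam lam k j)\<bar> \<le> norm (\<xi> / e) * norm e * norm (gam lam k j)"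
        using abs_Re_le_cmod[of "\<xi> * gam lam k j"] e0 by (simp add: norm_mult norm_divide)
      also have "\<dots> \<le> W * norm e * (D * real K0)"
      proof -
        have "D * real k \<le> D * real K0" using D False by (intro mult_left_mono) auto
        then have "norm (gam lam k j) \<le> D * real K0" using norm_gam_le[OF k(1), of j] by linarith
        then show ?thesis using w W by (intro mult_mono) auto
      qed
      also have "\<dots> \<le> C" using C by (simp add: mult_ac)
      finally show ?thesis using L by (simp add: add_increasing2)
    qed
  qed
qed

lemma coefG_bounds:
  assumes T: "sparse_set T m1 m2" and L: "0 \<le> L" and W: "0 \<le> W"
  obtains C where "0 < C" "\<And>k \<xi>. 1 \<le> k \<Longrightarrow> \<bar>Re (\<xi> / e)\<bar> \<le> m1 * L \<Longrightarrow> \<bar>Im (\<xi> / e)\<bar> \<le> m2 * L \<Longrightarrow>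
     norm (\<xi> / e) \<le> W \<Longrightarrow> norm (coefG lam T k \<xi>) \<le> C * (real k ^ 2 * exp (real k * L))"
    "\<And>k \<xi>. 1 \<le> k \<Longrightarrow> \<bar>Re (\<xi> / e)\<bar> \<le> m1 * L \<Longrightarrow> \<bar>Im (\<xi> / e)\<bar> \<le> m2 * L \<Longrightarrow>
     norm (\<xi> / e) \<le> W \<Longrightarrow> norm (coefG' lam T k \<xi>) \<le> C * (real k ^ 3 * exp (real k * L))"
proof -
  obtain C0 where C0: "\<And>k j \<xi>. 1 \<le> k \<Longrightarrow> j < k \<Longrightarrow> (k, j) \<in> T \<Longrightarrow> \<bar>Re (\<xi> / e)\<bar> \<le> m1 * L \<Longrightarrow> \<bar>Im (\<xi> / e)\<bar> \<le> m2 * L \<Longrightarrow>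
     norm (\<xi> / e) \<le> W \<Longrightarrow> \<bar>Re (\<xi> * gam lam k j)\<bar> \<le> C0 + real k * L"
    by (rule growth[OF assms]) (rule that)
  define C where "C = max (D ^ 2) (D ^ 3) * exp C0"
  have C: "0 < C" "D ^ 2 * exp C0 \<le> C" "D ^ 3 * exp C0 \<le> C" using D by (auto simp: C_def max_def mult_right_mono)
  show ?thesis
  proof (rule that[of C])
    fix k :: nat and \<xi> assume k: "1 \<le> k" and h: "\<bar>Re (\<xi> / e)\<bar> \<le> m1 * L" "\<bar>Im (\<xi> / e)\<bar> \<le> m2 * L" "norm (\<xi> / e) \<le> W"
    have g2: "norm ((gam lam k j)\<^sup>2) \<le> D ^ 2 * real k ^ 2" for j
      using power_mono[OF norm_gam_le[OF k, of j], of 2] by (simp add: norm_power power_mult_distrib)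
    have g3: "norm ((gam lam k j)\<^sup>2) * norm (gam lam k j) \<le> D ^ 3 * real k ^ 3" for j
    proof -
      have "norm ((gam lam k j)\<^sup>2) * norm (gam lam k j) = norm (gam lam k j) ^ 3"
        unfolding norm_power by (simp add: power2_eq_square power3_eq_cube)
      then show ?thesis using power_mono[OF norm_gam_le[OF k, of j], of 3] by (simp add: power_mult_distrib)
    qed
    have ex: "exp \<bar>Re (\<xi> * gam lam k j)\<bar> \<le> exp C0 * exp (real k * L)" if "j < k" "(k, j) \<in> T" for j
      using C0[OF k that h] by (simp flip: exp_add)
    show "norm (coefG lam T k \<xi>) \<le> C * (real k ^ 2 * exp (real k * L))"
      unfolding coefG_def norm_minus_cancel
    proof (rule norm_average_le[OF k])
      fix j assume j: "j < k"
      show "norm (if (k, j) \<in> T then rt k j * (gam lam k j)\<^sup>2 * cosh (\<xi> * gam lam k j) else 0) \<le> C * (real k ^ 2 * exp (real k * L))"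
      proof (cases "(k, j) \<in> T")
        case True
        have "norm (rt k j * (gam lam k j)\<^sup>2 * cosh (\<xi> * gam lam k j)) = norm ((gam lam k j)\<^sup>2) * norm (cosh (\<xi> * gam lam k j))"
          by (simp only: norm_mult norm_rt mult_1)
        also have "\<dots> \<le> (D ^ 2 * real k ^ 2) * (exp C0 * exp (real k * L))"
          using g2 order.trans[OF norm_cosh_le ex[OF j True]] D by (intro mult_mono) auto
        also have "\<dots> = (D ^ 2 * exp C0) * (real k ^ 2 * exp (real k * L))" by (simp only: mult_ac)
        also have "\<dots> \<le> C * (real k ^ 2 * exp (real k * L))" using C by (intro mult_right_mono) auto
        finally show ?thesis using True by simp
      qed (use C in simp)
    qed
    show "norm (coefG' lam T k \<xi>) \<le> C * (real k ^ 3 * exp (real k * L))"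
      unfolding coefG'_def norm_minus_cancel
    proof (rule norm_average_le[OF k])
      fix j assume j: "j < k"
      show "norm (if (k, j) \<in> T then rt k j * (gam lam k j)\<^sup>2 * (sinh (\<xi> * gam lam k j) * gam lam k j) else 0) \<le> C * (real k ^ 3 * exp (real k * L))"
      proof (cases "(k, j) \<in> T")
        case True
        have "norm (rt k j * (gam lam k j)\<^sup>2 * (sinh (\<xi> * gam lam k j) * gam lam k j)) = (norm ((gam lam k j)\<^sup>2) * norm (gam lam k j)) * norm (sinh (\<xi> * gam lam k j))"
          by (simp only: norm_mult norm_rt mult_1 mult_ac)
        also have "\<dots> \<le> (D ^ 3 * real k ^ 3) * (exp C0 * exp (real k * L))"
          using order.trans[OF norm_sinh_le ex[OF j True]] D by (intro mult_mono[OF g3]) auto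
        also have "\<dots> = (D ^ 3 * exp C0) * (real k ^ 3 * exp (real k * L))" by (simp only: mult_ac)
        also have "\<dots> \<le> C * (real k ^ 3 * exp (real k * L))" using C by (intro mult_right_mono) auto
        finally show ?thesis using True by simp
      qed (use C in simp)
    qed
  qed (use C in simp)
qed

text \<open>The ratio exp (L - L') < 1 is left over uniformly near the point. It dominates the terms
  and both partial derivatives, so the series can be differentiated jointly in the two
  variables.\<close>

lemma GT_local:
  assumes T: "sparse_set T m1 m2" and L: "0 \<le> L" "L < L'"
    and z: "norm z0 < exp (- L')" and \<xi>: "\<bar>Re (\<xi>0 / e)\<bar> < m1 * L" "\<bar>Im (\<xi>0 / e)\<bar> < m2 * L"
  shows "(\<lambda>m. coefG lam T (Suc m) \<xi>0 * z0 ^ Suc m) sums GT lam T (\<xi>0, z0)"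
    "\<exists>a b. (GT lam T has_derivative (\<lambda>(h, k). a * h + b * k)) (at (\<xi>0, z0))"
proof -
  define W where "W = norm (\<xi>0 / e) + 1"
  define U where "U = {\<xi>. \<bar>Re (\<xi> / e)\<bar> < m1 * L \<and> \<bar>Im (\<xi> / e)\<bar> < m2 * L \<and> norm (\<xi> / e) < W}"
  have "open U" unfolding U_def using e0 by (intro open_Collect_conj open_Collect_less continuous_intros) auto
  moreover have "\<xi>0 \<in> U" using \<xi> by (simp add: U_def W_def)
  ultimately obtain d where d: "0 < d" "ball \<xi>0 d \<subseteq> U" by (meson open_contains_ball)
  have "open (ball (0::complex) (exp (- L')))" "z0 \<in> ball 0 (exp (- L'))" using z by auto
  then obtain d' where d': "0 < d'" "ball z0 d' \<subseteq> ball 0 (exp (- L'))" by (meson open_contains_ball)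
  \<comment> \<open>A product of balls, because \<open>has_derivative_series\<close> works on a
    convex set.\<close>
  define S where "S = ball \<xi>0 d \<times> ball z0 d'"
  have S: "convex S" "open S" "(\<xi>0, z0) \<in> S" using d(1) d'(1) by (auto simp: S_def intro: convex_Times open_Times)
  obtain C where C: "0 < C" "\<And>k \<xi>. 1 \<le> k \<Longrightarrow> \<bar>Re (\<xi> / e)\<bar> \<le> m1 * L \<Longrightarrow> \<bar>Im (\<xi> / e)\<bar> \<le> m2 * L \<Longrightarrow>
     norm (\<xi> / e) \<le> W \<Longrightarrow> norm (coefG lam T k \<xi>) \<le> C * (real k ^ 2 * exp (real k * L))"
    "\<And>k \<xi>. 1 \<le> k \<Longrightarrow> \<bar>Re (\<xi> / e)\<bar> \<le> m1 * L \<Longrightarrow> \<bar>Im (\<xi> / e)\<bar> \<le> m2 * L \<Longrightarrow>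
     norm (\<xi> / e) \<le> W \<Longrightarrow> norm (coefG' lam T k \<xi>) \<le> C * (real k ^ 3 * exp (real k * L))"
    by (rule coefG_bounds[OF T L(1), of W]) (simp add: W_def, rule that)
  define \<theta> where "\<theta> = exp (L - L')"
  have \<theta>: "0 < \<theta>" "\<theta> < 1" using L by (auto simp: \<theta>_def)
  define f where "f = (\<lambda>m (p::complex \<times> complex). coefG lam T (Suc m) (fst p) * snd p ^ Suc m)"
  define A where "A = (\<lambda>m (p::complex \<times> complex). coefG' lam T (Suc m) (fst p) * snd p ^ Suc m)"
  define B where "B = (\<lambda>m (p::complex \<times> complex). coefG lam T (Suc m) (fst p) * (of_nat (Suc m) * snd p ^ m))"
  define f' where "f' = (\<lambda>m p (v::complex \<times> complex). A m p * fst v + B m p * snd v)"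
  define K where "K = C * (1 + exp L')"
  have K: "0 < K" using C(1) by (auto simp: K_def intro!: mult_pos_pos add_pos_pos)
  define M where "M = (\<lambda>m. K * (real (Suc m) ^ 3 * \<theta> ^ Suc m))"
  have sM: "summable M" unfolding M_def by (intro summable_mult summable_poly_geometric \<theta>)
  have bnd: "norm (f m p) \<le> M m" "norm (A m p) \<le> M m" "norm (B m p) \<le> M m" if p: "p \<in> S" for m p
  proof -
    define k where "k = Suc m"
    have k: "1 \<le> k" by (simp add: k_def)
    have U: "fst p \<in> U" using p d by (auto simp: S_def)
    have zl: "norm (snd p) \<le> exp (- L')" using p d' by (force simp: S_def)
    have c0: "norm (coefG lam T k (fst p)) \<le> C * (real k ^ 2 * exp (real k * L))"
      using U by (intro C(2) k) (auto simp: U_def)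
    have c1: "norm (coefG' lam T k (fst p)) \<le> C * (real k ^ 3 * exp (real k * L))"
      using U by (intro C(3) k) (auto simp: U_def)
    have "real k ^ 2 \<le> real k ^ 3" using k by (intro power_increasing) auto
    then have "C * (real k ^ 2 * exp (real k * L)) \<le> C * (real k ^ 3 * exp (real k * L))"
      using C(1) by (intro mult_left_mono mult_right_mono) auto
    then have c0': "norm (coefG lam T k (fst p)) \<le> C * (real k ^ 3 * exp (real k * L))" using c0 by linarith
    have zk: "norm (snd p) ^ k \<le> exp (- L') ^ k" using zl by (intro power_mono) auto
    have th: "exp (real k * L) * exp (- L') ^ k = \<theta> ^ k"
      by (simp only: \<theta>_def exp_of_nat_mult[symmetric] exp_add[symmetric]) (simp add: algebra_simps)
    have KC: "C \<le> K" using C(1) by (simp add: K_def)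
    have X: "norm (x * snd p ^ k) \<le> M m" if "norm x \<le> C * (real k ^ 3 * exp (real k * L))" for x
    proof -
      have "norm (x * snd p ^ k) \<le> C * (real k ^ 3 * exp (real k * L)) * exp (- L') ^ k"
        unfolding norm_mult norm_power using that zk C(1) by (intro mult_mono) auto
      also have "\<dots> = C * (real k ^ 3 * \<theta> ^ k)" by (simp only: th[symmetric] mult_ac)
      also have "\<dots> \<le> K * (real k ^ 3 * \<theta> ^ k)" using KC \<theta> by (intro mult_right_mono) auto
      finally show ?thesis by (simp only: M_def k_def)
    qed
    show "norm (f m p) \<le> M m" using X[OF c0'] by (simp only: f_def k_def)
    show "norm (A m p) \<le> M m" using X[OF c1] by (simp only: A_def k_def)
    have zm: "norm (snd p) ^ m \<le> exp (- L') ^ m" using zl by (intro power_mono) auto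
    have "exp (- L') ^ m = exp L' * exp (- L') ^ k" by (simp add: k_def exp_minus)
    then have zm: "norm (snd p) ^ m \<le> exp L' * exp (- L') ^ k" using zm by simp
    have "norm (B m p) = norm (coefG lam T k (fst p)) * (real k * norm (snd p) ^ m)"
      by (simp only: B_def norm_mult norm_power norm_of_nat k_def)
    also have "\<dots> \<le> C * (real k ^ 2 * exp (real k * L)) * (real k * (exp L' * exp (- L') ^ k))"
      using c0 zm C(1) by (intro mult_mono mult_left_mono) auto
    also have "\<dots> = C * exp L' * (real k ^ 3 * (exp (real k * L) * exp (- L') ^ k))"
      by (simp add: power2_eq_square power3_eq_cube)
    also have "\<dots> \<le> K * (real k ^ 3 * \<theta> ^ k)" unfolding th using C(1) \<theta> by (intro mult_right_mono) (auto simp: K_def)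
    finally show "norm (B m p) \<le> M m" by (simp only: M_def k_def)
  qed
  have sums_f: "(\<lambda>m. f m p) sums GT lam T p" if "p \<in> S" for p
  proof -
    have "summable (\<lambda>m. f m p)" by (rule summable_comparison_test'[OF sM, of 0]) (use bnd(1)[OF that] in auto)
    moreover have "GT lam T p = (\<Sum>m. f m p)" by (simp only: GT_def f_def)
    ultimately show ?thesis by (simp only: summable_sums)
  qed
  have sA: "summable (\<lambda>m. A m p)" and sB: "summable (\<lambda>m. B m p)" if "p \<in> S" for p
    by (rule summable_comparison_test'[OF sM, of 0], use bnd[OF that] in auto)+
  define g' where "g' = (\<lambda>p (v::complex \<times> complex). (\<Sum>m. A m p) * fst v + (\<Sum>m. B m p) * snd v)"
  have deriv: "((f m) has_derivative (f' m p)) (at p within S)" for m p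
  proof -
    have "((\<lambda>q. coefG lam T (Suc m) (fst q)) has_derivative (\<lambda>v. coefG' lam T (Suc m) (fst p) * fst v)) (at p within S)"
      by (rule has_derivative_compose[OF has_derivative_fst[OF has_derivative_ident]])
         (use coefG_deriv in \<open>auto simp: has_field_derivative_def\<close>)
    moreover have "((\<lambda>q::complex \<times> complex. snd q ^ Suc m) has_derivative (\<lambda>v. of_nat (Suc m) * snd p ^ m * snd v)) (at p within S)"
    proof (rule has_derivative_compose[OF has_derivative_snd[OF has_derivative_ident]])
      have "((\<lambda>z::complex. z ^ Suc m) has_field_derivative of_nat (Suc m) * snd p ^ m) (at (snd p))"
        using DERIV_power_Suc[OF DERIV_ident, of m "snd p" UNIV] by simp
      then show "((\<lambda>z::complex. z ^ Suc m) has_derivative (\<lambda>v. of_nat (Suc m) * snd p ^ m * v)) (at (snd p))"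
        by (simp only: has_field_derivative_def)
    qed
    ultimately have "((\<lambda>q. coefG lam T (Suc m) (fst q) * snd q ^ Suc m) has_derivative
       (\<lambda>v. coefG lam T (Suc m) (fst p) * (of_nat (Suc m) * snd p ^ m * snd v) + coefG' lam T (Suc m) (fst p) * fst v * snd p ^ Suc m)) (at p within S)"
      by (rule has_derivative_mult)
    then show ?thesis unfolding f_def f'_def A_def B_def by (simp add: mult_ac add_ac)
  qed
  have unif: "\<forall>\<^sub>F n in sequentially. \<forall>p\<in>S. \<forall>h. norm ((\<Sum>i<n. f' i p h) - g' p h) \<le> \<epsilon> * norm h" if \<epsilon>: "0 < \<epsilon>" for \<epsilon>
  proof -
    have tail: "norm ((\<Sum>i<n. F i) - suminf F) \<le> (\<Sum>i. M (i + n))" if "\<And>i. norm (F i) \<le> M i" for F :: "nat \<Rightarrow> complex" and n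
    proof -
      have sF: "summable F" by (rule summable_comparison_test'[OF sM, of 0]) (use that in auto)
      have "suminf F - (\<Sum>i<n. F i) = (\<Sum>i. F (i + n))" using suminf_minus_initial_segment[OF sF, of n] by simp
      moreover have "norm (\<Sum>i. F (i + n)) \<le> (\<Sum>i. M (i + n))"
        by (rule norm_suminf_le) (use that sM in \<open>auto simp: summable_iff_shift\<close>)
      ultimately show ?thesis by (simp add: norm_minus_commute)
    qed
    have "(\<lambda>n. (\<Sum>i. M (i + n))) \<longlonglongrightarrow> 0" by (rule suminf_exist_split2[OF sM])
    then have "\<forall>\<^sub>F n in sequentially. (\<Sum>i. M (i + n)) < \<epsilon> / 2" using \<epsilon> by (intro order_tendstoD(2)) auto
    then show ?thesis
    proof (rule eventually_mono, intro ballI allI)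
      fix n p and h :: "complex \<times> complex" assume n: "(\<Sum>i. M (i + n)) < \<epsilon> / 2" and p: "p \<in> S"
      have "(\<Sum>i<n. f' i p h) - g' p h = ((\<Sum>i<n. A i p) - (\<Sum>i. A i p)) * fst h + ((\<Sum>i<n. B i p) - (\<Sum>i. B i p)) * snd h"
        unfolding f'_def g'_def sum.distrib sum_distrib_right[symmetric] by (simp add: algebra_simps)
      also have "norm \<dots> \<le> \<epsilon> / 2 * norm h + \<epsilon> / 2 * norm h"
      proof (rule norm_triangle_le, unfold norm_mult, intro add_mono mult_mono)
        show "norm ((\<Sum>i<n. A i p) - (\<Sum>i. A i p)) \<le> \<epsilon> / 2" using tail[of "\<lambda>i. A i p" n, OF bnd(2)[OF p]] n by linarith
        show "norm ((\<Sum>i<n. B i p) - (\<Sum>i. B i p)) \<le> \<epsilon> / 2" using tail[of "\<lambda>i. B i p" n, OF bnd(3)[OF p]] n by linarith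
        show "norm (fst h) \<le> norm h" "norm (snd h) \<le> norm h"
          by (metis norm_fst_le norm_snd_le prod.collapse)+
      qed (use \<epsilon> in auto)
      finally show "norm ((\<Sum>i<n. f' i p h) - g' p h) \<le> \<epsilon> * norm h" by simp
    qed
  qed
  obtain G where G: "\<And>p. p \<in> S \<Longrightarrow> (\<lambda>m. f m p) sums G p" "\<And>p. p \<in> S \<Longrightarrow> (G has_derivative g' p) (at p within S)"
    using has_derivative_series[OF S(1) deriv unif S(3) sums_f[OF S(3)]] by blast
  have GG: "GT lam T p = G p" if "p \<in> S" for p using sums_f[OF that] G(1)[OF that] by (rule sums_unique2)
  have "(GT lam T has_derivative g' (\<xi>0, z0)) (at (\<xi>0, z0) within S)"
    by (rule has_derivative_transform[OF S(3) GG G(2)[OF S(3)]])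
  then have "(GT lam T has_derivative g' (\<xi>0, z0)) (at (\<xi>0, z0))"
    by (simp only: at_within_open[OF S(3,2)])
  moreover have g'eq: "g' (\<xi>0, z0) = (\<lambda>(h, k). (\<Sum>m. A m (\<xi>0, z0)) * h + (\<Sum>m. B m (\<xi>0, z0)) * k)"
    by (auto simp: g'_def)
  ultimately show "\<exists>a b. (GT lam T has_derivative (\<lambda>(h, k). a * h + b * k)) (at (\<xi>0, z0))"
    by (intro exI) (simp only: g'eq)
  show "(\<lambda>m. coefG lam T (Suc m) \<xi>0 * z0 ^ Suc m) sums GT lam T (\<xi>0, z0)"
    using sums_f[OF S(3)] by (simp only: f_def fst_conv snd_conv)
qed

end

section \<open>Agreement of the continued series with the germ\<close>

lemma cosh_even_sums:
  fixes y :: "'a :: {banach, real_normed_field}"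
  shows "(\<lambda>n. y ^ (2 * n) / fact (2 * n)) sums cosh y"
proof -
  have "(\<lambda>n. (\<lambda>n. if even n then y ^ n /\<^sub>R fact n else 0) (2 * n)) sums cosh y
     \<longleftrightarrow> (\<lambda>n. if even n then y ^ n /\<^sub>R fact n else 0) sums cosh y"
    by (rule sums_mono_reindex) (auto simp: strict_mono_def elim!: evenE)
  then have "(\<lambda>n. y ^ (2 * n) /\<^sub>R fact (2 * n)) sums cosh y" using cosh_converges[of y] by simp
  then show ?thesis by (simp add: scaleR_conv_of_real field_simps)
qed

lemma sum_even_le_exp:
  fixes y :: real assumes "0 \<le> y"
  shows "(\<Sum>n<N. y ^ (2 * n) / fact (2 * n)) \<le> exp y"
proof -
  have "(\<Sum>n<N. y ^ (2 * n) / fact (2 * n)) \<le> (\<Sum>n. y ^ (2 * n) / fact (2 * n))"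
    by (rule sum_le_suminf) (use cosh_even_sums[of y] assms in \<open>auto simp: sums_iff\<close>)
  also have "\<dots> = cosh y" using cosh_even_sums[of y] by (simp add: sums_iff)
  also have "\<dots> \<le> exp y" using assms by (simp add: cosh_field_def)
  finally show ?thesis .
qed

context rotated
begin

lemma lam1: "norm lam = 1"
  by (simp add: lam)

lemma norm_coefF: "norm (coefF lam n m) \<le> (D * real (Suc m)) ^ (2 * Suc n)"
proof -
  have "norm (coefF lam n m) \<le> (real (Suc m)) ^ (2 * Suc n) / (2 * c) ^ Suc n"
  proof (rule norm_coefF_le)
    show "norm lam = 1" by (rule lam1)
    show "0 < 2 * c" using c by simp
    show "0 < (1/2 :: real)" "(1/2 :: real) < 1" by auto
    show "2 * c / (real k)\<^sup>2 \<le> norm (rt k j - lam)" if "1 \<le> k" for k j using rt_gap[OF bad that] by (simp add: lam)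
  qed
  also have "\<dots> = (D * real (Suc m)) ^ (2 * Suc n)"
  proof -
    have "D\<^sup>2 = 1 / (2 * c)" using c by (simp add: D_def power_divide)
    then show ?thesis unfolding power_mult_distrib power_mult[of D] by (simp add: power_divide)
  qed
  finally show ?thesis .
qed

lemma asum_coefF':
  assumes "0 < r" "r < 1" shows "asum r (coefF lam n)"
proof (rule asum_coefF)
  show "norm lam = 1" by (rule lam1)
  show "0 < 2 * c" using c by simp
  show "2 * c / (real k)\<^sup>2 \<le> norm (rt k j - lam)" if "1 \<le> k" for k j using rt_gap[OF bad that] by (simp add: lam)
qed (use assms in auto)

lemma coefG_sums: "(\<lambda>n. coefF lam n m * \<xi> ^ (2 * n) / fact (2 * n)) sums coefG lam UNIV (Suc m) \<xi>"
proof -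
  define k where "k = Suc m"
  have "(\<lambda>n. - ((1 / of_nat k) * (\<Sum>j<k. rt k j * (gam lam k j)\<^sup>2 * ((\<xi> * gam lam k j) ^ (2 * n) / fact (2 * n))))) sums
     (- ((1 / of_nat k) * (\<Sum>j<k. rt k j * (gam lam k j)\<^sup>2 * cosh (\<xi> * gam lam k j))))"
    by (intro sums_minus sums_mult sums_sum cosh_even_sums)
  moreover have "- ((1 / of_nat k) * (\<Sum>j<k. rt k j * (gam lam k j)\<^sup>2 * ((\<xi> * gam lam k j) ^ (2 * n) / fact (2 * n))))
     = coefF lam n m * \<xi> ^ (2 * n) / fact (2 * n)" for n
  proof -
    have "rt k j * (gam lam k j)\<^sup>2 * ((\<xi> * gam lam k j) ^ (2 * n) / fact (2 * n))
      = rt k j / (rt k j - lam) ^ Suc n * (\<xi> ^ (2 * n) / fact (2 * n))" for j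
    proof -
      have "(gam lam k j)\<^sup>2 * gam lam k j ^ (2 * n) = 1 / (rt k j - lam) ^ Suc n"
        unfolding power_mult[of "gam lam k j"] gam_square by (simp add: power_divide)
      then have "rt k j * ((gam lam k j)\<^sup>2 * gam lam k j ^ (2 * n)) * (\<xi> ^ (2 * n) / fact (2 * n))
         = rt k j / (rt k j - lam) ^ Suc n * (\<xi> ^ (2 * n) / fact (2 * n))" by (simp del: power_Suc)
      then show ?thesis by (simp add: power_mult_distrib mult_ac del: power_Suc)
    qed
    then have "(\<Sum>j<k. rt k j * (gam lam k j)\<^sup>2 * ((\<xi> * gam lam k j) ^ (2 * n) / fact (2 * n)))
       = (\<Sum>j<k. rt k j / (rt k j - lam) ^ Suc n) * (\<xi> ^ (2 * n) / fact (2 * n))"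
      by (simp only: sum_distrib_right)
    then show ?thesis unfolding coefF_def k_def[symmetric] by (simp only:) (simp del: power_Suc)
  qed
  ultimately show ?thesis unfolding coefG_def k_def by simp
qed

text \<open>Tannery's theorem interchanges the sums over n and over the powers of z: the partial
  sums over n at index k are dominated, uniformly in their length, by D^2 k^2 exp (D k \<epsilon>)
  r^k.\<close>

lemma GT_germ:
  assumes r: "0 < r" "r < 1"
  obtains \<epsilon> where "0 < \<epsilon>" "\<And>\<xi> z. \<xi> \<in> ball 0 \<epsilon> \<Longrightarrow> z \<in> ball 0 r \<Longrightarrow>
     (\<lambda>n. pser r (coefF lam n) z * \<xi> ^ (2 * n) / fact (2 * n)) sums GT lam UNIV (\<xi>, z)"
proof -
  \<comment> \<open>Chosen so that exp (D \<epsilon>) r = sqrt r: the growth in \<xi> uses up half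
    of the decay of r^k.\<close>
  define \<epsilon> where "\<epsilon> = - ln r / (2 * D)"
  have \<epsilon>: "0 < \<epsilon>" using r D by (simp add: \<epsilon>_def divide_neg_pos)
  have er: "exp (D * \<epsilon>) * r = sqrt r"
  proof -
    have "D * \<epsilon> = - (1/2 * ln r)" using D by (simp add: \<epsilon>_def)
    then have "exp (D * \<epsilon>) = inverse (exp (1/2 * ln r))" by (simp only: exp_minus)
    also have "exp (1/2 * ln r) = sqrt r" using powr_half_sqrt[of r] r by (simp add: powr_def)
    finally have "exp (D * \<epsilon>) = 1 / sqrt r" by (simp add: divide_inverse)
    then show ?thesis using r real_div_sqrt[of r] by simp
  qed
  have main: "(\<lambda>n. pser r (coefF lam n) z * \<xi> ^ (2 * n) / fact (2 * n)) sums GT lam UNIV (\<xi>, z)"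
    if \<xi>: "\<xi> \<in> ball 0 \<epsilon>" and z: "z \<in> ball 0 r" for \<xi> z
  proof -
    define M where "M = (\<lambda>m. D\<^sup>2 * (real (Suc m) ^ 2 * sqrt r ^ Suc m))"
    have sM: "summable M" unfolding M_def using r by (intro summable_mult summable_poly_geometric) auto
    define a where "a = (\<lambda>m N. \<Sum>n<N. coefF lam n m * \<xi> ^ (2 * n) / fact (2 * n) * z ^ Suc m)"
    have lim: "a m \<longlonglongrightarrow> coefG lam UNIV (Suc m) \<xi> * z ^ Suc m" for m
      using sums_mult2[OF coefG_sums, of m \<xi> "z ^ Suc m"] unfolding a_def sums_def .
    have bound: "norm (a m N) \<le> M m" for m N
    proof -
      define y where "y = D * real (Suc m)"
      have y: "0 \<le> y" using D by (simp add: y_def)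
      have "norm (a m N) \<le> (\<Sum>n<N. (y\<^sup>2 * r ^ Suc m) * ((y * \<epsilon>) ^ (2 * n) / fact (2 * n)))"
        unfolding a_def
      proof (rule order.trans[OF norm_sum sum_mono])
        fix n
        have "norm (coefF lam n m * \<xi> ^ (2 * n) / fact (2 * n) * z ^ Suc m)
           = norm (coefF lam n m) * norm \<xi> ^ (2 * n) / fact (2 * n) * norm z ^ Suc m"
          by (simp only: norm_mult norm_divide norm_power norm_fact)
        also have "\<dots> \<le> y ^ (2 * Suc n) * \<epsilon> ^ (2 * n) / fact (2 * n) * r ^ Suc m"
          using norm_coefF[of n m] \<xi> z y \<epsilon>
          by (intro mult_mono divide_right_mono power_mono) (auto simp: y_def)
        also have "\<dots> = (y\<^sup>2 * r ^ Suc m) * ((y * \<epsilon>) ^ (2 * n) / fact (2 * n))"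
          by (simp add: power_mult_distrib power_add mult_ac power2_eq_square)
        finally show "norm (coefF lam n m * \<xi> ^ (2 * n) / fact (2 * n) * z ^ Suc m) \<le> (y\<^sup>2 * r ^ Suc m) * ((y * \<epsilon>) ^ (2 * n) / fact (2 * n))" .
      qed
      also have "\<dots> = (y\<^sup>2 * r ^ Suc m) * (\<Sum>n<N. (y * \<epsilon>) ^ (2 * n) / fact (2 * n))" by (simp only: sum_distrib_left)
      also have "\<dots> \<le> (y\<^sup>2 * r ^ Suc m) * exp (y * \<epsilon>)"
        using y r \<epsilon> by (intro mult_left_mono sum_even_le_exp) auto
      also have "exp (y * \<epsilon>) = exp (D * \<epsilon>) ^ Suc m"
        unfolding exp_of_nat_mult[symmetric] y_def by (simp only: mult_ac)
      also have "y\<^sup>2 * r ^ Suc m * exp (D * \<epsilon>) ^ Suc m = y\<^sup>2 * (exp (D * \<epsilon>) * r) ^ Suc m"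
        by (simp only: power_mult_distrib mult_ac)
      also have "\<dots> = M m" unfolding er M_def y_def by (simp only: power_mult_distrib mult_ac)
      finally show ?thesis .
    qed
    have "\<forall>\<^sub>F (m, N) in at_top \<times>\<^sub>F sequentially. norm (a m N) \<le> M m"
      by (rule always_eventually) (use bound in auto)
    from tannerys_theorem[OF lim this sM]
    have "(\<lambda>N. \<Sum>m. a m N) \<longlonglongrightarrow> (\<Sum>m. coefG lam UNIV (Suc m) \<xi> * z ^ Suc m)" by simp
    moreover have "(\<Sum>m. a m N) = (\<Sum>n<N. pser r (coefF lam n) z * \<xi> ^ (2 * n) / fact (2 * n))" for N
    proof -
      have "(\<lambda>m. \<Sum>n<N. coefF lam n m * z ^ Suc m * (\<xi> ^ (2 * n) / fact (2 * n))) sums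
         (\<Sum>n<N. pser r (coefF lam n) z * (\<xi> ^ (2 * n) / fact (2 * n)))"
        by (intro sums_sum sums_mult2 pser_sums asum_coefF' r) (use z in auto)
      moreover have "(\<lambda>m. \<Sum>n<N. coefF lam n m * z ^ Suc m * (\<xi> ^ (2 * n) / fact (2 * n))) = (\<lambda>m. a m N)"
        by (simp add: a_def mult_ac)
      ultimately show ?thesis by (simp add: sums_iff)
    qed
    ultimately show ?thesis by (simp add: sums_def GT_def)
  qed
  show ?thesis by (rule that[OF \<epsilon> main])
qed

lemma sparse_UNIV:
  assumes "lagrange \<alpha> s \<nu>1" "lagrange \<alpha> (- s) \<nu>2" "0 < m1" "m1 < sqrt \<nu>1" "0 < m2" "m2 < sqrt \<nu>2"
  shows "sparse_set UNIV m1 m2"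
proof -
  have "m1\<^sup>2 < \<nu>1" "m2\<^sup>2 < \<nu>2"
    using real_sqrt_less_iff[of "m1\<^sup>2" \<nu>1] real_sqrt_less_iff[of "m2\<^sup>2" \<nu>2] assms by auto
  then obtain K1 K2 where K: 
    "\<And>k N. K1 \<le> k \<Longrightarrow> 0 < s * (of_int N / real k - \<alpha>) \<Longrightarrow> m1\<^sup>2 \<le> (real k)\<^sup>2 * (s * (of_int N / real k - \<alpha>))"
    "\<And>k N. K2 \<le> k \<Longrightarrow> 0 < (- s) * (of_int N / real k - \<alpha>) \<Longrightarrow> m2\<^sup>2 \<le> (real k)\<^sup>2 * ((- s) * (of_int N / real k - \<alpha>))"
    using assms(1,2) unfolding lagrange_def by meson
  show ?thesis unfolding sparse_set_def
  proof (intro conjI assms exI[of _ "max K1 K2"] allI impI)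
    fix k j assume k: "max K1 K2 \<le> k"
    show "m1\<^sup>2 \<le> (real k)\<^sup>2 * X k j" if "0 < X k j" using K(1)[of k "int j"] k that by (simp add: X_def)
    show "m2\<^sup>2 \<le> (real k)\<^sup>2 * - X k j" if "X k j < 0" using K(2)[of k "int j"] k that by (simp add: X_def)
  qed
qed

end

section \<open>Lacunary frequencies\<close>

text \<open>With b the root, 2 Re b Im b = Im y and Re b \<ge> 1 give |Im b| \<le> K / 2, and b
  differs from |b| by at most 2 |Im b|.\<close>

lemma csqrt_near_real:
  fixes y :: complex and t K :: real
  assumes "norm (y - of_real t) \<le> K" "1 \<le> t - K"
  shows "norm (csqrt y - of_real (norm (csqrt y))) \<le> K"
proof -
  define b where "b = csqrt y"
  have b2: "b\<^sup>2 = y" by (simp add: b_def)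
  have Re0: "0 \<le> Re b" unfolding b_def using csqrt_principal[of y] by auto
  have "\<bar>Im (y - of_real t)\<bar> \<le> K" "\<bar>Re (y - of_real t)\<bar> \<le> K"
    using abs_Im_le_cmod[of "y - of_real t"] abs_Re_le_cmod[of "y - of_real t"] assms(1) by linarith+
  then have I: "\<bar>Im y\<bar> \<le> K" and R: "1 \<le> Re y" using assms(2) by (auto simp: abs_le_iff)
  have "Re y = (Re b)\<^sup>2 - (Im b)\<^sup>2" "Im y = 2 * Re b * Im b" unfolding b2[symmetric] by (simp_all add: power2_eq_square)
  with R have "1\<^sup>2 \<le> (Re b)\<^sup>2" using zero_le_power2[of "Im b"] by (simp only: one_power2)
  then have Re1: "1 \<le> Re b" using Re0 by (rule power2_le_imp_le)
  have "2 * \<bar>Im b\<bar> * 1 \<le> 2 * \<bar>Im b\<bar> * Re b" using Re1 by (intro mult_left_mono) auto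
  also have "\<dots> = \<bar>Im y\<bar>" using Re0 \<open>Im y = 2 * Re b * Im b\<close> by (simp add: abs_mult)
  finally have Im: "2 * \<bar>Im b\<bar> \<le> K" using I by simp
  have "norm b \<le> Re b + \<bar>Im b\<bar>" using cmod_le[of b] Re0 by simp
  then have "\<bar>Re b - norm b\<bar> \<le> \<bar>Im b\<bar>" using complex_Re_le_cmod[of b] by simp
  moreover have "norm (b - of_real (norm b)) \<le> \<bar>Re b - norm b\<bar> + \<bar>Im b\<bar>" using cmod_le[of "b - of_real (norm b)"] by simp
  ultimately show ?thesis using Im unfolding b_def by linarith
qed

text \<open>Past \<open>Ka\<close> the Lagrange bound holds with the constant \<nu>1 / 2. The
  conditions on \<open>K1\<close> after the first provide, in this order: one numerator per
  denominator, reduced fractions, frequencies close to the positive axis, and gaps that survive the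
  error \<open>K\<close>.\<close>

locale boundary = rotated +
  fixes z :: complex and \<nu>1 \<nu>2 K :: real and Ka K1 :: nat
  assumes z: "z \<noteq> 0" "norm z < 1"
    and lag1: "lagrange \<alpha> s \<nu>1" and lag2: "lagrange \<alpha> (- s) \<nu>2"
    and K: "0 < K" "\<And>k j. 1 \<le> k \<Longrightarrow> j < k \<Longrightarrow> norm ((bet k j)\<^sup>2 - of_real (1 / X k j)) \<le> K"
    and Ka: "1 \<le> Ka" "\<And>k N. Ka \<le> k \<Longrightarrow> 0 < s * (of_int N / real k - \<alpha>) \<Longrightarrow> \<nu>1 / 2 \<le> (real k)\<^sup>2 * (s * (of_int N / real k - \<alpha>))"
    and K1: "Ka \<le> K1" "3 * \<nu>1 / 2 < real K1" "3 * \<nu>1 / 2 * (real Ka)\<^sup>2 \<le> c * (real K1)\<^sup>2"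
      "3 * \<nu>1 * (K + 1) \<le> (real K1)\<^sup>2" "9 * \<nu>1\<^sup>2 * K \<le> (real K1)\<^sup>2"
begin

lemma \<nu>: "0 < \<nu>1" "0 < \<nu>2"
  using lag1 lag2 by (auto simp: lagrange_def)

text \<open>
  The indices whose summands may diverge across the right side. The bounds on \<open>K1\<close> make the fractions
  \<open>j / k\<close> reduced: after cancelling a factor \<open>d \<ge> 2\<close> a small denominator would be too far from \<open>\<alpha>\<close>,
  and a large one would violate the lower bound \<open>\<nu>1 / 2\<close>, because \<open>(3 / 2) / d\<^sup>2 < 1 / 2\<close>.
\<close>

definition E :: "(nat \<times> nat) set" where
  "E = {(k, j). j < k \<and> K1 \<le> k \<and> 0 < X k j \<and> (real k)\<^sup>2 * X k j < 3 * \<nu>1 / 2}"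

lemma E_D:
  assumes "(k, j) \<in> E"
  shows "j < k" "K1 \<le> k" "1 \<le> k" "0 < X k j" "(real k)\<^sup>2 * X k j < 3 * \<nu>1 / 2" "\<nu>1 / 2 \<le> (real k)\<^sup>2 * X k j"
    "real K1 \<le> real k"
  using assms Ka(2)[of k "int j"] K1(1) by (auto simp: E_def X_def)

lemma E_coprime:
  assumes E: "(k, j) \<in> E" shows "coprime k j"
proof (rule ccontr)
  note h = E_D[OF E]
  assume "\<not> coprime k j"
  define d where "d = gcd k j"
  have "d \<noteq> 1" "d \<noteq> 0" using \<open>\<not> coprime k j\<close> h(3) by (auto simp: d_def coprime_iff_gcd_eq_1)
  then have d: "2 \<le> d" by simp
  obtain k' j' where kj: "k = d * k'" "j = d * j'" unfolding d_def by (meson dvdE gcd_dvd1 gcd_dvd2)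
  have k': "1 \<le> k'" using h(3) by (cases k') (auto simp: kj)
  have X: "X k j = X k' j'" using d by (simp add: X_def kj)
  have "4 * ((real k')\<^sup>2 * X k j) \<le> (real d)\<^sup>2 * ((real k')\<^sup>2 * X k j)"
    using d h(4) power_mono[of 2 "real d" 2] by (intro mult_right_mono) auto
  also have "\<dots> = (real k)\<^sup>2 * X k j" by (simp add: kj power_mult_distrib)
  finally have lt: "(real k')\<^sup>2 * X k j < \<nu>1 / 2" using h(5) \<nu> by linarith
  have "k' < Ka"
  proof (rule ccontr)
    assume "\<not> k' < Ka"
    then have "\<nu>1 / 2 \<le> (real k')\<^sup>2 * X k' j'" using Ka(2)[of k' "int j'"] h(4) unfolding X by (simp add: X_def)
    then show False using lt X by simp
  qed
  have "c \<le> (real k')\<^sup>2 * X k j" using X_lower[OF k', of j'] h(4) unfolding X by simp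
  also have "\<dots> \<le> (real Ka)\<^sup>2 * X k j" using \<open>k' < Ka\<close> h(4) by (intro mult_right_mono power_mono) auto
  finally have "c * (real K1)\<^sup>2 \<le> (real Ka)\<^sup>2 * X k j * (real K1)\<^sup>2" by (intro mult_right_mono) auto
  then have "3 * \<nu>1 / 2 * (real Ka)\<^sup>2 \<le> ((real K1)\<^sup>2 * X k j) * (real Ka)\<^sup>2" using K1(3) by (simp add: mult_ac)
  then have "3 * \<nu>1 / 2 \<le> (real K1)\<^sup>2 * X k j" using Ka(1) by (subst (asm) mult_le_cancel_right) auto
  also have "\<dots> \<le> (real k)\<^sup>2 * X k j" using h by (intro mult_right_mono power_mono) auto
  finally show False using h(5) by simp
qed

text \<open>Two numerators would give fractions at distance at least 1 / k inside an interval of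
  length 3 \<nu>1 / (2 k^2).\<close>

lemma E_unique:
  assumes "(k, j) \<in> E" "(k, j') \<in> E" shows "j = j'"
proof (rule ccontr)
  assume ne: "j \<noteq> j'"
  note h = E_D[OF assms(1)] and h' = E_D[OF assms(2)]
  have "1 \<le> \<bar>real j - real j'\<bar>" using ne by linarith
  then have "1 / real k \<le> \<bar>real j - real j'\<bar> / real k" by (intro divide_right_mono) auto
  also have "\<dots> = \<bar>X k j - X k j'\<bar>"
  proof -
    have "X k j - X k j' = of_int s * ((real j - real j') / real k)" by (simp add: X_def algebra_simps diff_divide_distrib)
    then show ?thesis using s_cases(1) h(3) by (auto simp: abs_mult)
  qed
  finally have "(real k)\<^sup>2 * (1 / real k) \<le> (real k)\<^sup>2 * \<bar>X k j - X k j'\<bar>" by (intro mult_left_mono) auto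
  moreover have "(real k)\<^sup>2 * \<bar>X k j - X k j'\<bar> = \<bar>(real k)\<^sup>2 * X k j - (real k)\<^sup>2 * X k j'\<bar>"
    by (simp add: abs_mult flip: right_diff_distrib)
  moreover have "0 \<le> (real k)\<^sup>2 * X k j" "0 \<le> (real k)\<^sup>2 * X k j'" using h(4) h'(4) by auto
  ultimately have "(real k)\<^sup>2 * (1 / real k) < 3 * \<nu>1 / 2" using h(5) h'(5) by linarith
  then have "real k < 3 * \<nu>1 / 2" using h(3) by (simp add: power2_eq_square)
  then show False using K1(2) h(7) by linarith
qed

text \<open>\<open>bet k j\<close> up to sign, normalised to a nonnegative real part, as closeness
  to the positive axis requires.\<close>

definition freq :: "nat \<Rightarrow> nat \<Rightarrow> complex" where
  "freq k j = csqrt ((bet k j)\<^sup>2)"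

definition c1 :: real where "c1 = 1 / sqrt (3 * \<nu>1)"

lemma c1: "0 < c1" "c1\<^sup>2 = 1 / (3 * \<nu>1)"
  using \<nu> by (auto simp: c1_def power_divide)

lemma K_le: "(k, j) \<in> E \<Longrightarrow> K + 1 \<le> (real k)\<^sup>2 / (3 * \<nu>1)"
proof -
  assume "(k, j) \<in> E"
  note h = E_D[OF this]
  have "(real K1)\<^sup>2 \<le> (real k)\<^sup>2" using h(7) by (intro power_mono) auto
  with K1(4) have "3 * \<nu>1 * (K + 1) \<le> (real k)\<^sup>2" by (rule order.trans)
  then have "(K + 1) * (3 * \<nu>1) \<le> (real k)\<^sup>2" by (simp only: mult.commute)
  then show ?thesis using \<nu> by (subst pos_le_divide_eq) auto
qed

lemma inverse_X:
  assumes E: "(k, j) \<in> E"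
  shows "2 * ((real k)\<^sup>2 / (3 * \<nu>1)) \<le> 1 / X k j" "1 / X k j \<le> 2 * ((real k)\<^sup>2 / \<nu>1)"
proof -
  note h = E_D[OF E]
  show "2 * ((real k)\<^sup>2 / (3 * \<nu>1)) \<le> 1 / X k j" using h(3,4,5) \<nu> by (simp add: field_simps)
  show "1 / X k j \<le> 2 * ((real k)\<^sup>2 / \<nu>1)" using h(3,4,6) \<nu> by (simp add: field_simps)
qed

lemma freq_near: assumes E: "(k, j) \<in> E" shows "norm (freq k j - of_real (norm (freq k j))) \<le> K"
  unfolding freq_def
proof (rule csqrt_near_real)
  show "norm ((bet k j)\<^sup>2 - of_real (1 / X k j)) \<le> K" using K(2) E_D[OF E] by blast
  have "0 \<le> (real k)\<^sup>2 / (3 * \<nu>1)" using \<nu> by simp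
  then show "1 \<le> 1 / X k j - K" using inverse_X(1)[OF E] K_le[OF E] by linarith
qed

lemma freq_square: assumes E: "(k, j) \<in> E"
  shows "(norm (freq k j))\<^sup>2 \<le> 1 / X k j + K" "1 / X k j - K \<le> (norm (freq k j))\<^sup>2"
proof -
  have "(norm (freq k j))\<^sup>2 = norm ((bet k j)\<^sup>2)" by (simp add: freq_def flip: norm_power)
  moreover have "\<bar>norm ((bet k j)\<^sup>2) - norm (of_real (1 / X k j) :: complex)\<bar> \<le> K"
    using norm_triangle_ineq3[of "(bet k j)\<^sup>2" "of_real (1 / X k j)"] K(2)[of k j] E_D[OF E] by linarith
  moreover have "norm (of_real (1 / X k j) :: complex) = 1 / X k j" using E_D(4)[OF E] by (simp add: norm_divide)
  ultimately show "(norm (freq k j))\<^sup>2 \<le> 1 / X k j + K" "1 / X k j - K \<le> (norm (freq k j))\<^sup>2" by linarith+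
qed

text \<open>The error \<open>K\<close> is at most k^2 / (3 \<nu>1), half of the lower bound of 1 /
  X. The upper estimate 7 c1^2 k^2 for the square is rounded up to 9 c1^2 k^2.\<close>

lemma freq_bounds: assumes E: "(k, j) \<in> E"
  shows "c1 * real k \<le> norm (freq k j)" "norm (freq k j) \<le> 3 * c1 * real k"
proof -
  note i = inverse_X[OF E] and f = freq_square[OF E] and Kl = K_le[OF E]
  have "(c1 * real k)\<^sup>2 = (real k)\<^sup>2 / (3 * \<nu>1)" by (simp add: power_mult_distrib c1)
  then have "(c1 * real k)\<^sup>2 \<le> (norm (freq k j))\<^sup>2" using i f Kl K(1) by linarith
  then show "c1 * real k \<le> norm (freq k j)" by (rule power2_le_imp_le) simp
  have "(3 * c1 * real k)\<^sup>2 = 9 * ((real k)\<^sup>2 / (3 * \<nu>1))" by (simp add: power_mult_distrib c1)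
  moreover have "(real k)\<^sup>2 / \<nu>1 = 3 * ((real k)\<^sup>2 / (3 * \<nu>1))" by simp
  ultimately have "(norm (freq k j))\<^sup>2 \<le> (3 * c1 * real k)\<^sup>2" using i f Kl by linarith
  then show "norm (freq k j) \<le> 3 * c1 * real k" by (rule power2_le_imp_le) (use c1 in auto)
qed

text \<open>Distinct fractions \<open>j / k\<close> and \<open>j' / k'\<close> differ by at least \<open>1 / (k * k')\<close>; this makes the frequencies lacunary.\<close>

lemma freq_gap:
  obtains \<eta> where "0 < \<eta>" "\<And>k j k' j'. (k, j) \<in> E \<Longrightarrow> (k', j') \<in> E \<Longrightarrow> k \<noteq> k' \<Longrightarrow>
     \<eta> * norm (freq k' j') \<le> \<bar>norm (freq k j) - norm (freq k' j')\<bar>"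
proof -
  define A where "A = 3 * \<nu>1 / 2"
  have A: "0 < A" using \<nu> by (simp add: A_def)
  \<comment> \<open>1/6 serves the case k' \<ge> 6 k. In the other case 126 is 3, from \<mu>' \<le>
    3 c1 k', times twice 21, from \<mu> + \<mu>' \<le> 21 c1 k.\<close>
  define \<eta> where "\<eta> = min (1/6) (1 / (126 * A\<^sup>2 * c1\<^sup>2))"
  have \<eta>: "0 < \<eta>" using A c1(1) by (simp add: \<eta>_def)
  have "\<eta> * norm (freq k' j') \<le> \<bar>norm (freq k j) - norm (freq k' j')\<bar>"
    if E: "(k, j) \<in> E" and E': "(k', j') \<in> E" and ne: "k \<noteq> k'" for k j k' j'
  proof -
    note h = E_D[OF E] and h' = E_D[OF E']
    define \<mu> \<mu>' where "\<mu> = norm (freq k j)" and "\<mu>' = norm (freq k' j')"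
    have b: "c1 * real k \<le> \<mu>" "\<mu> \<le> 3 * c1 * real k" "c1 * real k' \<le> \<mu>'" "\<mu>' \<le> 3 * c1 * real k'"
      using freq_bounds[OF E] freq_bounds[OF E'] by (auto simp: \<mu>_def \<mu>'_def)
    \<comment> \<open>If k' is at least 6 k, the size bounds c1 k and 3 c1 k already separate the
      frequencies. Otherwise k' is controlled by k, and the difference of the squares can be divided
      by \<mu> + \<mu>'.\<close>
    show ?thesis
    proof (cases "6 * k \<le> k'")
      case True
      have "3 * c1 * (6 * real k) \<le> 3 * c1 * real k'" using True c1 by (intro mult_left_mono) auto
      then have "6 * \<mu> \<le> 3 * (c1 * real k')" using b(2) by linarith
      then have "\<bar>\<mu> - \<mu>'\<bar> \<ge> c1 * real k' / 2" using b(3) by linarith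
      moreover have "1/6 * \<mu>' \<le> c1 * real k' / 2" using b(4) by simp
      moreover have "\<eta> * \<mu>' \<le> 1/6 * \<mu>'" unfolding \<mu>'_def by (intro mult_right_mono) (auto simp: \<eta>_def)
      ultimately show ?thesis unfolding \<mu>_def[symmetric] \<mu>'_def[symmetric] by linarith
    next
      case False
      have kpos: "0 < real k" "0 < real k'" using h(3) h'(3) by auto
      have "int j * int k' - int j' * int k \<noteq> 0"
      proof
        assume "int j * int k' - int j' * int k = 0"
        then have eq: "j * k' = j' * k" by (metis eq_iff_diff_eq_0 of_nat_eq_iff of_nat_mult)
        have "k dvd k'" using eq E_coprime[OF E] by (metis coprime_dvd_mult_right_iff dvd_triv_right)
        moreover have "k' dvd k" using eq E_coprime[OF E'] by (metis coprime_dvd_mult_right_iff dvd_triv_right)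
        ultimately show False using ne by (simp add: dvd_antisym)
      qed
      then have "1 \<le> \<bar>int j * int k' - int j' * int k\<bar>" by linarith
      then have "1 \<le> real_of_int \<bar>int j * int k' - int j' * int k\<bar>" by linarith
      then have one: "1 \<le> \<bar>real j * real k' - real j' * real k\<bar>" by simp
      have "X k j - X k' j' = of_int s * ((real j * real k' - real j' * real k) / (real k * real k'))"
        using kpos by (simp add: X_def field_simps)
      then have Xd: "\<bar>X k j - X k' j'\<bar> = \<bar>real j * real k' - real j' * real k\<bar> / (real k * real k')"
        using s_cases(1) kpos by (auto simp: abs_mult)
      have "1 / X k j - 1 / X k' j' = (X k' j' - X k j) / (X k j * X k' j')" using h(4) h'(4) by (simp add: field_simps)
      then have "\<bar>1 / X k j - 1 / X k' j'\<bar> = \<bar>X k j - X k' j'\<bar> / (X k j * X k' j')"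
        using h(4) h'(4) by (simp add: abs_minus_commute)
      also have "\<dots> \<ge> 1 / (real k * real k') / (X k j * X k' j')"
        unfolding Xd using one kpos h(4) h'(4) by (intro divide_right_mono) auto
      also have "1 / (real k * real k') / (X k j * X k' j') = real k * real k' / (((real k)\<^sup>2 * X k j) * ((real k')\<^sup>2 * X k' j'))"
        using kpos by (simp add: power2_eq_square)
      also have "\<dots> \<ge> real k * real k' / (A * A)"
        using h h' kpos A by (intro divide_left_mono mult_mono mult_pos_pos) (auto simp: A_def)
      finally have y: "real k * real k' / (A * A) \<le> \<bar>1 / X k j - 1 / X k' j'\<bar>" by simp
      \<comment> \<open>Replacing 1 / X by \<mu>^2 for both fractions costs 2 K, at most half of the
        gap.\<close>
      have KA: "4 * K \<le> real k * real k' / (A * A)"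
      proof -
        have "4 * K * (A * A) = 9 * \<nu>1\<^sup>2 * K" by (simp add: A_def power2_eq_square)
        also have "\<dots> \<le> real K1 * real K1" using K1(5) by (simp add: power2_eq_square)
        also have "\<dots> \<le> real k * real k'" using h(7) h'(7) by (intro mult_mono) auto
        finally show ?thesis using A by (simp add: pos_le_divide_eq)
      qed
      have "real k * real k' / (A * A) / 2 \<le> \<bar>\<mu>\<^sup>2 - \<mu>'\<^sup>2\<bar>"
      proof -
        have lin: "q \<le> \<bar>m - n\<bar>" if "2 * q \<le> \<bar>x - x'\<bar>" "2 * K \<le> q" "m \<le> x + K" "x - K \<le> m" "n \<le> x' + K" "x' - K \<le> n"
          for q m n x x' :: real using that by linarith
        define p where "p = real k * real k' / (A * A)"
        show ?thesis using y KA unfolding p_def[symmetric]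
          by (intro lin[OF _ _ freq_square[OF E, folded \<mu>_def] freq_square[OF E', folded \<mu>'_def]]) simp_all
      qed
      also have "\<dots> = \<bar>\<mu> - \<mu>'\<bar> * (\<mu> + \<mu>')"
      proof -
        have "\<mu>\<^sup>2 - \<mu>'\<^sup>2 = (\<mu> - \<mu>') * (\<mu> + \<mu>')" by (simp add: power2_eq_square algebra_simps)
        then show ?thesis by (simp add: abs_mult \<mu>_def \<mu>'_def)
      qed
      also have "\<dots> \<le> \<bar>\<mu> - \<mu>'\<bar> * (21 * c1 * real k)"
      proof (rule mult_left_mono)
        have "3 * c1 * real k' \<le> 3 * c1 * (6 * real k)" using False c1 by (intro mult_left_mono) auto
        then show "\<mu> + \<mu>' \<le> 21 * c1 * real k" using b by linarith
      qed simp
      finally have "real k * (real k' / (A * A) / 2) \<le> real k * (\<bar>\<mu> - \<mu>'\<bar> * (21 * c1))"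
        by (simp add: mult_ac)
      then have "real k' / (A * A) / 2 \<le> \<bar>\<mu> - \<mu>'\<bar> * (21 * c1)" using kpos by (subst (asm) mult_le_cancel_left_pos)
      then have "real k' \<le> \<bar>\<mu> - \<mu>'\<bar> * (42 * A\<^sup>2 * c1)" using A by (simp add: field_simps power2_eq_square)
      then have "3 * c1 * real k' \<le> 3 * c1 * (\<bar>\<mu> - \<mu>'\<bar> * (42 * A\<^sup>2 * c1))" using c1 by (intro mult_left_mono) auto
      then have "\<mu>' \<le> \<bar>\<mu> - \<mu>'\<bar> * (126 * A\<^sup>2 * c1\<^sup>2)" using b(4) by (simp add: power2_eq_square mult_ac)
      then have "1 / (126 * A\<^sup>2 * c1\<^sup>2) * \<mu>' \<le> \<bar>\<mu> - \<mu>'\<bar>" using A c1(1) by (simp add: field_simps)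
      moreover have "\<eta> * \<mu>' \<le> 1 / (126 * A\<^sup>2 * c1\<^sup>2) * \<mu>'" unfolding \<mu>'_def by (intro mult_right_mono) (auto simp: \<eta>_def)
      ultimately show ?thesis unfolding \<mu>_def[symmetric] \<mu>'_def[symmetric] by linarith
    qed
  qed
  then show ?thesis using that \<eta> by blast
qed

end

section \<open>The lacunary part of the series on the right side\<close>

context boundary
begin

definition active :: "nat \<Rightarrow> bool" where "active k \<longleftrightarrow> (\<exists>j. (k, j) \<in> E)"

text \<open>By \<open>E_unique\<close> the choice is determined, and the series can be indexed by
  denominators.\<close>

definition idx :: "nat \<Rightarrow> nat" where "idx k = (SOME j. (k, j) \<in> E)"

lemma idx: "active k \<Longrightarrow> (k, idx k) \<in> E"
  unfolding active_def idx_def by (rule someI_ex)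

lemma idx_eq: "(k, j) \<in> E \<Longrightarrow> idx k = j"
  using E_unique idx active_def by blast

text \<open>Inactive denominators get frequency 0, which respects the bound on the distance from the
  positive axis, and coefficient 0 in \<open>cc\<close>.\<close>

definition bb :: "nat \<Rightarrow> complex" where
  "bb m = (if active (Suc m) then freq (Suc m) (idx (Suc m)) else 0)"

definition cc :: "nat \<Rightarrow> complex" where
  "cc m = (if active (Suc m) then
     - ((1 / of_nat (Suc m)) * (rt (Suc m) (idx (Suc m)) * (gam lam (Suc m) (idx (Suc m)))\<^sup>2)) * z ^ Suc m / 2 else 0)"

lemma cosh_gam: "cosh (\<xi> * gam lam k j) = (exp (freq k j * (\<xi> / e)) + exp (- (freq k j * (\<xi> / e)))) / 2"
proof -
  have "(freq k j)\<^sup>2 = (bet k j)\<^sup>2" by (simp add: freq_def)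
  then have f: "freq k j = bet k j \<or> freq k j = - bet k j" by (simp only: power2_eq_iff)
  have "\<xi> * gam lam k j = bet k j * (\<xi> / e)" using e0 by (simp add: bet_def)
  then have "cosh (\<xi> * gam lam k j) = (exp (bet k j * (\<xi> / e)) + exp (- (bet k j * (\<xi> / e)))) / 2"
    by (simp only: cosh_field_def)
  then show ?thesis using f by (auto simp: add.commute)
qed

text \<open>cosh splits into a growing and a decaying exponential with equal coefficients, hence the
  factor 1/2 in \<open>cc\<close>. The growing one carries the singularities of the right
  side.\<close>

lemma coefG_E:
  "coefG lam E (Suc m) \<xi> * z ^ Suc m = cc m * exp (bb m * (\<xi> / e)) + cc m * exp (- (bb m * (\<xi> / e)))"
proof -
  define k where "k = Suc m"
  show ?thesis
  proof (cases "active k")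
    case True
    define j where "j = idx k"
    have E: "(k, j) \<in> E" using idx[OF True] by (simp add: j_def)
    define g where "g = (\<lambda>j. rt k j * (gam lam k j)\<^sup>2 * cosh (\<xi> * gam lam k j))"
    have "(\<Sum>i<k. if (k, i) \<in> E then g i else 0) = (\<Sum>i\<in>{j}. if (k, i) \<in> E then g i else 0)"
      by (rule sum.mono_neutral_right) (use E_D(1)[OF E] E_unique[OF E] in auto)
    also have "\<dots> = g j" using E by simp
    finally have "coefG lam E k \<xi> * z ^ k = - ((1 / of_nat k) * (rt k j * (gam lam k j)\<^sup>2 * cosh (\<xi> * gam lam k j))) * z ^ k"
      unfolding coefG_def g_def by simp
    also have "\<dots> = (- ((1 / of_nat k) * (rt k j * (gam lam k j)\<^sup>2)) * z ^ k / 2) * exp (freq k j * (\<xi> / e))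
       + (- ((1 / of_nat k) * (rt k j * (gam lam k j)\<^sup>2)) * z ^ k / 2) * exp (- (freq k j * (\<xi> / e)))"
      unfolding cosh_gam by (simp add: algebra_simps add_divide_distrib)
    finally show ?thesis using True unfolding cc_def bb_def j_def k_def by (simp only: if_True)
  next
    case False
    then have "coefG lam E k \<xi> = 0" by (simp add: coefG_def active_def)
    then show ?thesis using False by (simp add: cc_def bb_def k_def)
  qed
qed

lemma bb_near: "norm (bb m - of_real (norm (bb m))) \<le> K"
  using freq_near[OF idx] K(1) by (simp add: bb_def)

definition Lz :: real where "Lz = ln (1 / norm z)"

lemma Lz: "0 < Lz" "norm z ^ k = exp (- (real k * Lz))"
proof -
  have "1 < 1 / norm z" using z by (simp add: field_simps)
  then show "0 < Lz" unfolding Lz_def by (rule ln_gt_zero)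
  have "exp (- Lz) = norm z" using z by (simp add: Lz_def ln_div)
  then show "norm z ^ k = exp (- (real k * Lz))" by (metis exp_of_nat_mult mult_minus_right)
qed

lemma norm_cc: assumes "active (Suc m)"
  shows "norm (cc m) = norm (gam lam (Suc m) (idx (Suc m))) ^ 2 / (2 * real (Suc m)) * exp (- (real (Suc m) * Lz))"
  using assms unfolding cc_def Lz(2)[symmetric]
  by (simp add: norm_mult norm_divide norm_power del: power_Suc of_nat_Suc)

lemma norm_cc_le: "norm (cc m) \<le> D\<^sup>2 * real (Suc m) * exp (- (real (Suc m) * Lz))"
proof (cases "active (Suc m)")
  case True
  have "norm (gam lam (Suc m) (idx (Suc m))) ^ 2 / (2 * real (Suc m)) \<le> (D * real (Suc m)) ^ 2 / (2 * real (Suc m))"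
    using norm_gam_le[of "Suc m"] by (intro divide_right_mono power_mono) auto
  also have "\<dots> = D\<^sup>2 * real (Suc m) / 2" by (simp add: power_mult_distrib power2_eq_square del: of_nat_Suc)
  also have "\<dots> \<le> D\<^sup>2 * real (Suc m)" by simp
  finally show ?thesis unfolding norm_cc[OF True] by (intro mult_right_mono) auto
qed (simp add: cc_def)

lemma Re_bb: "Re (bb m * w) \<le> norm (bb m) * Re w + K * norm w" "norm (bb m) * Re w - K * norm w \<le> Re (bb m * w)"
proof -
  have "Re (bb m * w) = norm (bb m) * Re w + Re ((bb m - of_real (norm (bb m))) * w)"
    by (simp add: algebra_simps)
  moreover have "\<bar>Re ((bb m - of_real (norm (bb m))) * w)\<bar> \<le> K * norm w"
    using abs_Re_le_cmod[of "(bb m - of_real (norm (bb m))) * w"] mult_right_mono[OF bb_near[of m], of "norm w"]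
    by (simp add: norm_mult)
  ultimately show "Re (bb m * w) \<le> norm (bb m) * Re w + K * norm w" "norm (bb m) * Re w - K * norm w \<le> Re (bb m * w)"
    by linarith+
qed

text \<open>Convergence with arbitrarily small extra decay up to and including the side: this is the
  summability hypothesis of \<open>lacunary\<close> once the origin is moved to a point of the
  side.\<close>

lemma lacunary_summable:
  assumes w: "Re w \<le> sqrt \<nu>1 * Lz" and \<sigma>: "0 < \<sigma>"
  shows "summable (\<lambda>m. norm (cc m * exp (bb m * w)) * exp (- \<sigma> * norm (bb m)))"
proof -
  define \<kappa> where "\<kappa> = sqrt \<nu>1"
  have \<kappa>: "0 < \<kappa>" "\<kappa>\<^sup>2 = \<nu>1" using \<nu> by (auto simp: \<kappa>_def)
  \<comment> \<open>\<open>q\<close> lies below sqrt \<nu>1, so that the Lagrange bound holds for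
    its square, yet so close to it that the loss (\<kappa> - q) Lz is at most \<sigma> / 2. The
    other half of \<sigma> yields the ratio \<theta>.\<close>
  define q where "q = max (\<kappa> / 2) (\<kappa> - \<sigma> / (2 * Lz))"
  have q: "0 < q" "q < \<kappa>" "(\<kappa> - q) * Lz \<le> \<sigma> / 2"
  proof -
    show "0 < q" "q < \<kappa>" using \<kappa> \<sigma> Lz(1) by (auto simp: q_def)
    have "(\<kappa> - q) * Lz \<le> (\<sigma> / (2 * Lz)) * Lz" using Lz(1) by (intro mult_right_mono) (auto simp: q_def)
    then show "(\<kappa> - q) * Lz \<le> \<sigma> / 2" using Lz(1) by simp
  qed
  have "q\<^sup>2 < \<nu>1" unfolding \<kappa>(2)[symmetric] using q by (intro power_strict_mono) auto
  then obtain Kq where Kq: "\<And>k N. Kq \<le> k \<Longrightarrow> 0 < s * (of_int N / real k - \<alpha>) \<Longrightarrow> q\<^sup>2 \<le> (real k)\<^sup>2 * (s * (of_int N / real k - \<alpha>))"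
    using lag1 unfolding lagrange_def by meson
  define \<theta> where "\<theta> = exp (- (\<sigma> / 2 * c1))"
  have \<theta>: "0 < \<theta>" "\<theta> < 1" using \<sigma> c1(1) by (auto simp: \<theta>_def)
  define C where "C = D\<^sup>2 * exp (K * norm w + q * sqrt K * Lz)"
  have C: "0 \<le> C" by (simp add: C_def)
  have main: "norm (cc m * exp (bb m * w)) * exp (- \<sigma> * norm (bb m)) \<le> C * (real (Suc m) ^ 1 * \<theta> ^ Suc m)"
    if m: "Kq \<le> m" for m
  proof (cases "active (Suc m)")
    case True
    define k where "k = Suc m"
    define \<mu> where "\<mu> = norm (bb m)"
    have E: "(k, idx k) \<in> E" using idx[OF True] by (simp add: k_def)
    note h = E_D[OF E]
    have \<mu>: "\<mu> = norm (freq k (idx k))" using True by (simp add: \<mu>_def bb_def k_def)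
    have "q\<^sup>2 \<le> (real k)\<^sup>2 * X k (idx k)" using Kq[of k "int (idx k)"] m h(4) by (simp add: X_def k_def)
    then have "1 / X k (idx k) \<le> (real k / q)\<^sup>2" using h(4) q(1) by (simp add: field_simps)
    then have "\<mu>\<^sup>2 \<le> (real k / q)\<^sup>2 + K" using freq_square(1)[OF E] unfolding \<mu> by linarith
    also have "\<dots> \<le> (real k / q + sqrt K)\<^sup>2" using K(1) q(1) by (simp add: power2_sum)
    finally have "\<mu> \<le> real k / q + sqrt K" by (rule power2_le_imp_le) (use q K(1) in auto)
    then have "q * \<mu> \<le> q * (real k / q + sqrt K)" using q by (intro mult_left_mono) auto
    also have "\<dots> = real k + q * sqrt K" using q by (simp add: distrib_left)
    finally have "(q * \<mu>) * Lz \<le> (real k + q * sqrt K) * Lz" using Lz(1) by (intro mult_right_mono) auto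
    moreover have "\<mu> * Re w \<le> \<mu> * (\<kappa> * Lz)" using w by (intro mult_left_mono) (auto simp: \<mu>_def \<kappa>_def)
    moreover have "\<mu> * ((\<kappa> - q) * Lz) \<le> \<mu> * (\<sigma> / 2)" using q(3) by (intro mult_left_mono) (auto simp: \<mu>_def)
    moreover have "\<sigma> / 2 * (c1 * real k) \<le> \<sigma> / 2 * \<mu>" using freq_bounds(1)[OF E] \<sigma> unfolding \<mu> by (intro mult_left_mono) auto
    ultimately have ex: "- (real k * Lz) + (\<mu> * Re w + K * norm w) + - \<sigma> * \<mu> \<le> (K * norm w + q * sqrt K * Lz) + real k * (- (\<sigma> / 2 * c1))"
      by (simp add: algebra_simps)
    have "norm (cc m * exp (bb m * w)) * exp (- \<sigma> * norm (bb m))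
       \<le> (D\<^sup>2 * real k * exp (- (real k * Lz))) * exp (\<mu> * Re w + K * norm w) * exp (- \<sigma> * \<mu>)"
      using norm_cc_le[of m] Re_bb(1)[of m w] unfolding norm_mult norm_exp_eq_Re \<mu>_def k_def
      by (intro mult_right_mono mult_mono) auto
    also have "\<dots> = D\<^sup>2 * real k * exp (- (real k * Lz) + (\<mu> * Re w + K * norm w) + - \<sigma> * \<mu>)"
      by (simp only: exp_add mult_ac)
    also have "\<dots> \<le> D\<^sup>2 * real k * exp ((K * norm w + q * sqrt K * Lz) + real k * (- (\<sigma> / 2 * c1)))"
      using ex by (intro mult_left_mono) auto
    also have "\<dots> = C * (real k ^ 1 * \<theta> ^ k)" unfolding C_def \<theta>_def by (simp only: exp_add exp_of_nat_mult power_one_right mult_ac)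
    finally show ?thesis by (simp only: k_def)
  qed (use C \<theta> in \<open>simp add: cc_def\<close>)
  show ?thesis
    by (rule summable_comparison_test'[OF summable_mult[OF summable_poly_geometric[OF \<theta>, of 1], of C], of Kq]) (use main in auto)
qed

text \<open>Removing \<open>E\<close> raises the constant of the right side from \<nu>1 to 3 \<nu>1
  / 2, so the remaining series converges across that side, with a surplus factor sqrt (3/2).\<close>

lemma sparse_complement:
  assumes "0 < m2" "m2 < sqrt \<nu>2"
  shows "sparse_set (- E) (sqrt (3 * \<nu>1 / 2)) m2"
proof -
  have "m2\<^sup>2 < \<nu>2" using real_sqrt_less_iff[of "m2\<^sup>2" \<nu>2] assms by auto
  then obtain K2 where K2: "\<And>k N. K2 \<le> k \<Longrightarrow> 0 < (- s) * (of_int N / real k - \<alpha>) \<Longrightarrow> m2\<^sup>2 \<le> (real k)\<^sup>2 * ((- s) * (of_int N / real k - \<alpha>))"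
    using lag2 unfolding lagrange_def by meson
  show ?thesis unfolding sparse_set_def
  proof (intro conjI assms exI[of _ "max K1 K2"] allI impI)
    fix k j assume k: "max K1 K2 \<le> k" "j < k" "(k, j) \<in> - E"
    show "(sqrt (3 * \<nu>1 / 2))\<^sup>2 \<le> (real k)\<^sup>2 * X k j" if "0 < X k j" using k that \<nu> by (auto simp: E_def)
    show "m2\<^sup>2 \<le> (real k)\<^sup>2 * - X k j" if "X k j < 0" using K2[of k "int j"] k that by (simp add: X_def)
  qed (use \<nu> in simp)
qed

lemma coefG_split: "coefG lam UNIV k \<xi> = coefG lam (- E) k \<xi> + coefG lam E k \<xi>"
proof -
  have "(\<Sum>j<k. if (k, j) \<in> UNIV then f j else 0) = (\<Sum>j<k. if (k, j) \<in> - E then f j else 0) + (\<Sum>j<k. if (k, j) \<in> E then f j else 0)"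
    for f :: "nat \<Rightarrow> complex"
    unfolding sum.distrib[symmetric] by (rule sum.cong) auto
  from this[of "\<lambda>j. rt k j * (gam lam k j)\<^sup>2 * cosh (\<xi> * gam lam k j)"]
  show ?thesis unfolding coefG_def by (simp only: distrib_left minus_add_distrib)
qed

text \<open>Fractions with k^2 X < q^2, for q slightly above \<kappa>, occur with arbitrarily large
  k. Their frequencies \<mu> are at least k / q up to a constant, so on the side their terms lose no
  more than exp (- (q - \<kappa>) Lz \<mu>) and a factor of order 1 / k, less than the assumed
  decay.\<close>

lemma lacunary_large:
  assumes wp: "Re wp = sqrt \<nu>1 * Lz" and C: "0 < C" "0 < c'"
    and le: "\<And>m. norm (cc m * exp (bb m * wp)) \<le> C * exp (- c' * norm (bb m))"
  shows False
proof -
  define \<kappa> where "\<kappa> = sqrt \<nu>1"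
  have \<kappa>: "0 < \<kappa>" "\<kappa>\<^sup>2 = \<nu>1" using \<nu> by (auto simp: \<kappa>_def)
  \<comment> \<open>Close enough to \<kappa> for the loss to be at most c' / 2, and at most sqrt (3
    \<nu>1 / 2) so that the fractions belong to \<open>E\<close>.\<close>
  define q where "q = min (\<kappa> + c' / (2 * Lz)) (sqrt (3 * \<nu>1 / 2))"
  have q: "0 < q" "\<kappa> < q" "q\<^sup>2 \<le> 3 * \<nu>1 / 2" "(q - \<kappa>) * Lz \<le> c' / 2"
  proof -
    show "\<kappa> < q" using \<kappa> C(2) Lz(1) \<nu> by (auto simp: q_def \<kappa>_def)
    then show "0 < q" using \<kappa> by simp
    then have "q\<^sup>2 \<le> (sqrt (3 * \<nu>1 / 2))\<^sup>2" by (intro power_mono) (auto simp: q_def)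
    then show "q\<^sup>2 \<le> 3 * \<nu>1 / 2" using \<nu> by simp
    have "(q - \<kappa>) * Lz \<le> (c' / (2 * Lz)) * Lz" using Lz(1) by (intro mult_right_mono) (auto simp: q_def)
    then show "(q - \<kappa>) * Lz \<le> c' / 2" using Lz(1) by simp
  qed
  have "\<nu>1 < q\<^sup>2" unfolding \<kappa>(2)[symmetric] using q \<kappa> by (intro power_strict_mono) auto
  define P where "P = ln C + K * norm wp + q * sqrt K * Lz"
  have "\<forall>\<^sub>F k::nat in at_top. P + ln (4 * real k) < c' / 2 * c1 * real k"
    using C(2) c1(1) by real_asymp
  \<comment> \<open>For such k the fraction lies strictly between 0 and 1, so its numerator is an
    admissible index j.\<close>
  moreover have "\<forall>\<^sub>F k::nat in at_top. q\<^sup>2 < (real k)\<^sup>2 * min \<alpha> (1 - \<alpha>)"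
    using \<alpha> by real_asymp
  ultimately have "\<forall>\<^sub>F k::nat in at_top. P + ln (4 * real k) < c' / 2 * c1 * real k \<and> q\<^sup>2 < (real k)\<^sup>2 * min \<alpha> (1 - \<alpha>)"
    by (rule eventually_conj)
  then obtain k0 where k0: "\<And>k. k0 \<le> k \<Longrightarrow> P + ln (4 * real k) < c' / 2 * c1 * real k \<and> q\<^sup>2 < (real k)\<^sup>2 * min \<alpha> (1 - \<alpha>)"
    unfolding eventually_at_top_linorder by blast
  obtain k and N :: int where k: "max k0 K1 \<le> k" "1 \<le> k" "0 < s * (N / real k - \<alpha>)" "(real k)\<^sup>2 * (s * (N / real k - \<alpha>)) < q\<^sup>2"
    using lag1 \<open>\<nu>1 < q\<^sup>2\<close> unfolding lagrange_def by meson
  define x where "x = N / real k - \<alpha>"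
  have sx: "s * x = \<bar>x\<bar>" using k(3) s_cases(1) unfolding x_def[symmetric] by auto
  have "(real k)\<^sup>2 * \<bar>x\<bar> < (real k)\<^sup>2 * min \<alpha> (1 - \<alpha>)"
    using k(4) k0[of k] k(1) unfolding x_def[symmetric] sx by auto
  then have xs: "\<bar>x\<bar> < \<alpha>" "\<bar>x\<bar> < 1 - \<alpha>" using k(2) by (auto simp: mult_less_cancel_left)
  then have "0 < N / real k" "N / real k < 1" by (auto simp: x_def)
  then have N: "0 < N" "N < int k" using k(2) by (auto simp: zero_less_divide_iff field_simps)
  define j where "j = nat N"
  have j: "real j = of_int N" "j < k" using N by (auto simp: j_def)
  have X: "X k j = s * (N / real k - \<alpha>)" by (simp add: X_def j)
  have E: "(k, j) \<in> E" unfolding E_def using j(2) k q(3) by (simp add: X[symmetric])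
  note h = E_D[OF E]
  define m where "m = k - 1"
  have m: "Suc m = k" using k(2) by (simp add: m_def)
  have act: "active (Suc m)" unfolding m active_def using E by blast
  have ij: "idx (Suc m) = j" unfolding m by (rule idx_eq[OF E])
  define \<mu> where "\<mu> = norm (bb m)"
  have \<mu>: "\<mu> = norm (freq k j)" using act ij unfolding \<mu>_def bb_def m by simp
  have "1 / norm (rt k j - lam) \<ge> 1 / 2"
  proof -
    have "norm (rt k j - lam) \<le> 2" using norm_triangle_ineq4[of "rt k j" lam] lam1 by simp
    moreover have "0 < norm (rt k j - lam)"
      using rt_gap[OF bad k(2), of j] c k(2) by (smt (verit, best) divide_pos_pos lam of_nat_0_less_iff zero_less_power less_le_trans zero_less_one)
    ultimately show ?thesis by (intro divide_left_mono) auto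
  qed
  then have g: "1 / 2 \<le> norm (gam lam k j) ^ 2" by (simp add: gam_square norm_divide flip: norm_power)
  have low: "1 / (4 * real k) * exp (- (real k * Lz) + (\<mu> * (\<kappa> * Lz) - K * norm wp)) \<le> norm (cc m * exp (bb m * wp))"
  proof -
    have "1 / (4 * real k) \<le> norm (gam lam k j) ^ 2 / (2 * real k)" using g k(2) by (simp add: field_simps)
    moreover have "\<mu> * (\<kappa> * Lz) - K * norm wp \<le> Re (bb m * wp)" using Re_bb(2)[of m wp] unfolding wp \<mu>_def \<kappa>_def .
    ultimately have "1 / (4 * real k) * exp (- (real k * Lz)) * exp (\<mu> * (\<kappa> * Lz) - K * norm wp)
      \<le> norm (gam lam k j) ^ 2 / (2 * real k) * exp (- (real k * Lz)) * exp (Re (bb m * wp))"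
      by (intro mult_mono mult_right_mono) auto
    also have "\<dots> = norm (cc m * exp (bb m * wp))" unfolding norm_mult norm_exp_eq_Re norm_cc[OF act] m ij[unfolded m] ..
    finally show ?thesis by (simp only: exp_add mult.assoc)
  qed
  also have "\<dots> \<le> C * exp (- c' * \<mu>)" using le[of m] by (simp only: \<mu>_def)
  finally have "ln (1 / (4 * real k) * exp (- (real k * Lz) + (\<mu> * (\<kappa> * Lz) - K * norm wp))) \<le> ln (C * exp (- c' * \<mu>))"
    using k(2) C(1) by (intro ln_mono) auto
  then have 1: "- ln (4 * real k) + (- (real k * Lz) + (\<mu> * (\<kappa> * Lz) - K * norm wp)) \<le> ln C - c' * \<mu>"
    using k(2) C(1) by (simp add: ln_mult ln_div)
  have "1 / X k j \<ge> (real k / q)\<^sup>2" using k(4) h(4) q(1) unfolding X[symmetric] by (simp add: field_simps)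
  then have "(real k / q)\<^sup>2 \<le> \<mu>\<^sup>2 + K" using freq_square(2)[OF E] unfolding \<mu> by linarith
  also have "\<dots> \<le> (\<mu> + sqrt K)\<^sup>2" using K(1) by (simp add: power2_sum \<mu>_def)
  finally have "real k / q \<le> \<mu> + sqrt K" by (rule power2_le_imp_le) (use K(1) in \<open>auto simp: \<mu>_def\<close>)
  then have "real k \<le> q * \<mu> + q * sqrt K" using q(1) by (simp add: field_simps)
  then have 2: "real k * Lz \<le> (q * \<mu> + q * sqrt K) * Lz" using Lz(1) by (intro mult_right_mono) auto
  have 3: "\<mu> * ((q - \<kappa>) * Lz) \<le> \<mu> * (c' / 2)" using q(4) by (intro mult_left_mono) (auto simp: \<mu>_def)
  have 4: "c' / 2 * (c1 * real k) \<le> c' / 2 * \<mu>" using freq_bounds(1)[OF E] C unfolding \<mu> by (intro mult_left_mono) auto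
  have "c' / 2 * (c1 * real k) \<le> P + ln (4 * real k)"
    using 1 2 3 4 unfolding P_def by (simp add: algebra_simps)
  then show False using k0[of k] k(1) by (simp add: mult.assoc)
qed

end

section \<open>The natural boundary\<close>

text \<open>Near the open side the terms off \<open>E\<close> and the decaying exponentials have
  sums that are holomorphic across it. Subtracting them, a continuation of the whole would continue
  the growing exponentials, against \<open>gap\<close> and \<open>lacunary_large\<close>.\<close>

lemma (in boundary) no_continuation:
  assumes wp: "Re wp = sqrt \<nu>1 * Lz" "\<bar>Im wp\<bar> < sqrt \<nu>2 * Lz"
    and \<rho>: "0 < \<rho>" and hol: "g holomorphic_on ball (e * wp) \<rho>"
    and agree: "\<And>\<xi>. \<xi> \<in> ball (e * wp) \<rho> \<Longrightarrow> \<bar>Re (\<xi> / e)\<bar> < sqrt \<nu>1 * Lz \<Longrightarrow> \<bar>Im (\<xi> / e)\<bar> < sqrt \<nu>2 * Lz \<Longrightarrow>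
      g \<xi> = GT lam UNIV (\<xi>, z)"
  shows False
proof -
  define \<kappa> \<kappa>' where "\<kappa> = sqrt \<nu>1" and "\<kappa>' = sqrt \<nu>2"
  have \<kappa>: "0 < \<kappa>" "0 < \<kappa>'" using \<nu> by (auto simp: \<kappa>_def \<kappa>'_def)
  \<comment> \<open>\<open>wp\<close> must lie in the rectangle for the complement of
    \<open>E\<close> at L = t Lz with t < 1, since |z| < exp (-L') is required. The first bound
    draws on the surplus sqrt (3/2) in the real direction, the second on the strict inequality for
    Im wp.\<close>
  define q where "q = max (1 / sqrt (3/2)) (sqrt (\<bar>Im wp\<bar> / (\<kappa>' * Lz)))"
  define t where "t = (1 + q) / 2"
  have q: "0 < q" "q < 1"
  proof -
    have "(1::real) < sqrt (3/2)" by simp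
    moreover have "\<bar>Im wp\<bar> / (\<kappa>' * Lz) < 1" using wp(2) \<kappa> Lz(1) by (simp add: \<kappa>'_def)
    ultimately show "0 < q" "q < 1" by (auto simp: q_def less_max_iff_disj)
  qed
  have t: "0 < t" "t < 1" "q < t" using q by (auto simp: t_def)
  have t1: "1 < sqrt (3/2) * t"
  proof -
    have "1 / sqrt (3/2) < t" using t(3) by (simp add: q_def)
    then show ?thesis by (simp add: field_simps)
  qed
  have t2: "\<bar>Im wp\<bar> < (t * \<kappa>') * (t * Lz)"
  proof -
    have "sqrt (\<bar>Im wp\<bar> / (\<kappa>' * Lz)) < t" using t(3) by (simp add: q_def)
    then have "(sqrt (\<bar>Im wp\<bar> / (\<kappa>' * Lz)))\<^sup>2 < t\<^sup>2" using \<kappa> Lz(1) by (intro power_strict_mono) auto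
    then have "\<bar>Im wp\<bar> / (\<kappa>' * Lz) < t\<^sup>2" using \<kappa> Lz(1) by simp
    then have "\<bar>Im wp\<bar> < t\<^sup>2 * (\<kappa>' * Lz)" using \<kappa> Lz(1) by (simp add: pos_divide_less_eq)
    then show ?thesis by (simp add: power2_eq_square mult_ac)
  qed
  define m1 m2 L L' where "m1 = sqrt (3 * \<nu>1 / 2)" and "m2 = t * \<kappa>'" and "L = t * Lz" and "L' = (1 + t) / 2 * Lz"
  have sp: "sparse_set (- E) m1 m2"
    unfolding m1_def m2_def by (rule sparse_complement) (use t \<kappa> in \<open>auto simp: \<kappa>'_def\<close>)
  have L: "0 \<le> L" "L < L'" using t Lz(1) by (auto simp: L_def L'_def)
  have zL: "norm z < exp (- L')"
  proof -
    have "norm z = exp (- Lz)" using Lz(2)[of 1] by simp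
    moreover have "L' < 1 * Lz" unfolding L'_def using t Lz(1) by (intro mult_strict_right_mono) auto
    ultimately show ?thesis by simp
  qed
  have re: "Re wp < m1 * L"
  proof -
    have "m1 = sqrt (3/2) * \<kappa>" unfolding m1_def \<kappa>_def real_sqrt_mult[symmetric] by (simp add: field_simps)
    then have "m1 * L = (sqrt (3/2) * t) * (\<kappa> * Lz)" by (simp add: L_def)
    moreover have "1 * (\<kappa> * Lz) < (sqrt (3/2) * t) * (\<kappa> * Lz)" using t1 \<kappa> Lz(1) by (intro mult_strict_right_mono) auto
    ultimately show ?thesis using wp(1) by (simp add: \<kappa>_def)
  qed
  have Rp: "0 < Re wp" using wp(1) \<kappa> Lz(1) by (simp add: \<kappa>_def)
  define \<Omega> where "\<Omega> = {x. 0 < Re (wp + x) \<and> Re (wp + x) < m1 * L \<and> \<bar>Im (wp + x)\<bar> < m2 * L \<and> \<bar>Im (wp + x)\<bar> < \<kappa>' * Lz}"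
  have "open \<Omega>" unfolding \<Omega>_def by (intro open_Collect_conj open_Collect_less continuous_intros)
  moreover have "0 \<in> \<Omega>" using Rp re t2 wp(2) by (simp add: \<Omega>_def m2_def L_def \<kappa>'_def)
  ultimately obtain \<rho>1 where \<rho>1: "0 < \<rho>1" "ball 0 \<rho>1 \<subseteq> \<Omega>" by (meson open_contains_ball)
  define \<rho>2 where "\<rho>2 = min \<rho>1 (\<rho> / norm e)"
  have \<rho>2: "0 < \<rho>2" using \<rho>1 \<rho> e0 by (simp add: \<rho>2_def)
  have in\<Omega>: "x \<in> \<Omega>" "e * (wp + x) \<in> ball (e * wp) \<rho>" if "x \<in> ball 0 \<rho>2" for x
  proof -
    show "x \<in> \<Omega>" using that \<rho>1(2) by (auto simp: \<rho>2_def)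
    have "norm e * norm x < norm e * (\<rho> / norm e)" using that e0 by (intro mult_strict_left_mono) (auto simp: \<rho>2_def)
    then show "e * (wp + x) \<in> ball (e * wp) \<rho>" using e0 by (simp add: dist_norm algebra_simps norm_mult)
  qed
  have quot: "e * (wp + x) / e = wp + x" for x using e0 by simp
  define R where "R = (\<lambda>x. GT lam (- E) (e * (wp + x), z))"
  have Rloc: "(\<lambda>m. coefG lam (- E) (Suc m) (e * (wp + x)) * z ^ Suc m) sums R x" "R field_differentiable (at x)"
    if "x \<in> ball 0 \<rho>2" for x
  proof -
    have b: "\<bar>Re (e * (wp + x) / e)\<bar> < m1 * L" "\<bar>Im (e * (wp + x) / e)\<bar> < m2 * L"
      unfolding quot using in\<Omega>(1)[OF that] by (auto simp: \<Omega>_def)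
    note loc = GT_local[OF sp L zL b]
    show "(\<lambda>m. coefG lam (- E) (Suc m) (e * (wp + x)) * z ^ Suc m) sums R x" unfolding R_def by (rule loc(1))
    obtain a b where d: "(GT lam (- E) has_derivative (\<lambda>(h, k). a * h + b * k)) (at (e * (wp + x), z))" using loc(2) by blast
    have "((\<lambda>x. (e * (wp + x), z)) has_derivative (\<lambda>h. (e * h, 0))) (at x)"
      by (auto intro!: derivative_eq_intros)
    from has_derivative_compose[OF this d] have "(R has_derivative (\<lambda>h. (a * e) * h)) (at x)"
      by (simp add: R_def mult.assoc)
    then show "R field_differentiable (at x)" by (auto simp: field_differentiable_def has_field_derivative_def)
  qed
  then have Rhol: "R holomorphic_on ball 0 \<rho>2"
    unfolding holomorphic_on_def by (blast intro: field_differentiable_at_within)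
  \<comment> \<open>The growing exponentials with the origin moved to \<open>wp\<close>;
    \<open>N\<close> below holds the decaying ones, to be evaluated at - (wp + x).\<close>
  interpret P: lacunary "\<lambda>m. cc m * exp (bb m * wp)" bb K
  proof
    show "summable (\<lambda>k. norm (cc k * exp (bb k * wp)) * exp (- \<sigma> * norm (bb k)))" if "0 < \<sigma>" for \<sigma>
      by (rule lacunary_summable[OF _ that]) (simp add: wp)
  qed (rule bb_near)
  interpret N: lacunary cc bb K
  proof
    show "summable (\<lambda>k. norm (cc k) * exp (- \<sigma> * norm (bb k)))" if "0 < \<sigma>" for \<sigma>
      using lacunary_summable[OF _ that, of 0] \<nu> Lz(1) by simp
  qed (rule bb_near)
  define g1 where "g1 = (\<lambda>x. g (e * (wp + x)) - R x - N.H 0 (- (wp + x)))"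
  have ghol: "(\<lambda>x. g (e * (wp + x))) holomorphic_on ball 0 \<rho>2"
    by (rule holomorphic_on_compose_gen[of "\<lambda>x. e * (wp + x)" _ g, unfolded o_def, OF _ hol])
       (use in\<Omega>(2) in \<open>auto intro!: holomorphic_intros\<close>)
  have Nneg: "- (wp + x) \<in> {s. Re s < 0}" if "x \<in> ball 0 \<rho>2" for x
    using in\<Omega>(1)[OF that] by (simp add: \<Omega>_def)
  have Nhol: "(\<lambda>x. N.H 0 (- (wp + x))) holomorphic_on ball 0 \<rho>2"
  proof (rule holomorphic_on_compose_gen[of "\<lambda>x. - (wp + x)" _ "N.H 0", unfolded o_def, OF _ N.H_holomorphic])
    show "(\<lambda>x. - (wp + x)) holomorphic_on ball 0 \<rho>2" by (intro holomorphic_intros)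
    show "(\<lambda>x. - (wp + x)) ` ball 0 \<rho>2 \<subseteq> {s. Re s < 0}" using Nneg by blast
  qed
  have g1hol: "g1 holomorphic_on ball 0 \<rho>2" unfolding g1_def by (intro holomorphic_on_diff ghol Rhol Nhol)
  have g1: "g1 x = P.H 0 x" if x: "x \<in> ball 0 \<rho>2" "Re x < 0" for x
  proof -
    note o = in\<Omega>(1)[OF x(1)]
    have "Re (- (wp + x)) < 0" using o by (simp add: \<Omega>_def)
    from sums_add[OF Rloc(1)[OF x(1)] sums_add[OF P.H_deriv(1)[OF x(2), of 0] N.H_deriv(1)[OF this, of 0]]]
    have "(\<lambda>m. coefG lam (- E) (Suc m) (e * (wp + x)) * z ^ Suc m +
       (cc m * exp (bb m * wp) * bb m ^ 0 * exp (bb m * x) + cc m * bb m ^ 0 * exp (bb m * - (wp + x))))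
       sums (R x + (P.H 0 x + N.H 0 (- (wp + x))))" .
    also have "(\<lambda>m. coefG lam (- E) (Suc m) (e * (wp + x)) * z ^ Suc m +
       (cc m * exp (bb m * wp) * bb m ^ 0 * exp (bb m * x) + cc m * bb m ^ 0 * exp (bb m * - (wp + x))))
       = (\<lambda>m. coefG lam UNIV (Suc m) (e * (wp + x)) * z ^ Suc m)"
    proof
      fix m
      have "coefG lam E (Suc m) (e * (wp + x)) * z ^ Suc m = cc m * exp (bb m * (wp + x)) + cc m * exp (- (bb m * (wp + x)))"
        unfolding coefG_E quot ..
      moreover have "exp (bb m * (wp + x)) = exp (bb m * wp) * exp (bb m * x)" by (simp only: distrib_left exp_add)
      moreover have "exp (- (bb m * (wp + x))) = exp (bb m * - (wp + x))" by (simp only: mult_minus_right)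
      ultimately show "coefG lam (- E) (Suc m) (e * (wp + x)) * z ^ Suc m +
       (cc m * exp (bb m * wp) * bb m ^ 0 * exp (bb m * x) + cc m * bb m ^ 0 * exp (bb m * - (wp + x)))
       = coefG lam UNIV (Suc m) (e * (wp + x)) * z ^ Suc m"
        by (simp only: coefG_split[of "Suc m"] distrib_right power_0 mult_1_right mult.assoc)
    qed
    finally have "GT lam UNIV (e * (wp + x), z) = R x + (P.H 0 x + N.H 0 (- (wp + x)))"
      by (simp add: GT_def sums_iff)
    moreover have "g (e * (wp + x)) = GT lam UNIV (e * (wp + x), z)"
    proof (rule agree[OF in\<Omega>(2)[OF x(1)]])
      show "\<bar>Re (e * (wp + x) / e)\<bar> < sqrt \<nu>1 * Lz" "\<bar>Im (e * (wp + x) / e)\<bar> < sqrt \<nu>2 * Lz"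
        unfolding quot using o x(2) wp(1) by (auto simp: \<Omega>_def \<kappa>'_def)
    qed
    ultimately show ?thesis by (simp add: g1_def)
  qed
  obtain \<eta> where \<eta>: "0 < \<eta>" "\<And>k j k' j'. (k, j) \<in> E \<Longrightarrow> (k', j') \<in> E \<Longrightarrow> k \<noteq> k' \<Longrightarrow>
     \<eta> * norm (freq k' j') \<le> \<bar>norm (freq k j) - norm (freq k' j')\<bar>"
    by (rule freq_gap) (rule that)
  have sep: "\<eta> * norm (bb k) \<le> \<bar>norm (bb i) - norm (bb k)\<bar>"
    if "cc i * exp (bb i * wp) \<noteq> 0" "cc k * exp (bb k * wp) \<noteq> 0" "i \<noteq> k" for i k
  proof -
    have act: "active (Suc i)" "active (Suc k)" using that by (auto simp: cc_def split: if_splits)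
    show ?thesis using \<eta>(2)[OF idx[OF act(1)] idx[OF act(2)]] that(3) act by (simp add: bb_def)
  qed
  obtain C c' where "0 < c'" "0 < C" "\<And>k. norm (cc k * exp (bb k * wp)) \<le> C * exp (- c' * norm (bb k))"
    by (rule P.gap[OF \<rho>2 g1hol g1 \<eta>(1) sep]) (assumption+, rule that)
  then show False using lacunary_large[OF wp(1)] by blast
qed

text \<open>Corners are included: a continuation about a corner is also one about nearby points of
  the open side, to which \<open>no_continuation\<close> applies.\<close>

lemma (in rotated) side_no_continuation:
  assumes z: "z \<noteq> 0" "norm z < 1"
    and lag: "lagrange \<alpha> s \<nu>1" "lagrange \<alpha> (- s) \<nu>2"
    and p: "Re (p / e) = sqrt \<nu>1 * ln (1 / norm z)" "\<bar>Im (p / e)\<bar> \<le> sqrt \<nu>2 * ln (1 / norm z)"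
    and \<rho>: "0 < \<rho>" and hol: "g holomorphic_on ball p \<rho>"
    and agree: "\<And>\<xi>. \<xi> \<in> ball p \<rho> \<Longrightarrow> \<bar>Re (\<xi> / e)\<bar> < sqrt \<nu>1 * ln (1 / norm z) \<Longrightarrow>
      \<bar>Im (\<xi> / e)\<bar> < sqrt \<nu>2 * ln (1 / norm z) \<Longrightarrow> g \<xi> = GT lam UNIV (\<xi>, z)"
  shows False
proof -
  have \<nu>: "0 < \<nu>1" "0 < \<nu>2" using lag by (auto simp: lagrange_def)
  obtain K where K: "0 < K" "\<And>k j. 1 \<le> k \<Longrightarrow> j < k \<Longrightarrow> norm ((bet k j)\<^sup>2 - of_real (1 / X k j)) \<le> K"
    by (rule bet_square_approx) (rule that)
  have "\<nu>1 / 2 < \<nu>1" using \<nu> by simp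
  then obtain K0 where K0: "\<And>k N. K0 \<le> k \<Longrightarrow> 0 < s * (of_int N / real k - \<alpha>) \<Longrightarrow> \<nu>1 / 2 \<le> (real k)\<^sup>2 * (s * (of_int N / real k - \<alpha>))"
    using lag(1) unfolding lagrange_def by meson
  define Ka where "Ka = Suc K0"
  have "\<forall>\<^sub>F n::nat in at_top. 3 * \<nu>1 / 2 < real n \<and> 3 * \<nu>1 / 2 * (real Ka)\<^sup>2 \<le> c * (real n)\<^sup>2 \<and>
      3 * \<nu>1 * (K + 1) \<le> (real n)\<^sup>2 \<and> 9 * \<nu>1\<^sup>2 * K \<le> (real n)\<^sup>2"
    using c by (intro eventually_conj; real_asymp)
  then obtain n0 where n0: "\<And>n. n0 \<le> n \<Longrightarrow> 3 * \<nu>1 / 2 < real n \<and> 3 * \<nu>1 / 2 * (real Ka)\<^sup>2 \<le> c * (real n)\<^sup>2 \<and>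
      3 * \<nu>1 * (K + 1) \<le> (real n)\<^sup>2 \<and> 9 * \<nu>1\<^sup>2 * K \<le> (real n)\<^sup>2"
    unfolding eventually_at_top_linorder by blast
  interpret boundary c \<alpha> lam e s z \<nu>1 \<nu>2 K Ka "max Ka n0"
  proof
    show "\<nu>1 / 2 \<le> (real k)\<^sup>2 * (s * (of_int N / real k - \<alpha>))" if "Ka \<le> k" "0 < s * (of_int N / real k - \<alpha>)" for k N
      by (rule K0) (use that in \<open>auto simp: Ka_def\<close>)
  qed (use z lag K n0[of "max Ka n0"] in \<open>auto simp: Ka_def\<close>)
  define y where "y = Im (p / e)"
  \<comment> \<open>Slides the point along the side towards its middle by at most \<rho> / 2, enough
    to leave a corner; the summand 1 prevents a division by 0.\<close>
  define u where "u = min 1 (\<rho> / (2 * norm e * (\<bar>y\<bar> + 1)))"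
  have pos: "0 < 2 * norm e * (\<bar>y\<bar> + 1)" using e0 by (intro mult_pos_pos) auto
  have u: "0 < u" "u \<le> 1" using \<rho> pos by (auto simp: u_def)
  define wp where "wp = Complex (Re (p / e)) ((1 - u) * y)"
  have "p / e - wp = Complex 0 (u * y)" by (simp add: wp_def y_def complex_eq_iff algebra_simps)
  then have "norm (p / e - wp) = u * \<bar>y\<bar>" using u by (simp add: cmod_def abs_mult)
  moreover have "p - e * wp = e * (p / e - wp)" using e0 by (simp add: algebra_simps)
  ultimately have "dist p (e * wp) = norm e * (u * \<bar>y\<bar>)" by (simp add: dist_norm norm_mult)
  also have "\<dots> \<le> norm e * (\<rho> / (2 * norm e * (\<bar>y\<bar> + 1)) * (\<bar>y\<bar> + 1))"
    using u \<rho> pos by (intro mult_left_mono mult_mono) (auto simp: u_def)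
  also have "\<dots> = \<rho> / 2" using e0 pos by (simp add: field_simps add_nonneg_eq_0_iff)
  finally have sub: "ball (e * wp) (\<rho> / 2) \<subseteq> ball p \<rho>"
    by (auto simp: subset_eq dist_commute intro: le_less_trans[OF dist_triangle[of _ _ "e * wp"]])
  have "Re wp = sqrt \<nu>1 * Lz" using p(1) by (simp add: wp_def Lz_def)
  moreover have "\<bar>Im wp\<bar> < sqrt \<nu>2 * Lz"
  proof (cases "y = 0")
    case False
    then have "(1 - u) * \<bar>y\<bar> < 1 * \<bar>y\<bar>" using u by (intro mult_strict_right_mono) auto
    moreover have "\<bar>Im wp\<bar> = (1 - u) * \<bar>y\<bar>" using u by (simp add: wp_def abs_mult)
    ultimately show ?thesis using p(2) by (simp add: y_def Lz_def)
  qed (use \<nu> Lz(1) in \<open>simp add: wp_def\<close>)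
  ultimately show False
  proof (rule no_continuation[of wp "\<rho> / 2" g])
    show "g holomorphic_on ball (e * wp) (\<rho> / 2)" using hol sub by (rule holomorphic_on_subset)
    show "g \<xi> = GT lam UNIV (\<xi>, z)" if "\<xi> \<in> ball (e * wp) (\<rho> / 2)" "\<bar>Re (\<xi> / e)\<bar> < sqrt \<nu>1 * Lz" "\<bar>Im (\<xi> / e)\<bar> < sqrt \<nu>2 * Lz" for \<xi>
      by (rule agree) (use that sub in \<open>auto simp: Lz_def\<close>)
  qed (use \<rho> in simp)
qed

section \<open>Holomorphy on the rectangle and its four sides\<close>

lemma REC_D:
  assumes "z \<noteq> 0"
  shows "\<xi> \<in> REC lam z \<longleftrightarrow> \<bar>Re (\<xi> / csqrt (2 * of_real pi * \<i> * lam))\<bar> < kappa_plus lam * ln (1 / norm z) \<and>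
      \<bar>Im (\<xi> / csqrt (2 * of_real pi * \<i> * lam))\<bar> < kappa_minus lam * ln (1 / norm z)"
  using assms by (simp add: REC_def)

lemma GT_holomorphic2:
  assumes rot: "rotated c \<alpha> lam e 1" and root: "e = csqrt (2 * of_real pi * \<i> * lam)"
    and lag: "lagrange \<alpha> 1 (nu_plus lam)" "lagrange \<alpha> (-1) (nu_minus lam)" and r: "0 < r" "r < 1"
  shows "holomorphic2_on (GT lam UNIV) {(\<xi>, z). z \<in> ball 0 r \<and> \<xi> \<in> REC lam z}"
  unfolding holomorphic2_on_def
proof clarify
  fix \<xi> z assume z: "z \<in> ball 0 r" and \<xi>: "\<xi> \<in> REC lam z"
  interpret rotated c \<alpha> lam e 1 by (rule rot)
  define \<kappa>1 \<kappa>2 where "\<kappa>1 = kappa_plus lam" and "\<kappa>2 = kappa_minus lam"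
  have \<kappa>: "0 < \<kappa>1" "0 < \<kappa>2" using lag by (auto simp: \<kappa>1_def \<kappa>2_def kappa_plus_def kappa_minus_def lagrange_def)
  have sp: "sparse_set UNIV m1 m2" if "0 < m1" "m1 < \<kappa>1" "0 < m2" "m2 < \<kappa>2" for m1 m2
    by (rule sparse_UNIV[of "nu_plus lam" "nu_minus lam"]) (use lag that in \<open>auto simp: \<kappa>1_def \<kappa>2_def kappa_plus_def kappa_minus_def\<close>)
  show "\<exists>a b. (GT lam UNIV has_derivative (\<lambda>(h, k). a * h + b * k)) (at (\<xi>, z))"
  proof (cases "z = 0")
    case True
    \<comment> \<open>At z = 0 every L is allowed; it is taken so large that the rectangle for
      halved kappas contains \<xi>.\<close>
    define L where "L = max (\<bar>Re (\<xi> / e)\<bar> / (\<kappa>1 / 2)) (\<bar>Im (\<xi> / e)\<bar> / (\<kappa>2 / 2)) + 1"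
    have "\<bar>Re (\<xi> / e)\<bar> / (\<kappa>1 / 2) < L" "\<bar>Im (\<xi> / e)\<bar> / (\<kappa>2 / 2) < L" by (auto simp: L_def)
    then have b: "\<bar>Re (\<xi> / e)\<bar> < \<kappa>1 / 2 * L" "\<bar>Im (\<xi> / e)\<bar> < \<kappa>2 / 2 * L" using \<kappa> by (auto simp: field_simps)
    have L: "0 \<le> L" using \<kappa> by (auto simp: L_def le_max_iff_disj intro: add_nonneg_nonneg)
    show ?thesis by (rule GT_local(2)[OF sp L _ _ b, of "L + 1"]) (use \<kappa> True in auto)
  next
    case False
    define \<Lambda> where "\<Lambda> = ln (1 / norm z)"
    have "1 < 1 / norm z" using z r False by (simp add: field_simps)
    then have \<Lambda>: "0 < \<Lambda>" unfolding \<Lambda>_def by (rule ln_gt_zero)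
    have b: "\<bar>Re (\<xi> / e)\<bar> < \<kappa>1 * \<Lambda>" "\<bar>Im (\<xi> / e)\<bar> < \<kappa>2 * \<Lambda>"
      using \<xi> unfolding REC_D[OF False] by (simp_all only: \<kappa>1_def \<kappa>2_def \<Lambda>_def root)
    define q where "q = max (\<bar>Re (\<xi> / e)\<bar> / (\<kappa>1 * \<Lambda>)) (\<bar>Im (\<xi> / e)\<bar> / (\<kappa>2 * \<Lambda>))"
    have p0: "0 < \<kappa>1 * \<Lambda>" "0 < \<kappa>2 * \<Lambda>" using \<kappa> \<Lambda> by auto
    have "\<bar>Re (\<xi> / e)\<bar> / (\<kappa>1 * \<Lambda>) < 1" "\<bar>Im (\<xi> / e)\<bar> / (\<kappa>2 * \<Lambda>) < 1"
      using b p0 by (simp_all only: pos_divide_less_eq mult_1)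
    moreover have "0 \<le> \<bar>Re (\<xi> / e)\<bar> / (\<kappa>1 * \<Lambda>)" using p0 by (intro divide_nonneg_pos) auto
    ultimately have q: "0 \<le> q" "q < 1" by (auto simp: q_def le_max_iff_disj)
    \<comment> \<open>The square root shares the available room between two shrinkings: of the
      kappas, for \<open>sparse_UNIV\<close>, and of \<Lambda>, for |z| < exp (-L').\<close>
    define t where "t = sqrt ((1 + q) / 2)"
    have t2: "t\<^sup>2 = (1 + q) / 2" using q by (simp add: t_def)
    have t: "0 < t" "t < 1" "q < t\<^sup>2" unfolding t2 using q by (auto simp: t_def)
    have "\<bar>Re (\<xi> / e)\<bar> / (\<kappa>1 * \<Lambda>) < t\<^sup>2" "\<bar>Im (\<xi> / e)\<bar> / (\<kappa>2 * \<Lambda>) < t\<^sup>2" using t(3) by (auto simp: q_def)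
    then have "\<bar>Re (\<xi> / e)\<bar> < t\<^sup>2 * (\<kappa>1 * \<Lambda>)" "\<bar>Im (\<xi> / e)\<bar> < t\<^sup>2 * (\<kappa>2 * \<Lambda>)"
      using p0 by (simp_all only: pos_divide_less_eq)
    then have b': "\<bar>Re (\<xi> / e)\<bar> < (t * \<kappa>1) * (t * \<Lambda>)" "\<bar>Im (\<xi> / e)\<bar> < (t * \<kappa>2) * (t * \<Lambda>)"
      by (simp_all only: power2_eq_square mult_ac)
    show ?thesis
    proof (rule GT_local(2)[OF sp _ _ _ b', of "(1 + t) / 2 * \<Lambda>"])
      show "0 \<le> t * \<Lambda>" "t * \<Lambda> < (1 + t) / 2 * \<Lambda>" using t \<Lambda> by auto
      have "norm z = exp (- \<Lambda>)" using False by (simp add: \<Lambda>_def ln_div)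
      moreover have "(1 + t) / 2 * \<Lambda> < 1 * \<Lambda>" using t \<Lambda> by (intro mult_strict_right_mono) auto
      ultimately show "norm z < exp (- ((1 + t) / 2 * \<Lambda>))" by simp
    qed (use t \<kappa> in auto)
  qed
qed

text \<open>A factor \<i> changes the sign of e^2, hence of \<open>s\<close>, and exchanges the real
  and imaginary directions; a change of sign of \<open>e\<close> exchanges opposite sides.\<close>

lemma rotated_turn:
  assumes "rotated c \<alpha> lam e 1" shows
    "rotated c \<alpha> lam (- e) 1" "rotated c \<alpha> lam (\<i> * e) (-1)" "rotated c \<alpha> lam (- (\<i> * e)) (-1)"
  using assms by (auto simp: rotated_def power_mult_distrib)

text \<open>For the two sides given by the imaginary part, the turned coordinate interchanges the
  roles of \<open>nu_plus\<close> and \<open>nu_minus\<close>.\<close>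

lemma GT_natural_boundary:
  assumes rot: "rotated c \<alpha> lam e 1" and root: "e = csqrt (2 * of_real pi * \<i> * lam)"
    and lag: "lagrange \<alpha> 1 (nu_plus lam)" "lagrange \<alpha> (-1) (nu_minus lam)" and z: "norm z < 1"
  shows "natural_boundary (\<lambda>\<xi>. GT lam UNIV (\<xi>, z)) (REC lam z)"
proof (cases "z = 0")
  case True
  then show ?thesis by (simp add: natural_boundary_def REC_def)
next
  case False
  define \<Lambda> where "\<Lambda> = ln (1 / norm z)"
  define \<kappa>1 \<kappa>2 where "\<kappa>1 = sqrt (nu_plus lam)" and "\<kappa>2 = sqrt (nu_minus lam)"
  have e0: "e \<noteq> 0" by (rule rotated.e0[OF rot])
  have REC: "\<xi> \<in> REC lam z \<longleftrightarrow> \<bar>Re (\<xi> / e)\<bar> < \<kappa>1 * \<Lambda> \<and> \<bar>Im (\<xi> / e)\<bar> < \<kappa>2 * \<Lambda>" for \<xi>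
    unfolding REC_D[OF False] by (simp only: root \<kappa>1_def \<kappa>2_def \<Lambda>_def kappa_plus_def kappa_minus_def)
  show ?thesis unfolding natural_boundary_def
  proof (intro ballI notI, elim exE conjE)
    fix p \<rho> g
    assume p: "p \<in> frontier (REC lam z)" and \<rho>: "0 < \<rho>" and hol: "g holomorphic_on ball p \<rho>"
      and agree: "\<forall>x\<in>ball p \<rho> \<inter> REC lam z. g x = GT lam UNIV (x, z)"
    have Req: "REC lam z = {\<xi>. \<bar>Re (\<xi> / e)\<bar> < \<kappa>1 * \<Lambda>} \<inter> {\<xi>. \<bar>Im (\<xi> / e)\<bar> < \<kappa>2 * \<Lambda>}" using REC by auto
    have "open (REC lam z)" unfolding Req using e0
      by (intro open_Int open_Collect_less continuous_intros) auto
    then have notin: "p \<notin> REC lam z" using p by (simp add: frontier_def interior_open)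
    have "closed ({\<xi>. \<bar>Re (\<xi> / e)\<bar> \<le> \<kappa>1 * \<Lambda>} \<inter> {\<xi>. \<bar>Im (\<xi> / e)\<bar> \<le> \<kappa>2 * \<Lambda>})" using e0
      by (intro closed_Int closed_Collect_le continuous_intros) auto
    then have "closure (REC lam z) \<subseteq> {\<xi>. \<bar>Re (\<xi> / e)\<bar> \<le> \<kappa>1 * \<Lambda>} \<inter> {\<xi>. \<bar>Im (\<xi> / e)\<bar> \<le> \<kappa>2 * \<Lambda>}"
      by (intro closure_minimal) (auto simp: REC)
    then have le: "\<bar>Re (p / e)\<bar> \<le> \<kappa>1 * \<Lambda>" "\<bar>Im (p / e)\<bar> \<le> \<kappa>2 * \<Lambda>" using p by (auto simp: frontier_def)
    with notin consider "Re (p / e) = \<kappa>1 * \<Lambda>" | "- Re (p / e) = \<kappa>1 * \<Lambda>" | "Im (p / e) = \<kappa>2 * \<Lambda>" | "- Im (p / e) = \<kappa>2 * \<Lambda>"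
      unfolding REC by linarith
    then show False
    proof cases
      case 1
      show False
      proof (rule rotated.side_no_continuation[OF rot False z, of "nu_plus lam" "nu_minus lam" p \<rho> g])
        show "Re (p / e) = sqrt (nu_plus lam) * ln (1 / norm z)" using 1 by (simp only: \<kappa>1_def \<Lambda>_def)
        show "\<bar>Im (p / e)\<bar> \<le> sqrt (nu_minus lam) * ln (1 / norm z)" using le by (simp only: \<kappa>2_def \<Lambda>_def)
      qed (use lag \<rho> hol agree in \<open>auto simp: REC \<kappa>1_def \<kappa>2_def \<Lambda>_def\<close>)
    next
      case 2
      show False
      proof (rule rotated.side_no_continuation[OF rotated_turn(1)[OF rot] False z, of "nu_plus lam" "nu_minus lam" p \<rho> g])
        show "Re (p / (- e)) = sqrt (nu_plus lam) * ln (1 / norm z)" using 2 by (simp add: \<kappa>1_def \<Lambda>_def)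
        show "\<bar>Im (p / (- e))\<bar> \<le> sqrt (nu_minus lam) * ln (1 / norm z)" using le by (simp add: \<kappa>2_def \<Lambda>_def)
      qed (use lag \<rho> hol agree in \<open>auto simp: REC \<kappa>1_def \<kappa>2_def \<Lambda>_def\<close>)
    next
      case 3
      have "x / (\<i> * e) = - (\<i> * (x / e))" for x using e0 by (simp add: field_simps)
      then have q: "Re (x / (\<i> * e)) = Im (x / e)" "Im (x / (\<i> * e)) = - Re (x / e)" for x
        by (simp_all del: times_divide_eq_right)
      show False
      proof (rule rotated.side_no_continuation[OF rotated_turn(2)[OF rot] False z, of "nu_minus lam" "nu_plus lam" p \<rho> g])
        show "Re (p / (\<i> * e)) = sqrt (nu_minus lam) * ln (1 / norm z)" using 3 unfolding q by (simp add: \<kappa>2_def \<Lambda>_def)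
        show "\<bar>Im (p / (\<i> * e))\<bar> \<le> sqrt (nu_plus lam) * ln (1 / norm z)" using le unfolding q by (simp add: \<kappa>1_def \<Lambda>_def)
        show "g \<xi> = GT lam UNIV (\<xi>, z)" if "\<xi> \<in> ball p \<rho>" "\<bar>Re (\<xi> / (\<i> * e))\<bar> < sqrt (nu_minus lam) * ln (1 / norm z)"
          "\<bar>Im (\<xi> / (\<i> * e))\<bar> < sqrt (nu_plus lam) * ln (1 / norm z)" for \<xi>
          using agree that unfolding q by (auto simp: REC \<kappa>1_def \<kappa>2_def \<Lambda>_def)
      qed (use lag \<rho> hol in auto)
    next
      case 4
      have "x / (- (\<i> * e)) = \<i> * (x / e)" for x using e0 by (simp add: field_simps)
      then have q: "Re (x / (- (\<i> * e))) = - Im (x / e)" "Im (x / (- (\<i> * e))) = Re (x / e)" for x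
        by (simp_all del: times_divide_eq_right)
      show False
      proof (rule rotated.side_no_continuation[OF rotated_turn(3)[OF rot] False z, of "nu_minus lam" "nu_plus lam" p \<rho> g])
        show "Re (p / (- (\<i> * e))) = sqrt (nu_minus lam) * ln (1 / norm z)" using 4 unfolding q by (simp add: \<kappa>2_def \<Lambda>_def)
        show "\<bar>Im (p / (- (\<i> * e)))\<bar> \<le> sqrt (nu_plus lam) * ln (1 / norm z)" using le unfolding q by (simp add: \<kappa>1_def \<Lambda>_def)
        show "g \<xi> = GT lam UNIV (\<xi>, z)" if "\<xi> \<in> ball p \<rho>" "\<bar>Re (\<xi> / (- (\<i> * e)))\<bar> < sqrt (nu_minus lam) * ln (1 / norm z)"
          "\<bar>Im (\<xi> / (- (\<i> * e)))\<bar> < sqrt (nu_plus lam) * ln (1 / norm z)" for \<xi>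
          using agree that unfolding q by (auto simp: REC \<kappa>1_def \<kappa>2_def \<Lambda>_def)
      qed (use lag \<rho> hol in auto)
    qed
  qed
qed

section \<open>Assembly of the three claims\<close>

lemma QI_E:
  assumes "lam \<in> QI"
  obtains \<alpha> c where "0 < \<alpha>" "\<alpha> < 1" "lam = cis (2 * pi * \<alpha>)" "angle lam = \<alpha>" "badly_approx c \<alpha>"
proof -
  obtain \<alpha> where \<alpha>: "0 < \<alpha>" "\<alpha> < 1" "quadratic_irrational \<alpha>" "lam = exp (2 * of_real pi * \<i> * of_real \<alpha>)"
    using assms by (auto simp: QI_def)
  obtain c where "badly_approx c \<alpha>" using quadratic_irrational_badly_approx[OF \<alpha>(3)] .
  moreover have "lam = cis (2 * pi * \<alpha>)" by (simp add: \<alpha>(4) cis_conv_exp mult_ac)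
  moreover have "angle lam = \<alpha>" unfolding \<alpha>(4) by (rule angle_exp[OF \<alpha>(1,2)])
  ultimately show ?thesis using that \<alpha>(1,2) by blast
qed

theorem theorem3p4:
  fixes r :: real and lam :: complex
  assumes "0 < r" and "r < 1" and "lam \<in> QI"
  shows "f_delta r \<in> gevrey2_class lam r \<and>
    (\<exists>G :: complex \<times> complex \<Rightarrow> complex.
       (\<exists>\<epsilon>>0. \<forall>\<xi>\<in>ball 0 \<epsilon>. \<forall>z\<in>ball 0 r.
          (\<lambda>n. gevrey2_exp lam r (f_delta r) n z * \<xi> ^ (2 * n) / fact (2 * n)) sums G (\<xi>, z)) \<and>
       holomorphic2_on G {(\<xi>, z). z \<in> ball 0 r \<and> \<xi> \<in> REC lam z} \<and>
       (\<forall>z\<in>ball 0 r. natural_boundary (\<lambda>\<xi>. G (\<xi>, z)) (REC lam z))) \<and>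
    (\<forall>M :: nat \<Rightarrow> real.
       (\<forall>n. 0 < M n) \<and> mono M \<and>
       (f_delta r \<in> carleman_class inner_disc lam M r \<or>
        f_delta r \<in> carleman_class outer_disc lam M r) \<longrightarrow>
       \<not> quasianalytic inner_disc lam M r \<and> \<not> quasianalytic outer_disc lam M r)"
proof -
  obtain \<alpha> c where \<alpha>: "0 < \<alpha>" "\<alpha> < 1" and lam: "lam = cis (2 * pi * \<alpha>)" and ang: "angle lam = \<alpha>" and bad: "badly_approx c \<alpha>"
    using QI_E[OF assms(3)] .
  have lam1: "norm lam = 1" by (simp add: lam)
  note lag = lagrange_nu[OF bad ang]
  define e where "e = csqrt (2 * of_real pi * \<i> * lam)"
  have rot: "rotated c \<alpha> lam e 1"
    by unfold_locales (use \<alpha> lam bad in \<open>auto simp: e_def\<close>)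
  interpret rotated c \<alpha> lam e 1 by (rule rot)
  have gev: "gevrey2_expansion lam r (f_delta r) (\<lambda>n. pser r (coefF lam n))"
  proof (rule f_delta_gevrey)
    show "0 < 2 * c" using c by simp
    show "2 * c / (real k)\<^sup>2 \<le> norm (rt k j - lam)" if "1 \<le> k" for k j using rt_gap[OF bad that] by (simp add: lam)
  qed (use lam1 assms in auto)
  have J: "gevrey2_exp lam r (f_delta r) = (\<lambda>n. pser r (coefF lam n))"
    by (rule gevrey2_exp_eq[OF gev lam1])
  obtain \<epsilon> where \<epsilon>: "0 < \<epsilon>" "\<And>\<xi> z. \<xi> \<in> ball 0 \<epsilon> \<Longrightarrow> z \<in> ball 0 r \<Longrightarrow>
     (\<lambda>n. pser r (coefF lam n) z * \<xi> ^ (2 * n) / fact (2 * n)) sums GT lam UNIV (\<xi>, z)"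
    by (rule GT_germ[OF assms(1,2)]) (rule that)
  have nonqa: "\<not> quasianalytic inner_disc lam M r \<and> \<not> quasianalytic outer_disc lam M r"
    if M: "\<And>n. 0 < M n" and U: "disk_side U \<tau>" and f: "f_delta r \<in> carleman_class U lam M r" for M U \<tau>
  proof -
    obtain a where a: "carleman_expansion U lam M r (f_delta r) a" using f by (auto simp: carleman_class_def)
    have "carleman_expansion U lam (\<lambda>n. Gamma (1 + 2 * real n)) r (f_delta r) (\<lambda>n. pser r (coefF lam n))"
      using gev U by (auto simp: gevrey2_expansion_def disk_side_def)
    \<comment> \<open>Uniqueness across different weights makes the coefficients explicit, so their
      growth can be compared with \<open>M\<close>.\<close>
    then have a_eq: "a = (\<lambda>n. pser r (coefF lam n))" using carleman_expansion_unique[OF a _ U lam1] by blast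
    obtain A B where AB: "0 < A" "0 < B" "\<And>n z. z \<in> ball 0 r \<Longrightarrow> norm (a n z) \<le> A * B ^ n * M n"
      by (rule carleman_coeff_bound[OF a U lam1]) (rule that)
    obtain c' d where cd: "0 < c'" "0 < d" "\<And>n. c' * d ^ n * fact (2 * n) \<le> M n"
      by (rule weights_lower[OF bad lam assms(1,2) M AB[unfolded a_eq]]) (assumption, rule that)
    \<comment> \<open>The lower bound on the weights does not refer to a side, so membership on one
      side excludes quasianalyticity on both.\<close>
    show ?thesis
      using not_quasianalytic[of inner_disc "-1", OF _ lam1 assms(1,2) cd] not_quasianalytic[of outer_disc 1, OF _ lam1 assms(1,2) cd]
      by (simp add: disk_side_def)
  qed
  show ?thesis
  proof (intro conjI exI[of _ "GT lam UNIV"] exI[of _ \<epsilon>] allI impI ballI)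
    show "f_delta r \<in> gevrey2_class lam r" using gev by (auto simp: gevrey2_class_def)
    show "(\<lambda>n. gevrey2_exp lam r (f_delta r) n z * \<xi> ^ (2 * n) / fact (2 * n)) sums GT lam UNIV (\<xi>, z)"
      if "\<xi> \<in> ball 0 \<epsilon>" "z \<in> ball 0 r" for \<xi> z unfolding J by (rule \<epsilon>(2)[OF that])
    show "holomorphic2_on (GT lam UNIV) {(\<xi>, z). z \<in> ball 0 r \<and> \<xi> \<in> REC lam z}"
      by (rule GT_holomorphic2[OF rot e_def lag assms(1,2)])
    show "natural_boundary (\<lambda>\<xi>. GT lam UNIV (\<xi>, z)) (REC lam z)" if "z \<in> ball 0 r" for z
      by (rule GT_natural_boundary[OF rot e_def lag]) (use that assms in simp)
    fix M :: "nat \<Rightarrow> real"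
    assume M: "(\<forall>n. 0 < M n) \<and> mono M \<and>
       (f_delta r \<in> carleman_class inner_disc lam M r \<or> f_delta r \<in> carleman_class outer_disc lam M r)"
    then show "\<not> quasianalytic inner_disc lam M r" "\<not> quasianalytic outer_disc lam M r"
      using nonqa[of M inner_disc "-1"] nonqa[of M outer_disc 1] by (auto simp: disk_side_def)
  qed (rule \<epsilon>(1))
qed

end
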